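(* Consider the ODE $\dfrac{df}{dz}=\dfrac{Pf}{z}+\dfrac{Qf}{1-z}$ for $f$ with values in $\mathbb C^N$, where $P,Q\in\mathrm{End}(\mathbb C^N)$ satisfy the following: - $Q(x)=\phi(x)v$ with $\phi\in(\mathbb C^N)^*$, $v\in\mathbb C^N$ and $\phi(v)=\delta\neq0$; - $P$ has distinct eigenvalues $\lambda_1,\dots,\lambda_N$, no two differing by a positive integer, and $Q$ is in general position with respect to $P$; - $R=Q-P$ has distinct eigenvalues $-\mu_1,\dots,-\mu_N$, no two of the $\mu_j$ differing by a positive integer, and $Q$ is in general position with respect to $R$. Let $\xi_i$ be eigenvectors of $P$ ($P\xi_i=\lambda_i\xi_i$) and $\zeta_j$ eigenvectors of $R$ ($R\zeta_j=-\mu_j\zeta_j$), normalised by $\phi(\xi_i)=1=\phi(\zeta_j)$. Let $f_i(z)=\sum_{n\ge0}\xi_{i,n}z^{\lambda_i+n}$ with $\xi_{i,0}=\xi_i$, and $h_j(z)=\sum_{n\ge0}\zeta_{j,n}z^{\mu_j-n}$ with $\zeta_{j,0}=\zeta_j$, be the formal series solutions of the ODE. Then $f_i$ converges on $\{|z|<1\}\setminus[0,1)$ and $h_j$ on $\{|z|>1\}\setminus[1,\infty)$. Both extend to single-valued holomorphic functions on $\mathbb C\setminus[0,\infty)$, and there $f_i=\sum_jc_{ij}h_j$ with $$c_{ij}=e^{i\pi(\lambda_i-\mu_j)}\frac{\prod_{k\ne i}\Gamma(\lambda_i-\lambda_k+1)\prod_{m\ne j}\Gamma(\mu_j-\mu_m)}{\prod_{m\ne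 j}\Gamma(\lambda_i-\mu_m+1)\prod_{k\ne i}\Gamma(\mu_j-\lambda_k)}.$$
   Context: "$Q$ in general position with respect to $P$" means: $P$ has a basis of eigenvectors $\xi_i$ with $\phi(\xi_i)\ne0$ for all $i$, and writing $v=\sum_i\delta_i\xi_i$ one has $\delta_i\ne0$ for all $i$ (similarly for $R$). Complex powers are taken as $z^s=\exp(s\log z)$ with $\arg z\in(0,2\pi)$ on $\mathbb C\setminus[0,\infty)$. $1/\Gamma$ is understood as an entire function. *)

theory Defs
  imports "HOL-Analysis.Analysis"
begin

text \<open>Vectors in C^N are modelled as complex^'n with a finite index type 'n (N = CARD('n));
  endomorphisms as matrices complex^'n^'n acting by *v; a covector phi in (C^N)^* as a
  vector acting by the pairing below.\<close>

definition dual_app :: "complex^'n \<Rightarrow> complex^'n \<Rightarrow> complex" where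
  "dual_app phi x = (\<Sum>k\<in>UNIV. phi $ k * x $ k)"

text \<open>Logarithm with argument in (0, 2 pi), defined on C minus [0,infinity).\<close>
definition cut_log :: "complex \<Rightarrow> complex" where
  "cut_log z = (THE w. exp w = z \<and> 0 < Im w \<and> Im w < 2 * pi)"

definition cut_pow :: "complex \<Rightarrow> complex \<Rightarrow> complex" where
  "cut_pow z s = exp (s * cut_log z)"

text \<open>Formal solution sum_n a_n z^(lam+n) of z(1-z) f' = (1-z) P f + z Q f
  (i.e. of f' = P f / z + Q f/(1-z)): comparison of the coefficients of z^(lam+n).\<close>
definition formal_sol0 :: "complex^'n^'n \<Rightarrow> complex^'n^'n \<Rightarrow> complex \<Rightarrow> (nat \<Rightarrow> complex^'n) \<Rightarrow> bool" where
  "formal_sol0 P Q lam a \<longleftrightarrow>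
     lam *s a 0 = P *v a 0 \<and>
     (\<forall>n\<ge>1. (lam + of_nat n) *s a n - (lam + of_nat n - 1) *s a (n - 1)
             = P *v a n - P *v a (n - 1) + Q *v a (n - 1))"

text \<open>Formal solution sum_n b_n z^(mu-n) of the same equation: comparison of the
  coefficients of z^(mu-n+1).\<close>
definition formal_sol_inf :: "complex^'n^'n \<Rightarrow> complex^'n^'n \<Rightarrow> complex \<Rightarrow> (nat \<Rightarrow> complex^'n) \<Rightarrow> bool" where
  "formal_sol_inf P Q mu b \<longleftrightarrow>
     - (mu *s b 0) = - (P *v b 0) + Q *v b 0 \<and>
     (\<forall>n\<ge>1. (mu - of_nat n + 1) *s b (n - 1) - (mu - of_nat n) *s b n
             = P *v b (n - 1) - P *v b n + Q *v b n)"

definition no_pos_int_diff :: "('n \<Rightarrow> complex) \<Rightarrow> bool" where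
  "no_pos_int_diff l \<longleftrightarrow> (\<forall>i k. \<forall>m::nat. m > 0 \<longrightarrow> l i - l k \<noteq> of_nat m)"

end

theory Submission
  imports Defs "HOL-Complex_Analysis.Complex_Analysis" "HOL-Real_Asymp.Real_Asymp"
begin

text \<open>Idea: in the basis of eigenvectors of P the coordinates of the coefficients of f_i are values of
  quotients of Gamma functions, because 1 + phi((t - P)^{-1} v) = prod (t - mu_j) / prod (t - lam_k).
  Hence both series are sums of residues of one Mellin-Barnes kernel z^t U(t), whose poles are
  lam_i + n and mu_j - n and which satisfies (t + 1 - P) U(t+1) = (t - P + Q) U(t). Integrals along
  vertical lines converge on the whole slit plane; moving the line to the right gives f_i for |z| < 1,
  moving it to the left gives the combination of the h_j for |z| > 1. The recurrence passes to the
  residues, so they are proportional to the given coefficients, and only the two leading residues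
  have to be computed. With w = log z the slit plane becomes the convex strip 0 < Im w < 2 pi.\<close>

subsection \<open>Bounds for Gamma quotients and the sine\<close>

text \<open>The recurrence fixes a kernel only up to 1-periodic factors. The factor used is exp(-i
  pi t) pi / sin(pi (t - lam i)): it places poles at lam i + n for this one i, and its modulus
  behaves like exp(pi Im t - pi |Im t|). Multiplied by |exp(w t)| it decays at both ends of a
  vertical line when 0 < Im w < 2 pi, which is the branch arg z in (0, 2 pi). The leading residues
  carry the phases exp(-i pi lam i) and exp(-i pi mu j); their ratio is the phase of c_ij. Two
  obstacles shape the proof. If mu j - lam i is a natural number, the two pole sequences collide and
  the poles need not be simple; that case is settled algebraically. And moving the line to the left
  controls only the combined partial sums of all h_j. That each h_j converges and continues to the
  slit plane follows from the same result for Q - P, that is, after z -> 1/z, which acts on the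
  strip as w -> 2 pi i - w.\<close>

lemma norm_one_plus_le_exp:
  fixes w :: complex
  shows "norm (1 + w) \<le> exp (Re w + (norm w)\<^sup>2 / 2)"
proof (rule power2_le_imp_le)
  have "(norm (1 + w))\<^sup>2 = 1 + (2 * Re w + (norm w)\<^sup>2)"
    unfolding cmod_power2 by (simp add: power2_eq_square algebra_simps)
  also have "\<dots> \<le> exp (2 * Re w + (norm w)\<^sup>2)"
    by (rule exp_ge_add_one_self)
  also have "\<dots> = (exp (Re w + (norm w)\<^sup>2 / 2))\<^sup>2"
    by (simp add: power2_eq_square flip: exp_add)
  finally show "(norm (1 + w))\<^sup>2 \<le> (exp (Re w + (norm w)\<^sup>2 / 2))\<^sup>2" .
qed simp

lemma harm_conv_sum_lessThan: "(harm n :: real) = (\<Sum>m<n. 1 / (1 + real m))"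
  by (induction n) (auto simp: harm_Suc harm_expand(1) divide_inverse)

text \<open>Euler's limit turns the quotient into a product of factors 1 + a/(t+m). Replacing
  a/(t+m) by a/(1+m) produces a harmonic sum that cancels the power of n, and the error is of order
  sqrt |t| (1+m)^(-3/2), which is summable in m. The preceding lemma keeps the signed first-order
  term Re w, without which the cancellation would be lost.\<close>

lemma Gamma_ratio_bound_right:
  fixes a :: complex
  shows "\<exists>C\<ge>0. \<forall>t. Re t \<ge> 1 \<longrightarrow> norm (Gamma t * rGamma (t + a)) \<le> exp (C * (1 + sqrt (norm t)))"
proof -
  let ?f = "\<lambda>m::nat. (1 + real m) powr (-3/2)"
  let ?g = "\<lambda>m::nat. 1 / (1 + real m)^2"
  have "summable (\<lambda>m::nat. real m powr (-3/2))"
    by (subst summable_real_powr_iff) simp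
  then have sf: "summable ?f" 
    by (subst (asm) summable_Suc_iff [symmetric]) (simp add: add_ac)
  have "summable (\<lambda>m::nat. 1 / real m ^ 2)"
    using inverse_power_summable[of 2, where 'a=real] by (simp add: field_simps)
  then have sg: "summable ?g"
    by (subst (asm) summable_Suc_iff [symmetric]) (simp add: add_ac)
  define Z1 where "Z1 = suminf ?f"
  define Z2 where "Z2 = suminf ?g"
  have Z1: "sum ?f A \<le> Z1" if "finite A" for A
    unfolding Z1_def using sf that by (intro sum_le_suminf) auto
  have Z2: "sum ?g A \<le> Z2" if "finite A" for A
    unfolding Z2_def using sg that by (intro sum_le_suminf) auto
  have Z0: "Z1 \<ge> 0" "Z2 \<ge> 0"
    using Z1[of "{}"] Z2[of "{}"] by auto
  have "Bseq (\<lambda>n. harm n - ln (real n))"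
    using euler_mascheroni_LIMSEQ convergent_imp_Bseq convergent_def by blast
  then obtain K where K: "\<And>n. \<bar>harm n - ln (real n)\<bar> \<le> K" 
    unfolding Bseq_def by auto
  have K0: "K \<ge> 0" using K[of 0] by linarith
  \<comment> \<open>\<open>K + 1\<close> bounds |harm (n+1) - ln n|, \<open>2 * Z1\<close> is the
    cost of replacing a/(t+m) by a/(1+m), and \<open>Z2\<close> sums the quadratic terms.\<close>
  define C where "C = norm a * (K + 1) + norm a * (2 * Z1) + (norm a)\<^sup>2 / 2 * Z2"
  have C0: "C \<ge> 0" unfolding C_def using Z0 K0 by (intro add_nonneg_nonneg mult_nonneg_nonneg) auto
  show ?thesis
  proof (intro exI[of _ C] conjI allI impI C0)
    fix t :: complex assume t: "Re t \<ge> 1"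
    have t1: "norm t \<ge> 1" using t complex_Re_le_cmod[of t] by linarith
    have tm: "norm (t + of_nat m) \<ge> 1 + real m" for m
      using t complex_Re_le_cmod[of "t + of_nat m"] by simp
    have tm': "norm (t + of_nat m) \<ge> norm t" for m
    proof -
      have "(norm t)\<^sup>2 \<le> (norm (t + of_nat m))\<^sup>2"
        unfolding cmod_power2 using t by (auto intro!: power_mono)
      then show ?thesis by (rule power2_le_imp_le) simp
    qed
    have tn0: "t + of_nat m \<noteq> 0" for m using tm[of m] by (auto simp del: of_nat_0_le_iff)
    have lim: "(\<lambda>n. Gamma_series t n * rGamma_series (t + a) n) \<longlonglongrightarrow> Gamma t * rGamma (t + a)"
      by (intro tendsto_mult Gamma_series_LIMSEQ rGamma_series_LIMSEQ)
    have bd: "norm (Gamma_series t n * rGamma_series (t + a) n) \<le> exp (C * (1 + sqrt (norm t)))"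
      if n: "n \<ge> 1" for n
    proof -
      have "Gamma_series t n * rGamma_series (t + a) n
             = pochhammer (t + a) (n+1) / pochhammer t (n+1) * exp (- a * of_real (ln (real n)))"
      proof -
        have "exp (- a * of_real (ln (real n))) = exp (t * of_real (ln (real n))) / exp ((t + a) * of_real (ln (real n)))"
          by (simp add: algebra_simps flip: exp_diff)
        then show ?thesis
          unfolding Gamma_series_def rGamma_series_def by simp
      qed
      also have "pochhammer (t + a) (n+1) / pochhammer t (n+1) = (\<Prod>m<n+1. 1 + a / (t + of_nat m))"
        unfolding pochhammer_prod prod_dividef[symmetric] atLeast0LessThan
        using tn0 by (intro prod.cong) (auto simp: field_simps)
      finally have eq: "norm (Gamma_series t n * rGamma_series (t + a) n)
          = (\<Prod>m<n+1. norm (1 + a / (t + of_nat m))) * exp (- Re a * ln (real n))"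
        by (simp add: norm_mult prod_norm)
      have "(\<Prod>m<n+1. norm (1 + a / (t + of_nat m))) 
          \<le> (\<Prod>m<n+1. exp (Re a * (1 / (1 + real m)) + norm a * (2 * sqrt (norm t) * ?f m) + (norm a)\<^sup>2 / 2 * ?g m))"
      proof (intro prod_mono conjI)
        fix m
        have "norm (1 + a / (t + of_nat m)) \<le> exp (Re (a / (t + of_nat m)) + (norm (a / (t + of_nat m)))\<^sup>2 / 2)"
          by (rule norm_one_plus_le_exp)
        also have "\<dots> \<le> exp (Re a * (1 / (1 + real m)) + norm a * (2 * sqrt (norm t) * ?f m) + (norm a)\<^sup>2 / 2 * ?g m)"
        proof -
          have aux: "Re (x / y) - Re x * (1 / r) = Re (x * (1 / y - 1 / of_real r))" for x y :: complex and r :: real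
          proof -
            have "x * (1 / y - 1 / of_real r) = x / y - x * of_real (1 / r)"
              by (simp add: right_diff_distrib)
            then show ?thesis by simp
          qed
          have "Re (a / (t + of_nat m)) - Re a * (1 / (1 + real m)) = Re (a * (1 / (t + of_nat m) - 1 / of_real (1 + real m)))"
            by (rule aux)
          also have "\<dots> \<le> norm (a * (1 / (t + of_nat m) - 1 / of_real (1 + real m)))"
            by (rule complex_Re_le_cmod)
          also have "1 / (t + of_nat m) - 1 / of_real (1 + real m) = (1 - t) / ((t + of_nat m) * of_real (1 + real m))"
          proof -
            have "of_real (1 + real m) \<noteq> (0 :: complex)"
              unfolding of_real_eq_0_iff by linarith
            then have "1 / (t + of_nat m) - 1 / of_real (1 + real m)
                = (of_real (1 + real m) - (t + of_nat m)) / ((t + of_nat m) * of_real (1 + real m))"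
              using diff_frac_eq[OF tn0[of m], of "of_real (1 + real m)" 1 1] by simp
            then show ?thesis by simp
          qed
          also have "norm (a * \<dots>) = norm a * (norm (1 - t) / (norm (t + of_nat m) * (1 + real m)))"
            by (simp add: norm_mult norm_divide del: of_real_add)
          also have "norm (1 - t) / (norm (t + of_nat m) * (1 + real m)) \<le> 2 * sqrt (norm t) * ?f m"
          proof -
            have "norm (1 - t) \<le> 2 * norm t" using norm_triangle_ineq4[of 1 t] t1 by simp
            \<comment> \<open>The geometric mean of the two lower bounds |t| and 1 + m for |t + m|;
              it leaves only sqrt |t| and still gives a summable power of m.\<close>
            moreover have "sqrt (norm t) * sqrt (1 + real m) \<le> norm (t + of_nat m)"
            proof -
              have "norm t * (1 + real m) \<le> norm (t + of_nat m) * norm (t + of_nat m)"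
                by (intro mult_mono tm tm') auto
              then show ?thesis 
                by (metis real_sqrt_le_mono real_sqrt_mult real_sqrt_mult_self abs_norm_cancel)
            qed
            ultimately have "norm (1 - t) / (norm (t + of_nat m) * (1 + real m)) 
                \<le> (2 * norm t) / ((sqrt (norm t) * sqrt (1 + real m)) * (1 + real m))"
              using t1 by (intro frac_le mult_right_mono mult_pos_pos) auto
            also have "\<dots> = 2 * sqrt (norm t) * ?f m"
            proof -
              have "(1 + real m) powr (-3/2) = 1 / (sqrt (1 + real m) * (1 + real m))"
              proof -
                have "(1 + real m) powr (-3/2) = (1 + real m) powr (-(1/2)) * (1 + real m) powr (-1)"
                  unfolding powr_add [symmetric] by simp
                also have "\<dots> = 1 / (sqrt (1 + real m) * (1 + real m))"
                proof -
                  have "(1 + real m) powr (-1) = inverse (1 + real m)"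
                    unfolding powr_minus by simp
                  moreover have "(1 + real m) powr (-(1/2)) = inverse (sqrt (1 + real m))"
                    unfolding powr_minus by (subst powr_half_sqrt) auto
                  ultimately show ?thesis
                    unfolding divide_inverse inverse_mult_distrib by (simp only: mult_1_left)
                qed
                finally show ?thesis .
              qed
              moreover have "2 * (x * x) / ((x * S) * R) = 2 * x * (1 / (S * R))" if "x > 0" for x S R :: real
                using that by simp
              from this[of "sqrt (norm t)"] have "2 * norm t / ((sqrt (norm t) * S) * R) = 2 * sqrt (norm t) * (1 / (S * R))" for S R
                using t1 by fastforce
              ultimately show ?thesis by (simp only:)
            qed
            finally show ?thesis .
          qed
          finally have 1: "Re (a / (t + of_nat m)) \<le> Re a * (1 / (1 + real m)) + norm a * (2 * sqrt (norm t) * ?f m)"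
            by (simp add: mult_left_mono)
          have "(norm (a / (t + of_nat m)))\<^sup>2 \<le> (norm a / (1 + real m))\<^sup>2"
            unfolding norm_divide using tm[of m] by (intro power_mono divide_left_mono mult_pos_pos) (auto intro: less_le_trans)
          then have 2: "(norm (a / (t + of_nat m)))\<^sup>2 / 2 \<le> (norm a)\<^sup>2 / 2 * ?g m"
            by (simp add: power_divide)
          show ?thesis using 1 2 by simp
        qed
        finally show "norm (1 + a / (t + of_nat m)) \<le> exp (Re a * (1 / (1 + real m)) + norm a * (2 * sqrt (norm t) * ?f m) + (norm a)\<^sup>2 / 2 * ?g m)" .
      qed simp
      also have "\<dots> = exp (Re a * harm (n+1) + norm a * (2 * sqrt (norm t)) * sum ?f {..<n+1} + (norm a)\<^sup>2 / 2 * sum ?g {..<n+1})"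
        unfolding exp_sum [symmetric, OF finite_lessThan] sum.distrib sum_distrib_left [symmetric] harm_conv_sum_lessThan
        by (simp only: mult.assoc sum_distrib_left [symmetric])
      finally have "norm (Gamma_series t n * rGamma_series (t + a) n)
         \<le> exp (Re a * harm (n+1) + norm a * (2 * sqrt (norm t)) * sum ?f {..<n+1} + (norm a)\<^sup>2 / 2 * sum ?g {..<n+1}) 
             * exp (- Re a * ln (real n))"
        unfolding eq by (rule mult_right_mono) simp
      also have "\<dots> = exp (Re a * (harm (n+1) - ln (real n)) + norm a * (2 * sqrt (norm t)) * sum ?f {..<n+1} + (norm a)\<^sup>2 / 2 * sum ?g {..<n+1})"
        by (simp add: algebra_simps flip: exp_add)
      also have "\<dots> \<le> exp (norm a * (K + 1) + norm a * (2 * sqrt (norm t)) * Z1 + (norm a)\<^sup>2 / 2 * Z2)"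
      proof -
        have "\<bar>harm (n+1) - ln (real n)\<bar> \<le> \<bar>harm n - ln (real n)\<bar> + 1 / (real n + 1)"
        proof -
          have "harm (n+1) - ln (real n) = (harm n - ln (real n)) + 1 / (real n + 1)"
            by (simp add: harm_Suc divide_inverse add_ac)
          moreover have "1 / (real n + 1) \<ge> 0" by simp
          ultimately show ?thesis by linarith
        qed
        also have "\<dots> \<le> K + 1" using K[of n] by (intro add_mono) auto
        finally have "Re a * (harm (n+1) - ln (real n)) \<le> norm a * (K + 1)"
        proof -
          assume *: "\<bar>harm (n+1) - ln (real n)\<bar> \<le> K + 1"
          have "Re a * (harm (n+1) - ln (real n)) \<le> \<bar>Re a\<bar> * \<bar>harm (n+1) - ln (real n)\<bar>"
            unfolding abs_mult [symmetric] by (rule abs_ge_self)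
          also have "\<dots> \<le> norm a * (K + 1)"
            by (rule mult_mono[OF abs_Re_le_cmod *]) auto
          finally show ?thesis .
        qed
        then show ?thesis
          using Z1[of "{..<n+1}"] Z2[of "{..<n+1}"]
          by (intro iffD2[OF exp_le_cancel_iff] add_mono mult_left_mono) auto
      qed
      also have "\<dots> \<le> exp (C * (1 + sqrt (norm t)))"
      proof -
        define x y z where "x = norm a * (K + 1)" and "y = norm a * (2 * Z1)" and "z = (norm a)\<^sup>2 / 2 * Z2"
        have xyz: "x \<ge> 0" "y \<ge> 0" "z \<ge> 0" unfolding x_def y_def z_def using Z0 K0 by (auto simp del: zero_le_mult_iff intro!: mult_nonneg_nonneg)
        have C: "C = x + y + z" by (simp only: C_def x_def y_def z_def)
        have "y * sqrt (norm t) \<le> C * sqrt (norm t)"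
          using xyz C by (intro mult_right_mono) auto
        moreover have "norm a * (2 * sqrt (norm t)) * Z1 = y * sqrt (norm t)"
          by (simp add: y_def)
        moreover have "C * (1 + sqrt (norm t)) = C + C * sqrt (norm t)" by (simp add: distrib_left)
        ultimately have "norm a * (K + 1) + norm a * (2 * sqrt (norm t)) * Z1 + (norm a)\<^sup>2 / 2 * Z2 \<le> C * (1 + sqrt (norm t))"
          unfolding x_def [symmetric] z_def [symmetric] using xyz C by linarith
        then show ?thesis by simp
      qed
      finally show ?thesis .
    qed
    show "norm (Gamma t * rGamma (t + a)) \<le> exp (C * (1 + sqrt (norm t)))"
      by (rule tendsto_upperbound[OF tendsto_norm[OF lim]])
         (use bd in \<open>auto simp: eventually_sequentially intro!: exI[of _ 1]\<close>)
  qed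
qed

text \<open>At negative integers both sides vanish, because \<open>Gamma\<close> has the value 0 at
  its poles; elsewhere this is the functional equation.\<close>

lemma Gamma_ratio_shift:
  fixes t :: complex
  assumes "t \<noteq> 0"
  shows "Gamma t * rGamma (t + a) = Gamma (t + 1) * rGamma (t + 1 + a) * ((t + a) / t)"
proof -
  have "rGamma (t + a) = (t + a) * rGamma (t + 1 + a)"
    using rGamma_plus1[of "t + a"] by (simp add: add_ac)
  moreover have "Gamma t = Gamma (t + 1) / t"
  proof (cases "t \<in> \<int>\<^sub>\<le>\<^sub>0")
    case True
    then obtain n where n: "t = - of_nat n" by (auto elim: nonpos_Ints_cases')
    then obtain m where "n = Suc m" using assms by (cases n) auto
    then have "t + 1 = - of_nat m" using n by simp
    then have "t + 1 \<in> \<int>\<^sub>\<le>\<^sub>0" by simp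
    then have "Gamma (t + 1) = 0" "Gamma t = 0" using True by (auto simp only: Gamma_eq_zero_iff)
    then show ?thesis by simp
  next
    case False
    then show ?thesis using assms by (simp add: Gamma_plus1)
  qed
  ultimately show ?thesis by simp
qed

text \<open>The true growth is polynomial; any subexponential bound is enough against the decay of 1/sin.\<close>

lemma Gamma_ratio_bound:
  fixes a :: complex
  assumes \<delta>: "\<delta> > 0"
  shows "\<exists>C\<ge>0. \<forall>t. (\<forall>m::nat. \<delta> \<le> norm (t + of_nat m)) \<longrightarrow> norm (Gamma t * rGamma (t + a)) \<le> exp (C * (1 + sqrt (norm t)))"
proof -
  obtain C where C: "C \<ge> 0" "\<And>t. Re t \<ge> 1 \<Longrightarrow> norm (Gamma t * rGamma (t + a)) \<le> exp (C * (1 + sqrt (norm t)))"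
    using Gamma_ratio_bound_right by blast
  \<comment> \<open>Chosen so that |t| >= \<epsilon> (1 + K) whenever Re t < 1 - K: for K <= 1 by
    the distance \<delta> from the pole at 0, for K >= 2 because K - 1 >= (1 + K)/3.\<close>
  define \<epsilon> where "\<epsilon> = min (\<delta> / 2) (1 / 3)"
  have \<epsilon>: "\<epsilon> > 0" "\<epsilon> \<le> \<delta> / 2" "\<epsilon> \<le> 1/3" using \<delta> by (auto simp: \<epsilon>_def)
  define B where "B = 2 * norm a / \<epsilon>"
  have B: "B \<ge> 0" using \<epsilon> by (simp add: B_def)
  \<comment> \<open>K unit shifts lead to the half plane Re t >= 1. The shift from stage K costs a
    factor 1 + |a|/|t| with |t| >= \<epsilon> (1 + K); since 1/(2(K+1)) <= sqrt (K+1) - sqrt K, the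
    exponents telescope to B sqrt K.\<close>
  have step: "norm (Gamma t * rGamma (t + a)) \<le> exp (C * (1 + sqrt (norm t + real K)) + B * sqrt (real K))"
    if "Re t \<ge> 1 - real K" "\<forall>m::nat. \<delta> \<le> norm (t + of_nat m)" for K t
    using that
  proof (induction K arbitrary: t)
    case 0
    then show ?case using C(2)[of t] by simp
  next
    case (Suc K)
    show ?case
    proof (cases "Re t \<ge> 1 - real K")
      case True
      have "norm (Gamma t * rGamma (t + a)) \<le> exp (C * (1 + sqrt (norm t + real K)) + B * sqrt (real K))"
        using Suc.IH True Suc.prems by blast
      also have "\<dots> \<le> exp (C * (1 + sqrt (norm t + real (Suc K))) + B * sqrt (real (Suc K)))"
        using C(1) B by (intro iffD2[OF exp_le_cancel_iff] add_mono mult_left_mono) auto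
      finally show ?thesis .
    next
      case False
      have nt: "norm t \<ge> \<epsilon> * (1 + real K)"
      proof (cases "K \<le> 1")
        case True
        then have "\<epsilon> * (1 + real K) \<le> \<epsilon> * 2"
          using \<epsilon>(1) by (intro mult_left_mono) auto
        also have "\<epsilon> * 2 \<le> \<delta>" using \<epsilon> by linarith
        also have "\<delta> \<le> norm t" using Suc.prems(2)[rule_format, of 0] by simp
        finally show ?thesis .
      next
        case False
        then have "\<epsilon> * (1 + real K) \<le> 1/3 * (1 + real K)"
          using \<epsilon> by (intro mult_right_mono) auto
        also have "\<dots> \<le> real K - 1" using False by auto
        also have "\<dots> \<le> norm t"
          using \<open>\<not> 1 - real K \<le> Re t\<close> abs_Re_le_cmod[of t] by linarith
        finally show ?thesis .
      qed
      have "0 < \<epsilon> * (1 + real K)" using \<epsilon> by simp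
      then have t0: "t \<noteq> 0" using nt by auto
      have "norm ((t + a) / t) \<le> 1 + norm a / norm t"
        using t0 norm_triangle_ineq[of 1 "a / t"] by (simp add: add_divide_distrib norm_divide)
      also have "\<dots> \<le> exp (norm a / norm t)" by (rule exp_ge_add_one_self)
      also have "\<dots> \<le> exp (B * (sqrt (real (Suc K)) - sqrt (real K)))"
      proof -
        have "norm a / norm t \<le> norm a / (\<epsilon> * (1 + real K))"
          using nt \<epsilon>(1) t0 by (intro divide_left_mono mult_pos_pos) auto
        also have "\<dots> = B * (1 / (2 * (1 + real K)))"
        proof -
          have "n / (e * R) = 2 * n / e * (1 / (2 * R))" for n e R :: real by simp
          then show ?thesis unfolding B_def .
        qed
        also have "\<dots> \<le> B * (sqrt (real (Suc K)) - sqrt (real K))"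
        proof (rule mult_left_mono[OF _ B])
          define x y where "x = sqrt (real (Suc K))" and "y = sqrt (real K)"
          have xy: "x * x = 1 + real K" "y * y = real K" "x \<ge> 1" "y \<ge> 0" "y \<le> x"
            by (auto simp: x_def y_def)
          have "x * x \<ge> x * 1" using xy by (intro mult_left_mono) auto
          then have "1 / (2 * (x * x)) \<le> 1 / (x + y)"
            using xy by (intro divide_left_mono mult_pos_pos) auto
          also have "1 / (x + y) = x - y"
          proof -
            have "(x - y) * (x + y) = 1" using xy by (simp add: algebra_simps)
            moreover have "x + y \<noteq> 0" using xy by linarith
            ultimately show ?thesis by (simp add: divide_eq_eq)
          qed
          finally have "1 / (2 * (1 + real K)) \<le> x - y"
            unfolding xy(1) .
          then show "1 / (2 * (1 + real K)) \<le> sqrt (real (Suc K)) - sqrt (real K)"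
            unfolding x_def y_def .
        qed
        finally show ?thesis by simp
      qed
      finally have q: "norm ((t + a) / t) \<le> exp (B * (sqrt (real (Suc K)) - sqrt (real K)))" .
      have "norm (Gamma (t + 1) * rGamma (t + 1 + a)) \<le> exp (C * (1 + sqrt (norm (t + 1) + real K)) + B * sqrt (real K))"
        by (rule Suc.IH) (use Suc.prems(1) Suc.prems(2)[rule_format, of "Suc _"] in \<open>auto simp: add_ac\<close>)
      also have "\<dots> \<le> exp (C * (1 + sqrt (norm t + real (Suc K))) + B * sqrt (real K))"
        using C(1) B norm_triangle_ineq[of t 1] by (intro iffD2[OF exp_le_cancel_iff] add_mono mult_left_mono) auto
      finally have p: "norm (Gamma (t + 1) * rGamma (t + 1 + a)) \<le> exp (C * (1 + sqrt (norm t + real (Suc K))) + B * sqrt (real K))" .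
      have "norm (Gamma t * rGamma (t + a)) = norm (Gamma (t + 1) * rGamma (t + 1 + a)) * norm ((t + a) / t)"
        unfolding Gamma_ratio_shift[OF t0] norm_mult ..
      also have "\<dots> \<le> exp (C * (1 + sqrt (norm t + real (Suc K))) + B * sqrt (real K)) * exp (B * (sqrt (real (Suc K)) - sqrt (real K)))"
        by (intro mult_mono p q) auto
      also have "\<dots> = exp (C * (1 + sqrt (norm t + real (Suc K))) + B * sqrt (real (Suc K)))"
        by (simp add: algebra_simps flip: exp_add)
      finally show ?thesis .
    qed
  qed
  define C' where "C' = 2 * C + 2 * B"
  show ?thesis
  proof (intro exI[of _ "3 * C'"] conjI allI impI)
    show "3 * C' \<ge> 0" using C B by (simp add: C'_def)
    fix t :: complex assume t: "\<forall>m::nat. \<delta> \<le> norm (t + of_nat m)"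
    \<comment> \<open>The number of shifts is at most |t| + 2, so sqrt K is again bounded by a
      multiple of 1 + sqrt |t|.\<close>
    define K where "K = nat \<lceil>1 - Re t\<rceil>"
    have K1: "Re t \<ge> 1 - real K" unfolding K_def by linarith
    have K2: "real K \<le> norm t + 2" unfolding K_def using abs_Re_le_cmod[of t] by linarith
    have s1: "sqrt (norm t + real K) \<le> 2 + 2 * sqrt (norm t)"
    proof (rule real_le_lsqrt)
      have "norm t + real K \<le> 2 * norm t + 2" using K2 by simp
      also have "\<dots> \<le> (2 + 2 * sqrt (norm t))\<^sup>2"
        by (simp add: power2_sum power_mult_distrib)
      finally show "norm t + real K \<le> (2 + 2 * sqrt (norm t))\<^sup>2" .
    qed simp
    have s2: "sqrt (real K) \<le> 2 + 2 * sqrt (norm t)"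
      by (rule order.trans[OF real_sqrt_le_mono s1]) simp
    have "norm (Gamma t * rGamma (t + a)) \<le> exp (C * (1 + sqrt (norm t + real K)) + B * sqrt (real K))"
      by (rule step[OF K1 t])
    also have "\<dots> \<le> exp (C * (1 + (2 + 2 * sqrt (norm t))) + B * (2 + 2 * sqrt (norm t)))"
      using s1 s2 C B by (intro iffD2[OF exp_le_cancel_iff] add_mono mult_left_mono) auto
    also have "\<dots> \<le> exp (3 * C' * (1 + sqrt (norm t)))"
      using C B by (auto simp: C'_def algebra_simps intro!: add_mono)
    finally show "norm (Gamma t * rGamma (t + a)) \<le> exp (3 * C' * (1 + sqrt (norm t)))" .
  qed
qed

text \<open>Contains every contour used later: the vertical lines over c + Z, and horizontal sides
  at height at least Y. A bound on this set is uniform in the position of the line, which must move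
  to infinity.\<close>

definition grid :: "real \<Rightarrow> real \<Rightarrow> complex set" where
  "grid c Y = {t. Y \<le> \<bar>Im t\<bar> \<or> Re t - c \<in> \<int>}"

lemma dist_Ints_pos:
  fixes x :: real
  assumes "x \<notin> \<int>"
  shows "\<exists>\<delta>>0. \<forall>n\<in>\<int>. \<delta> \<le> \<bar>x - n\<bar>"
proof (intro exI[of _ "min (frac x) (1 - frac x)"] conjI ballI)
  show "0 < min (frac x) (1 - frac x)"
    using assms frac_lt_1[of x] by (simp add: frac_gt_0_iff)
  fix n :: real assume "n \<in> \<int>"
  then obtain k where k: "n = of_int k" by (auto elim: Ints_cases)
  have "k \<le> \<lfloor>x\<rfloor> \<or> k \<ge> \<lfloor>x\<rfloor> + 1" by linarith
  then show "min (frac x) (1 - frac x) \<le> \<bar>x - n\<bar>"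
  proof
    assume "k \<le> \<lfloor>x\<rfloor>"
    then have "(of_int k :: real) \<le> of_int \<lfloor>x\<rfloor>" by simp
    then show ?thesis unfolding k frac_def by linarith
  next
    assume "k \<ge> \<lfloor>x\<rfloor> + 1"
    then have "(of_int k :: real) \<ge> of_int (\<lfloor>x\<rfloor> + 1)" by (simp only: of_int_le_iff)
    then show ?thesis unfolding k frac_def by simp
  qed
qed

text \<open>On the vertical lines Re t is constant modulo 1, so one \<delta> serves all lines and
  all integer translates of \<open>s\<close>, hence a whole sequence of poles.\<close>

lemma grid_dist:
  assumes "Re s - c \<notin> \<int>" "\<bar>Im s\<bar> + 1 \<le> Y"
  shows "\<exists>\<delta>>0. \<forall>t\<in>grid c Y. \<forall>m\<in>\<int>. \<delta> \<le> norm (t - s + m)"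
proof -
  obtain \<delta> where \<delta>: "\<delta> > 0" "\<And>n. n \<in> \<int> \<Longrightarrow> \<delta> \<le> \<bar>(Re s - c) - n\<bar>"
    using dist_Ints_pos[OF assms(1)] by blast
  show ?thesis
  proof (intro exI[of _ "min \<delta> 1"] conjI ballI)
    fix t m :: complex assume t: "t \<in> grid c Y" and m: "m \<in> \<int>"
    then have m': "Im m = 0" "Re m \<in> \<int>" by (auto elim!: Ints_cases)
    from t consider "Y \<le> \<bar>Im t\<bar>" | "Re t - c \<in> \<int>" by (auto simp: grid_def)
    then show "min \<delta> 1 \<le> norm (t - s + m)"
    proof cases
      case 1
      then show ?thesis using assms(2) m' abs_Im_le_cmod[of "t - s + m"] by auto
    next
      case 2
      have "\<delta> \<le> \<bar>(Re s - c) - ((Re t - c) + Re m)\<bar>"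
        by (intro \<delta>(2) Ints_add 2 m')
      also have "\<dots> = \<bar>Re (t - s + m)\<bar>" by simp
      also have "\<dots> \<le> norm (t - s + m)" by (rule abs_Re_le_cmod)
      finally show ?thesis by simp
    qed
  qed (use \<delta> in auto)
qed

lemma norm_sin_sq: "(norm (sin z))\<^sup>2 = (sin (Re z))\<^sup>2 + (sinh (Im z))\<^sup>2"
proof -
  have "(norm (sin z))\<^sup>2 = (sin (Re z) * cosh (Im z))\<^sup>2 + (cos (Re z) * sinh (Im z))\<^sup>2"
    unfolding cmod_power2 by (simp add: Re_sin Im_sin cosh_def sinh_def field_simps)
  also have "\<dots> = (sin (Re z))\<^sup>2 * (1 + (sinh (Im z))\<^sup>2) + (1 - (sin (Re z))\<^sup>2) * (sinh (Im z))\<^sup>2"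
    by (simp add: power_mult_distrib cosh_square_eq cos_squared_eq add.commute)
  also have "\<dots> = (sin (Re z))\<^sup>2 + (sinh (Im z))\<^sup>2" by (simp add: algebra_simps)
  finally show ?thesis .
qed

text \<open>On the vertical lines |sin (pi Re (t - s))| is the constant \<kappa> > 0, and cosh
  supplies the growth; at height at least Y the sinh term alone is large enough.\<close>

lemma sin_pi_bound_grid:
  assumes "Re s - c \<notin> \<int>" "\<bar>Im s\<bar> + 1 \<le> Y"
  shows "\<exists>A>0. \<forall>t\<in>grid c Y. norm (pi / sin (pi * (t - s))) \<le> A * exp (- pi * \<bar>Im t\<bar>)"
proof -
  define \<kappa> where "\<kappa> = \<bar>sin (pi * (Re s - c))\<bar>"
  have "sin (pi * (Re s - c)) \<noteq> 0"
  proof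
    assume "sin (pi * (Re s - c)) = 0"
    then obtain i :: int where "pi * (Re s - c) = of_int i * pi" by (auto simp: sin_zero_iff_int2)
    then have "Re s - c = of_int i" by simp
    then show False using assms(1) by simp
  qed
  then have \<kappa>: "\<kappa> > 0" "\<kappa> \<le> 1" by (auto simp: \<kappa>_def)
  have main: "norm (sin (pi * (t - s))) \<ge> \<kappa> * exp (pi * \<bar>Im (t - s)\<bar>) / 4" if "t \<in> grid c Y" for t
  proof -
    define X where "X = Re (pi * (t - s))"
    define V where "V = \<bar>Im (pi * (t - s))\<bar>"
    have V: "V = pi * \<bar>Im (t - s)\<bar>" by (simp add: V_def abs_mult)
    have V0: "V \<ge> 0" by (simp add: V_def)
    have sq: "(norm (sin (pi * (t - s))))\<^sup>2 = (sin X)\<^sup>2 + (sinh V)\<^sup>2"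
      unfolding norm_sin_sq X_def V_def by (simp add: abs_if)
    have "(\<kappa> * exp V / 4)\<^sup>2 \<le> (sin X)\<^sup>2 + (sinh V)\<^sup>2"
    proof (cases "Y \<le> \<bar>Im t\<bar>")
      case True
      then have "\<bar>Im (t - s)\<bar> \<ge> 1" using assms(2) by auto
      then have "V \<ge> 1" unfolding V using pi_ge_two mult_mono[of 1 pi 1 "\<bar>Im (t - s)\<bar>"] by simp
      then have "exp V \<ge> 2" using exp_ge_add_one_self[of V] by linarith
      moreover have "exp (- V) \<le> 1" using V0 by simp
      moreover have "sinh V = (exp V - exp (- V)) / 2" by (simp add: sinh_def)
      moreover have "p / 4 \<le> q" if "2 \<le> p" "r \<le> 1" "q = (p - r) / 2" for p q r :: real
        using that by simp
      ultimately have "exp V / 4 \<le> sinh V" by blast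
      moreover have "\<kappa> * exp V / 4 \<le> exp V / 4" using \<kappa> by simp
      ultimately have "\<kappa> * exp V / 4 \<le> sinh V" by linarith
      then have "(\<kappa> * exp V / 4)\<^sup>2 \<le> (sinh V)\<^sup>2" using \<kappa> by (intro power_mono) auto
      then show ?thesis by (smt (verit) zero_le_power2)
    next
      case False
      then have "Re t - c \<in> \<int>" using that by (auto simp: grid_def)
      then obtain i :: int where i: "Re t - c = of_int i" by (auto elim: Ints_cases)
      have "X = pi * of_int i - pi * (Re s - c)"
        unfolding X_def using i by (simp add: algebra_simps)
      then have "\<bar>sin X\<bar> = \<kappa>"
        by (simp add: sin_diff \<kappa>_def abs_mult sin_npi_int cos_npi_int)
      then have sX: "(sin X)\<^sup>2 = \<kappa>\<^sup>2" by (metis power2_abs)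
      have "\<kappa>\<^sup>2 * (sinh V)\<^sup>2 \<le> 1 * (sinh V)\<^sup>2"
        using \<kappa> by (intro mult_right_mono power_le_one) auto
      then have "(sin X)\<^sup>2 + (sinh V)\<^sup>2 \<ge> \<kappa>\<^sup>2 * (cosh V)\<^sup>2"
        unfolding sX cosh_square_eq by (simp add: algebra_simps)
      moreover have "cosh V \<ge> exp V / 4"
      proof -
        have "cosh V = (exp V + exp (- V)) / 2" by (simp add: cosh_def)
        moreover have "p / 4 \<le> q" if "0 < p" "0 < r" "q = (p + r) / 2" for p q r :: real
          using that by simp
        ultimately show ?thesis using exp_gt_zero by blast
      qed
      then have "(\<kappa> * exp V / 4)\<^sup>2 \<le> (\<kappa> * cosh V)\<^sup>2"
        using \<kappa> by (intro power_mono) auto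
      ultimately show ?thesis by (simp add: power_mult_distrib)
    qed
    then have "\<kappa> * exp V / 4 \<le> norm (sin (pi * (t - s)))"
      unfolding sq[symmetric] by (rule power2_le_imp_le) simp
    then show ?thesis unfolding V .
  qed
  \<comment> \<open>The factor exp (pi |Im s|) pays for replacing Im (t - s) by Im t.\<close>
  define A where "A = 4 * pi / \<kappa> * exp (pi * \<bar>Im s\<bar>)"
  show ?thesis
  proof (intro exI[of _ A] conjI ballI)
    show "A > 0" using \<kappa> by (simp add: A_def)
    fix t assume t: "t \<in> grid c Y"
    have "norm (pi / sin (pi * (t - s))) = pi / norm (sin (pi * (t - s)))" by (simp add: norm_divide)
    also have "\<dots> \<le> pi / (\<kappa> * exp (pi * \<bar>Im (t - s)\<bar>) / 4)"
    proof (rule divide_left_mono[OF main[OF t]])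
      have "0 < \<kappa> * exp (pi * \<bar>Im (t - s)\<bar>) / 4" using \<kappa> by simp
      then show "0 < norm (sin (pi * (t - s))) * (\<kappa> * exp (pi * \<bar>Im (t - s)\<bar>) / 4)"
        using main[OF t] by (intro mult_pos_pos) linarith+
    qed simp
    also have "\<dots> = 4 * pi / \<kappa> * exp (- (pi * \<bar>Im (t - s)\<bar>))" 
      by (simp add: exp_minus field_simps)
    also have "\<dots> \<le> 4 * pi / \<kappa> * exp (pi * \<bar>Im s\<bar> - pi * \<bar>Im t\<bar>)"
    proof -
      have "pi * \<bar>Im t\<bar> \<le> pi * (\<bar>Im (t - s)\<bar> + \<bar>Im s\<bar>)" by (intro mult_left_mono) auto
      then show ?thesis using \<kappa> by (intro mult_left_mono) (auto simp: algebra_simps)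
    qed
    also have "\<dots> = A * exp (- pi * \<bar>Im t\<bar>)" by (simp add: A_def exp_diff exp_minus field_simps)
    finally show "norm (pi / sin (pi * (t - s))) \<le> A * exp (- pi * \<bar>Im t\<bar>)" .
  qed
qed

subsection \<open>Shifting Mellin-Barnes integrals\<close>

text \<open>\<open>S\<close> holds the at most simple poles and \<open>r\<close> the residues. In
  the bound, exp (pi Im t) stems from exp(-i pi t) and exp (- pi |Im t|) from 1/sin; against |exp (w
  t)| they leave exp (- Im w |Im t|) upwards and exp (- (2 pi - Im w) |Im t|) downwards. The sqrt
  term is the allowance for the Gamma quotients.\<close>

locale barnes_kernel =
  fixes u :: "complex \<Rightarrow> complex" and S :: "complex set" and r :: "complex \<Rightarrow> complex"
    and c Y A C :: real
  assumes holo: "u holomorphic_on - S"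
    and fin: "\<And>a b. finite {s\<in>S. a \<le> Re s \<and> Re s \<le> b}"
    and res: "\<And>s. s \<in> S \<Longrightarrow> ((\<lambda>t. u t * (t - s)) \<longlongrightarrow> r s) (at s)"
    and avoid: "\<And>s. s \<in> S \<Longrightarrow> s \<notin> grid c Y"
    and bound: "\<And>t. t \<in> grid c Y \<Longrightarrow>
        norm (u t) \<le> A * exp (C * sqrt (norm t) + pi * Im t - pi * \<bar>Im t\<bar>)"
    and A: "A \<ge> 0" and C: "C \<ge> 0"
begin

definition M :: "real \<Rightarrow> real \<Rightarrow> real \<Rightarrow> real" where
  "M \<kappa> \<rho> x = A * exp (C\<^sup>2 / (4 * \<kappa>) + \<rho> * x + C * sqrt \<bar>x\<bar>)"

lemma M_nonneg: "M \<kappa> \<rho> x \<ge> 0"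
  using A by (simp add: M_def)

text \<open>A margin of 2 \<kappa> inside the strip gives decay exp (- 2 \<kappa> |Im t|). One half
  absorbs C sqrt |Im t| by completing the square, which leaves the constant C^2 / (4 \<kappa>) in
  \<open>M\<close>; the other half remains.\<close>

lemma integrand_bound:
  assumes t: "t \<in> grid c Y" and \<kappa>: "\<kappa> > 0" "2 * \<kappa> \<le> Im w" "Im w \<le> 2 * pi - 2 * \<kappa>"
  shows "norm (exp (w * t) * u t) \<le> M \<kappa> (Re w) (Re t) * exp (- \<kappa> * \<bar>Im t\<bar>)"
proof -
  define x y where "x = Re t" and "y = Im t"
  define s where "s = sqrt \<bar>y\<bar>"
  have s2: "s * s = \<bar>y\<bar>" by (simp add: s_def)
  have "sqrt (norm t) \<le> sqrt (\<bar>x\<bar> + \<bar>y\<bar>)"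
    unfolding x_def y_def by (intro real_sqrt_le_mono cmod_le)
  also have "\<dots> \<le> sqrt \<bar>x\<bar> + s"
    unfolding s_def by (rule sqrt_add_le_add_sqrt) auto
  finally have "C * sqrt (norm t) \<le> C * (sqrt \<bar>x\<bar> + s)"
    using C by (rule mult_left_mono)
  moreover have "C * s \<le> \<kappa> * \<bar>y\<bar> + C\<^sup>2 / (4 * \<kappa>)"
  proof -
    have "0 \<le> \<kappa> * (s - C / (2 * \<kappa>))\<^sup>2" using \<kappa> by simp
    also have "\<dots> = \<kappa> * (s * s) + C\<^sup>2 / (4 * \<kappa>) - C * s"
      using \<kappa>(1) by (simp add: power2_eq_square field_simps)
    finally show ?thesis unfolding s2 by simp
  qed
  moreover have "- Im w * y + pi * y - pi * \<bar>y\<bar> \<le> - 2 * \<kappa> * \<bar>y\<bar>"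
  proof (cases "y \<ge> 0")
    case True
    then have "2 * \<kappa> * y \<le> Im w * y" using \<kappa> by (intro mult_right_mono) auto
    then show ?thesis using True by simp
  next
    case False
    then have "2 * \<kappa> * (- y) \<le> (2 * pi - Im w) * (- y)" using \<kappa> by (intro mult_right_mono) auto
    then show ?thesis using False by (simp add: algebra_simps)
  qed
  ultimately have e: "Re w * x - Im w * y + (C * sqrt (norm t) + pi * y - pi * \<bar>y\<bar>)
      \<le> (C\<^sup>2 / (4 * \<kappa>) + Re w * x + C * sqrt \<bar>x\<bar>) + (- \<kappa> * \<bar>y\<bar>)"
    by (simp add: distrib_left) 
  have "norm (exp (w * t) * u t) = exp (Re w * x - Im w * y) * norm (u t)"
    by (simp add: norm_mult x_def y_def)
  also have "\<dots> \<le> exp (Re w * x - Im w * y) * (A * exp (C * sqrt (norm t) + pi * y - pi * \<bar>y\<bar>))"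
    using bound[OF t] by (simp add: y_def mult_left_mono)
  also have "\<dots> = A * exp (Re w * x - Im w * y + (C * sqrt (norm t) + pi * y - pi * \<bar>y\<bar>))"
    by (simp add: exp_add)
  also have "\<dots> \<le> A * exp ((C\<^sup>2 / (4 * \<kappa>) + Re w * x + C * sqrt \<bar>x\<bar>) + (- \<kappa> * \<bar>y\<bar>))"
    using A e by (intro mult_left_mono) auto
  also have "\<dots> = M \<kappa> (Re w) (Re t) * exp (- \<kappa> * \<bar>Im t\<bar>)"
    unfolding M_def exp_add x_def y_def by simp
  finally show ?thesis .
qed

definition seg :: "real \<Rightarrow> real \<Rightarrow> real \<Rightarrow> complex \<Rightarrow> complex" where
  "seg x a b w = integral {a..b} (\<lambda>y. exp (w * Complex x y) * u (Complex x y))"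

lemma grid_line: "x - c \<in> \<int> \<Longrightarrow> Complex x y \<in> grid c Y"
  by (simp add: grid_def)

lemma continuous_on_u: "T \<inter> S = {} \<Longrightarrow> continuous_on T u"
  by (rule continuous_on_subset[OF holomorphic_on_imp_continuous_on[OF holo]]) auto

lemma continuous_on_line:
  assumes "x - c \<in> \<int>"
  shows "continuous_on T (\<lambda>y. u (Complex x y))"
proof -
  have "Complex x y \<notin> S" for y using grid_line[OF assms] avoid by blast
  then have "continuous_on ((\<lambda>y. Complex x y) ` T) u" by (intro continuous_on_u) auto
  moreover have "continuous_on T (\<lambda>y. Complex x y)"
    unfolding Complex_eq by (intro continuous_intros)
  ultimately show ?thesis using continuous_on_compose2 by blast
qed

lemma seg_integrand_continuous:
  assumes "x - c \<in> \<int>"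
  shows "continuous_on T (\<lambda>y. exp (w * Complex x y) * u (Complex x y))"
  by (intro continuous_intros continuous_on_line assms)

lemma seg_holomorphic:
  assumes "x - c \<in> \<int>"
  shows "seg x a b holomorphic_on UNIV"
proof -
  have "(\<lambda>w. integral (cbox a b) (\<lambda>y. exp (w * Complex x y) * u (Complex x y))) holomorphic_on UNIV"
  proof (rule leibniz_rule_holomorphic)
    show "((\<lambda>w. exp (w * Complex x y) * u (Complex x y)) has_field_derivative
        Complex x y * exp (w * Complex x y) * u (Complex x y)) (at w within UNIV)" for w y
      by (auto intro!: derivative_eq_intros)
    show "(\<lambda>y. exp (w * Complex x y) * u (Complex x y)) integrable_on cbox a b" for w
      by (rule integrable_continuous seg_integrand_continuous[OF assms])+
    have "continuous_on (UNIV \<times> cbox a b) (\<lambda>z. u (Complex x (snd z)))"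
      using continuous_on_line[OF assms, of "cbox a b"]
      by (rule continuous_on_compose2) (auto intro!: continuous_intros)
    then show "continuous_on (UNIV \<times> cbox a b)
        (\<lambda>(w, y). Complex x y * exp (w * Complex x y) * u (Complex x y))"
      unfolding case_prod_beta by (simp only: Complex_eq) (intro continuous_intros)
  qed simp
  then show ?thesis unfolding seg_def [abs_def] by simp
qed

lemma seg_bound:
  assumes x: "x - c \<in> \<int>" and \<kappa>: "\<kappa> > 0" "2 * \<kappa> \<le> Im w" "Im w \<le> 2 * pi - 2 * \<kappa>"
    and ab: "a \<le> b" and k: "\<And>y. y \<in> {a..b} \<Longrightarrow> k \<le> \<bar>y\<bar>"
  shows "norm (seg x a b w) \<le> M \<kappa> (Re w) x * exp (- \<kappa> * k) * (b - a)"
  unfolding seg_def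
proof (rule integral_bound[OF ab seg_integrand_continuous[OF x]])
  fix y assume y: "y \<in> {a..b}"
  have "norm (exp (w * Complex x y) * u (Complex x y)) \<le> M \<kappa> (Re w) x * exp (- \<kappa> * \<bar>y\<bar>)"
    using integrand_bound[OF grid_line[OF x] \<kappa>] by simp
  also have "\<dots> \<le> M \<kappa> (Re w) x * exp (- \<kappa> * k)"
    using k[OF y] \<kappa> M_nonneg by (intro mult_left_mono) auto
  finally show "norm (exp (w * Complex x y) * u (Complex x y)) \<le> M \<kappa> (Re w) x * exp (- \<kappa> * k)" .
qed

text \<open>Cutting the line into pairs of unit segments makes the improper integral
  \<open>J\<close> a series with geometrically bounded terms, so the Weierstrass test yields
  holomorphy in w. The integrals run over y = Im t, without the i of dt = i dy; hence 2 pi instead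
  of 2 pi i in \<open>J_shift\<close>.\<close>

definition D :: "real \<Rightarrow> nat \<Rightarrow> complex \<Rightarrow> complex" where
  "D x k w = seg x (real k) (real k + 1) w + seg x (- real k - 1) (- real k) w"

definition J :: "real \<Rightarrow> complex \<Rightarrow> complex" where
  "J x w = (\<Sum>k. D x k w)"

lemma D_bound:
  assumes x: "x - c \<in> \<int>" and \<kappa>: "\<kappa> > 0" "2 * \<kappa> \<le> Im w" "Im w \<le> 2 * pi - 2 * \<kappa>"
  shows "norm (D x k w) \<le> 2 * M \<kappa> (Re w) x * exp (- \<kappa>) ^ k"
proof -
  have "norm (seg x (real k) (real k + 1) w) \<le> M \<kappa> (Re w) x * exp (- \<kappa> * real k) * ((real k + 1) - real k)"
    by (rule seg_bound[OF x \<kappa>]) auto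
  moreover have "norm (seg x (- real k - 1) (- real k) w) \<le> M \<kappa> (Re w) x * exp (- \<kappa> * real k) * ((- real k) - (- real k - 1))"
    by (rule seg_bound[OF x \<kappa>]) auto
  ultimately have "norm (D x k w) \<le> 2 * M \<kappa> (Re w) x * exp (- \<kappa> * real k)"
    unfolding D_def by (intro order.trans[OF norm_triangle_ineq]) simp
  then show ?thesis by (simp add: mult.commute flip: exp_of_nat_mult)
qed

lemma sum_D:
  assumes x: "x - c \<in> \<int>"
  shows "(\<Sum>k<K. D x k w) = seg x (- real K) (real K) w"
proof (induction K)
  case 0
  then show ?case by (simp add: seg_def)
next
  case (Suc K)
  have int: "(\<lambda>y. exp (w * Complex x y) * u (Complex x y)) integrable_on {a..b}" for a b
    by (intro integrable_continuous_interval seg_integrand_continuous x)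
  have "(\<Sum>k<Suc K. D x k w) = (seg x (- real K - 1) (- real K) w + seg x (- real K) (real K) w)
      + seg x (real K) (real K + 1) w"
    unfolding sum.lessThan_Suc Suc.IH by (simp only: D_def add_ac)
  also have "seg x (- real K - 1) (- real K) w + seg x (- real K) (real K) w = seg x (- real K - 1) (real K) w"
    unfolding seg_def by (rule Henstock_Kurzweil_Integration.integral_combine) (auto intro: int)
  also have "seg x (- real K - 1) (real K) w + seg x (real K) (real K + 1) w = seg x (- real K - 1) (real K + 1) w"
    unfolding seg_def by (rule Henstock_Kurzweil_Integration.integral_combine) (auto intro: int)
  also have "\<dots> = seg x (- real (Suc K)) (real (Suc K)) w"
    by (rule arg_cong2[where f = "\<lambda>a b. seg x a b w"]) auto
  finally show ?case .
qed

lemma summable_geo: "\<kappa> > 0 \<Longrightarrow> summable (\<lambda>k. B * exp (- \<kappa>) ^ k)" for B \<kappa> :: real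
  by (intro summable_mult summable_geometric) simp

text \<open>The third \<kappa> is room for a closed ball of radius \<kappa> about w on which the
  margin 2 \<kappa> of the estimates persists.\<close>

lemma strip_margin:
  fixes w :: complex
  assumes "0 < Im w" "Im w < 2 * pi"
  obtains \<kappa> where "\<kappa> > 0" "3 * \<kappa> \<le> Im w" "Im w \<le> 2 * pi - 3 * \<kappa>"
  using assms by (intro that[of "min (Im w) (2 * pi - Im w) / 3"]) (auto simp: min_def)

lemma J_LIMSEQ:
  assumes x: "x - c \<in> \<int>" and w: "0 < Im w" "Im w < 2 * pi"
  shows "(\<lambda>K. seg x (- real K) (real K) w) \<longlonglongrightarrow> J x w"
proof -
  obtain \<kappa> where \<kappa>: "\<kappa> > 0" "3 * \<kappa> \<le> Im w" "Im w \<le> 2 * pi - 3 * \<kappa>" using strip_margin[OF w] .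
  have "summable (\<lambda>k. D x k w)"
  proof (rule summable_comparison_test'[OF summable_geo])
    show "\<kappa> > 0" by fact
    show "norm (D x k w) \<le> 2 * M \<kappa> (Re w) x * exp (- \<kappa>) ^ k" for k
      using \<kappa> by (intro D_bound x) auto
  qed
  then have "(\<lambda>K. \<Sum>k<K. D x k w) \<longlonglongrightarrow> J x w"
    unfolding J_def by (rule summable_LIMSEQ)
  then show ?thesis by (simp only: sum_D[OF x])
qed

lemma J_bound:
  assumes x: "x - c \<in> \<int>" and \<kappa>: "\<kappa> > 0" "2 * \<kappa> \<le> Im w" "Im w \<le> 2 * pi - 2 * \<kappa>"
  shows "norm (J x w) \<le> 2 * M \<kappa> (Re w) x * (1 / (1 - exp (- \<kappa>)))"
proof -
  have "norm (J x w) \<le> (\<Sum>k. 2 * M \<kappa> (Re w) x * exp (- \<kappa>) ^ k)"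
    unfolding J_def using D_bound[OF x \<kappa>] summable_geo[OF \<kappa>(1)] by (rule norm_suminf_le)
  also have "\<dots> = 2 * M \<kappa> (Re w) x * (\<Sum>k. exp (- \<kappa>) ^ k)"
    using \<kappa> by (intro suminf_mult summable_geometric) simp
  also have "(\<Sum>k. exp (- \<kappa>) ^ k) = 1 / (1 - exp (- \<kappa>))"
    using \<kappa> by (intro suminf_geometric) simp
  finally show ?thesis .
qed

lemma J_holomorphic:
  assumes x: "x - c \<in> \<int>"
  shows "J x holomorphic_on {w. 0 < Im w \<and> Im w < 2 * pi}"
proof (rule holomorphic_uniform_sequence)
  show "open {w. 0 < Im w \<and> Im w < 2 * pi}"
    by (intro open_Collect_conj open_Collect_less continuous_intros)
  show "(\<lambda>w. \<Sum>k<K. D x k w) holomorphic_on {w. 0 < Im w \<and> Im w < 2 * pi}" for K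
    unfolding sum_D[OF x] by (rule holomorphic_on_subset[OF seg_holomorphic[OF x]]) auto
  fix w0 assume "w0 \<in> {w. 0 < Im w \<and> Im w < 2 * pi}"
  then obtain \<kappa> where \<kappa>: "\<kappa> > 0" "3 * \<kappa> \<le> Im w0" "Im w0 \<le> 2 * pi - 3 * \<kappa>"
    using strip_margin[of w0] by auto
  \<comment> \<open>On the ball, Re w * x exceeds Re w0 * x by at most \<kappa> |x|, so this
    majorises \<open>2 * M \<kappa> (Re w) x\<close> independently of w.\<close>
  define B where "B = 2 * (A * exp (C\<^sup>2 / (4 * \<kappa>) + (Re w0 * x + \<kappa> * \<bar>x\<bar>) + C * sqrt \<bar>x\<bar>))"
  have near: "\<bar>Re w - Re w0\<bar> \<le> \<kappa>" "\<bar>Im w - Im w0\<bar> \<le> \<kappa>" if "w \<in> cball w0 \<kappa>" for w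
    using that abs_Re_le_cmod[of "w - w0"] abs_Im_le_cmod[of "w - w0"]
    by (auto simp: dist_norm norm_minus_commute)
  show "\<exists>d>0. cball w0 d \<subseteq> {w. 0 < Im w \<and> Im w < 2 * pi} \<and>
      uniform_limit (cball w0 d) (\<lambda>K w. \<Sum>k<K. D x k w) (J x) sequentially"
  proof (intro exI[of _ \<kappa>] conjI \<kappa>)
    show "cball w0 \<kappa> \<subseteq> {w. 0 < Im w \<and> Im w < 2 * pi}"
      using near(2) \<kappa> by fastforce
    show "uniform_limit (cball w0 \<kappa>) (\<lambda>K w. \<Sum>k<K. D x k w) (J x) sequentially"
      unfolding J_def [abs_def]
    proof (rule Weierstrass_m_test[OF _ summable_geo[OF \<kappa>(1)]])
      fix k w assume w: "w \<in> cball w0 \<kappa>"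
      have "norm (D x k w) \<le> 2 * M \<kappa> (Re w) x * exp (- \<kappa>) ^ k"
        using near(2)[OF w] \<kappa> by (intro D_bound x) auto
      also have "\<dots> \<le> B * exp (- \<kappa>) ^ k"
      proof (rule mult_right_mono)
        have "(Re w - Re w0) * x \<le> \<bar>Re w - Re w0\<bar> * \<bar>x\<bar>"
          unfolding abs_mult [symmetric] by (rule abs_ge_self)
        also have "\<dots> \<le> \<kappa> * \<bar>x\<bar>" using near(1)[OF w] by (intro mult_right_mono) auto
        finally have "Re w * x \<le> Re w0 * x + \<kappa> * \<bar>x\<bar>" by (simp add: algebra_simps)
        then show "2 * M \<kappa> (Re w) x \<le> B"
          unfolding B_def M_def using A by (intro mult_left_mono) auto
      qed simp
      finally show "norm (D x k w) \<le> B * exp (- \<kappa>) ^ k" .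
    qed
  qed
qed

text \<open>The residue theorem on the rectangle with vertical sides over a and b and horizontal
  sides at height K and -K; the horizontal sides contribute at most \<open>2 * E K\<close>, which
  tends to 0.\<close>

lemma J_shift:
  assumes ab: "a < b" and a: "a - c \<in> \<int>" and b: "b - c \<in> \<int>" and w: "0 < Im w" "Im w < 2 * pi"
  shows "J b w - J a w = 2 * pi * (\<Sum>s | s \<in> S \<and> a < Re s \<and> Re s < b. r s * exp (w * s))"
proof -
  obtain \<kappa> where \<kappa>: "\<kappa> > 0" "3 * \<kappa> \<le> Im w" "Im w \<le> 2 * pi - 3 * \<kappa>" using strip_margin[OF w] .
  define f where "f t = exp (w * t) * u t" for t
  \<comment> \<open>A slightly wider vertical strip: it contains the closed rectangles for all K and
    only finitely many poles.\<close>
  define U where "U = {t::complex. a - 1 < Re t \<and> Re t < b + 1}"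
  define T where "T = {s. s \<in> S \<and> a < Re s \<and> Re s < b}"
  have U: "open U" "connected U"
  proof -
    show "open U" unfolding U_def by (intro open_Collect_conj open_Collect_less continuous_intros)
    have "U = {t. a - 1 < Re t} \<inter> {t. Re t < b + 1}" by (auto simp: U_def)
    then have "convex U"
      by (simp add: convex_Int convex_halfspace_Re_gt convex_halfspace_Re_lt)
    then show "connected U" by (rule convex_connected)
  qed
  have avoid': "\<bar>Im s\<bar> < Y \<and> Re s - c \<notin> \<int>" if "s \<in> S" for s
    using avoid[OF that] by (auto simp: grid_def)
  have finU: "finite (S \<inter> U)"
    by (rule finite_subset[OF _ fin[of "a - 1" "b + 1"]]) (auto simp: U_def)
  have f_holo: "f holomorphic_on - S"
    unfolding f_def by (intro holomorphic_intros holo)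
  have f_cont: "continuous_on X f" if "X \<inter> S = {}" for X
    using f_holo that by (intro continuous_on_subset[OF holomorphic_on_imp_continuous_on]) auto
  have res_f: "residue f s = r s * exp (w * s)" if s: "s \<in> S" "s \<in> U" for s
  proof (rule residue_simple')
    show "open (U - (S \<inter> U - {s}))"
      using U finU by (intro open_Diff finite_imp_closed) auto
    show "s \<in> U - (S \<inter> U - {s})" using s by auto
    show "f holomorphic_on (U - (S \<inter> U - {s}) - {s})"
      by (rule holomorphic_on_subset[OF f_holo]) auto
    have "((\<lambda>t. exp (w * t) * (u t * (t - s))) \<longlongrightarrow> exp (w * s) * r s) (at s)"
      by (intro tendsto_intros res s)
    then show "((\<lambda>t. f t * (t - s)) \<longlongrightarrow> r s * exp (w * s)) (at s)"
      by (simp add: f_def mult_ac)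
  qed
  \<comment> \<open>Bounds \<open>M \<kappa> (Re w)\<close> at all abscissas between a and b, so the
    horizontal sides decay like exp (- \<kappa> K).\<close>
  define B where "B = A * exp (C\<^sup>2 / (4 * \<kappa>) + \<bar>Re w\<bar> * (\<bar>a\<bar> + \<bar>b\<bar>) + C * sqrt (\<bar>a\<bar> + \<bar>b\<bar>))"
  have B: "B \<ge> 0" using A by (simp add: B_def)
  define E where "E K = exp (- \<kappa> * real K) * (B * (b - a))" for K :: nat
  have main: "norm (seg b (- real K) (real K) w - seg a (- real K) (real K) w
      - 2 * pi * (\<Sum>s\<in>T. r s * exp (w * s))) \<le> 2 * E K" if K: "real K \<ge> Y" "K > 0" for K
  proof -
    define a1 a2 a3 a4 where "a1 = Complex a (- real K)" and "a2 = Complex b (- real K)"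
      and "a3 = Complex b (real K)" and "a4 = Complex a (real K)"
    have lines: "closed_segment a1 a2 \<inter> S = {}" "closed_segment a2 a3 \<inter> S = {}"
       "closed_segment a3 a4 \<inter> S = {}" "closed_segment a4 a1 \<inter> S = {}"
      using K ab a b
      by (auto dest!: avoid' simp: a1_def a2_def a3_def a4_def closed_segment_same_Im closed_segment_same_Re grid_def)
    have ci: "f contour_integrable_on (linepath a1 a2)" "f contour_integrable_on (linepath a2 a3)"
       "f contour_integrable_on (linepath a3 a4)" "f contour_integrable_on (linepath a4 a1)"
      using lines by (auto intro!: contour_integrable_continuous_linepath f_cont)
    have "contour_integral (rectpath a1 a3) f = contour_integral (linepath a1 a2) f
       + (contour_integral (linepath a2 a3) f + (contour_integral (linepath a3 a4) f + contour_integral (linepath a4 a1) f))"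
    proof -
      have "rectpath a1 a3 = linepath a1 a2 +++ linepath a2 a3 +++ linepath a3 a4 +++ linepath a4 a1"
        by (simp add: rectpath_def Let_def a1_def a2_def a3_def a4_def)
      then show ?thesis
        using ci by (simp add: contour_integrable_joinI)
    qed
    moreover have "contour_integral (linepath a2 a3) f = \<i> * seg b (- real K) (real K) w"
      unfolding seg_def f_def using K by (intro contour_integral_linepath_same_Re) (auto simp: a2_def a3_def)
    moreover have "contour_integral (linepath a4 a1) f = - (\<i> * seg a (- real K) (real K) w)"
    proof -
      have "contour_integral (linepath a4 a1) f = - contour_integral (linepath a1 a4) f"
        using f_cont[OF lines(4)] by (rule contour_integral_reverse_linepath)
      also have "contour_integral (linepath a1 a4) f = \<i> * seg a (- real K) (real K) w"
        unfolding seg_def f_def using K by (intro contour_integral_linepath_same_Re) (auto simp: a1_def a4_def)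
      finally show ?thesis .
    qed
    moreover have hb: "norm (f t) \<le> exp (- \<kappa> * real K) * B"
      if t: "\<bar>Im t\<bar> = real K" "a \<le> Re t" "Re t \<le> b" for t
    proof -
      have ab': "\<bar>Re t\<bar> \<le> \<bar>a\<bar> + \<bar>b\<bar>" using t by linarith
      have "norm (f t) \<le> M \<kappa> (Re w) (Re t) * exp (- \<kappa> * \<bar>Im t\<bar>)"
        unfolding f_def using t K \<kappa> by (intro integrand_bound) (auto simp: grid_def)
      also have "M \<kappa> (Re w) (Re t) \<le> B"
      proof -
        have "Re w * Re t \<le> \<bar>Re w\<bar> * \<bar>Re t\<bar>" unfolding abs_mult [symmetric] by (rule abs_ge_self)
        also have "\<dots> \<le> \<bar>Re w\<bar> * (\<bar>a\<bar> + \<bar>b\<bar>)" using ab' by (intro mult_left_mono) auto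
        finally show ?thesis unfolding M_def B_def using ab' A C
          by (intro mult_left_mono iffD2[OF exp_le_cancel_iff] add_mono) auto
      qed
      finally show ?thesis by (simp add: t(1) mult.commute mult_left_mono)
    qed
    moreover have h1: "norm (contour_integral (linepath a1 a2) f) \<le> E K"
    proof -
      have "norm (contour_integral (linepath a1 a2) f) \<le> exp (- \<kappa> * real K) * B * norm (a2 - a1)"
        using ab B
        by (intro contour_integral_bound_linepath ci hb)
           (auto simp: a1_def a2_def closed_segment_same_Im closed_segment_eq_real_ivl)
      also have "norm (a2 - a1) = b - a"
        using ab by (simp add: a1_def a2_def cmod_def)
      finally show ?thesis by (simp add: E_def mult.assoc)
    qed
    moreover have h2: "norm (contour_integral (linepath a3 a4) f) \<le> E K"
    proof -
      have "norm (contour_integral (linepath a3 a4) f) \<le> exp (- \<kappa> * real K) * B * norm (a4 - a3)"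
        using ab B
        by (intro contour_integral_bound_linepath ci hb)
           (auto simp: a3_def a4_def closed_segment_same_Im closed_segment_eq_real_ivl)
      also have "norm (a4 - a3) = b - a"
        using ab by (simp add: a3_def a4_def cmod_def)
      finally show ?thesis by (simp add: E_def mult.assoc)
    qed
    moreover have "contour_integral (rectpath a1 a3) f = 2 * pi * \<i> * (\<Sum>s\<in>T. r s * exp (w * s))"
    proof -
      have "contour_integral (rectpath a1 a3) f
          = 2 * pi * \<i> * (\<Sum>p\<in>S \<inter> U. winding_number (rectpath a1 a3) p * residue f p)"
      proof (rule Residue_theorem)
        have "cbox a1 a3 \<subseteq> U" by (auto simp: in_cbox_complex_iff a1_def a3_def U_def)
        moreover have "path_image (rectpath a1 a3) \<subseteq> cbox a1 a3"
          using ab by (intro path_image_rectpath_subset_cbox) (auto simp: a1_def a3_def)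
        moreover have "path_image (rectpath a1 a3) \<inter> S = {}"
          using lines by (auto simp: rectpath_def Let_def path_image_join a1_def a2_def a3_def a4_def)
        ultimately show "path_image (rectpath a1 a3) \<subseteq> U - S \<inter> U" by blast
        show "\<forall>z. z \<notin> U \<longrightarrow> winding_number (rectpath a1 a3) z = 0"
          using \<open>cbox a1 a3 \<subseteq> U\<close> ab by (auto intro!: winding_number_rectpath_outside simp: a1_def a3_def)
        show "f holomorphic_on U - S \<inter> U" by (rule holomorphic_on_subset[OF f_holo]) auto
      qed (use U finU in auto)
      also have "(\<Sum>p\<in>S \<inter> U. winding_number (rectpath a1 a3) p * residue f p) = (\<Sum>s\<in>T. r s * exp (w * s))"
      proof (rule sum.mono_neutral_cong_right[OF finU])
        show "T \<subseteq> S \<inter> U" using ab by (auto simp: T_def U_def)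
        \<comment> \<open>No pole lies over a or b, since those lines belong to the grid; a pole of
          the wide strip outside \<open>T\<close> is therefore outside the rectangle and has winding
          number 0.\<close>
        show "\<forall>p\<in>S \<inter> U - T. winding_number (rectpath a1 a3) p * residue f p = 0"
        proof
          fix p assume p: "p \<in> S \<inter> U - T"
          then have "Re p \<noteq> a" "Re p \<noteq> b" using avoid[of p] a b by (auto simp: grid_def)
          then have "p \<notin> cbox a1 a3" using p by (auto simp: T_def in_cbox_complex_iff a1_def a3_def)
          then show "winding_number (rectpath a1 a3) p * residue f p = 0"
            using ab by (subst winding_number_rectpath_outside) (auto simp: a1_def a3_def)
        qed
        fix p assume p: "p \<in> T"
        then have "\<bar>Im p\<bar> < Y" using avoid[of p] by (auto simp: T_def grid_def)
        then have "p \<in> box a1 a3" using p K by (auto simp: T_def in_box_complex_iff a1_def a3_def)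
        then show "winding_number (rectpath a1 a3) p * residue f p = r p * exp (w * p)"
          using p ab by (subst winding_number_rectpath, simp, subst res_f) (auto simp: T_def U_def)
      qed
      finally show ?thesis .
    qed
    ultimately have "\<i> * (seg b (- real K) (real K) w - seg a (- real K) (real K) w - 2 * pi * (\<Sum>s\<in>T. r s * exp (w * s)))
        = - (contour_integral (linepath a1 a2) f + contour_integral (linepath a3 a4) f)"
      by (simp add: algebra_simps)
    then have "norm (\<i> * (seg b (- real K) (real K) w - seg a (- real K) (real K) w - 2 * pi * (\<Sum>s\<in>T. r s * exp (w * s))))
        = norm (contour_integral (linepath a1 a2) f + contour_integral (linepath a3 a4) f)"
      by (simp only: norm_minus_cancel)
    also have "\<dots> \<le> 2 * E K" using norm_triangle_le[OF add_mono[OF h1 h2]] by simp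
    finally show ?thesis by (simp add: norm_mult)
  qed
  have E0: "(\<lambda>K. 2 * E K) \<longlonglongrightarrow> 0"
  proof -
    have "(\<lambda>K. exp (- \<kappa>) ^ K) \<longlonglongrightarrow> 0" using \<kappa> by (intro LIMSEQ_power_zero) simp
    then have "(\<lambda>K. exp (- \<kappa> * real K)) \<longlonglongrightarrow> 0"
      by (simp add: mult.commute flip: exp_of_nat_mult)
    then show ?thesis unfolding E_def by (intro tendsto_mult_right_zero tendsto_mult_left_zero)
  qed
  have "(\<lambda>K. seg b (- real K) (real K) w - seg a (- real K) (real K) w
      - 2 * pi * (\<Sum>s\<in>T. r s * exp (w * s))) \<longlonglongrightarrow> 0"
  proof (rule Lim_null_comparison[OF _ E0])
    show "\<forall>\<^sub>F K in sequentially. norm (seg b (- real K) (real K) w - seg a (- real K) (real K) w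
      - 2 * pi * (\<Sum>s\<in>T. r s * exp (w * s))) \<le> 2 * E K"
      using eventually_ge_at_top[of "nat \<lceil>Y\<rceil> + 1"]
    proof eventually_elim
      case (elim K)
      show ?case by (rule main) (use elim in linarith)+
    qed
  qed
  moreover have "(\<lambda>K. seg b (- real K) (real K) w - seg a (- real K) (real K) w
      - 2 * pi * (\<Sum>s\<in>T. r s * exp (w * s))) \<longlonglongrightarrow> J b w - J a w - 2 * pi * (\<Sum>s\<in>T. r s * exp (w * s))"
    by (intro tendsto_intros J_LIMSEQ a b w)
  ultimately have "J b w - J a w - 2 * pi * (\<Sum>s\<in>T. r s * exp (w * s)) = 0"
    by (rule LIMSEQ_unique[symmetric])
  then show ?thesis by (simp add: T_def)
qed

text \<open>The sign \<sigma> treats both directions together. The line over c + \<sigma> m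
  contributes exp (- q m) with q = - \<sigma> Re w > 0, which beats exp (C sqrt m); the constants
  \<open>A\<close> and \<open>C\<close> are the same on all lines.\<close>

lemma J_tendsto_0:
  assumes w: "0 < Im w" "Im w < 2 * pi" and \<sigma>: "\<sigma> = 1 \<or> \<sigma> = -1" "\<sigma> * Re w < 0"
  shows "(\<lambda>m. J (c + \<sigma> * real m) w) \<longlonglongrightarrow> 0"
proof -
  obtain \<kappa> where \<kappa>: "\<kappa> > 0" "3 * \<kappa> \<le> Im w" "Im w \<le> 2 * pi - 3 * \<kappa>" using strip_margin[OF w] .
  define q where "q = - (\<sigma> * Re w)"
  define B where "B = 2 * A * exp (C\<^sup>2 / (4 * \<kappa>) + Re w * c + C * sqrt \<bar>c\<bar>) * (1 / (1 - exp (- \<kappa>)))"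
  have q: "q > 0" using \<sigma> by (simp add: q_def)
  have B: "B \<ge> 0" using A \<kappa> by (simp add: B_def)
  have "norm (J (c + \<sigma> * real m) w) \<le> B * exp (C * sqrt (real m) - q * real m)" for m
  proof -
    have "\<sigma> * real m \<in> \<int>" using \<sigma>(1) by auto
    then have "norm (J (c + \<sigma> * real m) w) \<le> 2 * M \<kappa> (Re w) (c + \<sigma> * real m) * (1 / (1 - exp (- \<kappa>)))"
      using \<kappa> by (intro J_bound) auto
    also have "\<dots> \<le> (2 * A * exp (C\<^sup>2 / (4 * \<kappa>) + Re w * c + C * sqrt \<bar>c\<bar>) * exp (C * sqrt (real m) - q * real m)) * (1 / (1 - exp (- \<kappa>)))"
    proof (rule mult_right_mono)
      show "2 * M \<kappa> (Re w) (c + \<sigma> * real m) \<le> 2 * A * exp (C\<^sup>2 / (4 * \<kappa>) + Re w * c + C * sqrt \<bar>c\<bar>) * exp (C * sqrt (real m) - q * real m)"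
      proof -
        have "sqrt \<bar>c + \<sigma> * real m\<bar> \<le> sqrt (\<bar>c\<bar> + real m)" using \<sigma>(1) by auto
      also have "\<dots> \<le> sqrt \<bar>c\<bar> + sqrt (real m)" by (rule sqrt_add_le_add_sqrt) auto
      finally have "C * sqrt \<bar>c + \<sigma> * real m\<bar> \<le> C * (sqrt \<bar>c\<bar> + sqrt (real m))"
        using C by (rule mult_left_mono)
      moreover have "Re w * (c + \<sigma> * real m) = Re w * c - q * real m" by (simp add: q_def algebra_simps)
      ultimately have "C\<^sup>2 / (4 * \<kappa>) + Re w * (c + \<sigma> * real m) + C * sqrt \<bar>c + \<sigma> * real m\<bar>
          \<le> (C\<^sup>2 / (4 * \<kappa>) + Re w * c + C * sqrt \<bar>c\<bar>) + (C * sqrt (real m) - q * real m)"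
        by (simp add: distrib_left)
      then have "2 * A * exp (C\<^sup>2 / (4 * \<kappa>) + Re w * (c + \<sigma> * real m) + C * sqrt \<bar>c + \<sigma> * real m\<bar>)
          \<le> 2 * A * exp ((C\<^sup>2 / (4 * \<kappa>) + Re w * c + C * sqrt \<bar>c\<bar>) + (C * sqrt (real m) - q * real m))"
        using A by (intro mult_left_mono) auto
      then show ?thesis unfolding M_def exp_add[of "C\<^sup>2 / (4 * \<kappa>) + Re w * c + C * sqrt \<bar>c\<bar>"]
        by (simp add: mult.assoc)
      qed
    qed (use \<kappa> in simp)
    finally show ?thesis by (simp only: B_def mult_ac)
  qed
  moreover have "(\<lambda>m. B * exp (C * sqrt (real m) - q * real m)) \<longlonglongrightarrow> 0"
  proof -
    have "filterlim (\<lambda>m. C * sqrt (real m) - q * real m) at_bot sequentially"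
    proof (rule filterlim_at_bot_mono)
      \<comment> \<open>Half of q m absorbs C sqrt m by completing the square; the other half still
        drives the exponent to minus infinity.\<close>
      show "filterlim (\<lambda>m. C\<^sup>2 / (2 * q) - (q / 2) * real m) at_bot sequentially"
        using q by real_asymp
      show "\<forall>\<^sub>F m in sequentially. C * sqrt (real m) - q * real m \<le> C\<^sup>2 / (2 * q) - (q / 2) * real m"
      proof (intro always_eventually allI)
        fix m :: nat
        define s where "s = sqrt (real m)"
        have s: "s * s = real m" by (simp add: s_def)
        have "0 \<le> (q / 2) * (s - C / q)\<^sup>2" using q by simp
        also have "\<dots> = (q / 2) * (s * s) + C\<^sup>2 / (2 * q) - C * s"
          using q by (simp add: power2_eq_square field_simps)
        finally show "C * sqrt (real m) - q * real m \<le> C\<^sup>2 / (2 * q) - (q / 2) * real m"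
          unfolding s_def[symmetric] s by simp
      qed
    qed
    then have "(\<lambda>m. exp (C * sqrt (real m) - q * real m)) \<longlonglongrightarrow> 0"
      by (rule filterlim_compose[OF exp_at_bot])
    then show ?thesis by (intro tendsto_mult_right_zero)
  qed
  ultimately show ?thesis by (rule Lim_null_comparison[OF always_eventually[OF allI]])
qed

end

subsection \<open>Algebra of the rank one perturbation\<close>

lemma matrix_vector_mult_sum:
  fixes M :: "'a::field^'n^'m"
  shows "M *v (\<Sum>k\<in>A. c k *s x k) = (\<Sum>k\<in>A. c k *s (M *v x k))"
  by (induction A rule: infinite_finite_induct) (simp_all add: matrix_vector_right_distrib vector_scalar_commute)

lemma dual_app_add: "dual_app phi (x + y) = dual_app phi x + dual_app phi y"
  by (simp add: dual_app_def distrib_left sum.distrib)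

lemma dual_app_smult: "dual_app phi (c *s x) = c * dual_app phi x"
  by (simp add: dual_app_def sum_distrib_left mult_ac)

lemma dual_app_sum: "dual_app phi (\<Sum>k\<in>A. c k *s x k) = (\<Sum>k\<in>A. c k * dual_app phi (x k))"
  by (induction A rule: infinite_finite_induct) (simp_all add: dual_app_add dual_app_smult, simp_all add: dual_app_def)

text \<open>Applying M - l j to a relation removes the term of j and multiplies every other
  coefficient by a nonzero number.\<close>

lemma eigenvectors_independent:
  fixes M :: "complex^'n::finite^'n" and l :: "'n \<Rightarrow> complex"
  assumes l: "inj l" and eig: "\<And>i. M *v x i = l i *s x i" and nz: "\<And>i. x i \<noteq> 0"
    and "(\<Sum>i\<in>A. c i *s x i) = 0" "i \<in> A"
  shows "c i = 0"
  using finite[of A] assms(4,5)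
proof (induction A arbitrary: c i rule: finite_induct)
  case (insert j A)
  have "0 = M *v (\<Sum>i\<in>insert j A. c i *s x i) - l j *s (\<Sum>i\<in>insert j A. c i *s x i)"
    by (simp add: insert.prems(1))
  also have "\<dots> = (\<Sum>i\<in>insert j A. (c i * (l i - l j)) *s x i)"
    unfolding matrix_vector_mult_sum vec.scale_sum_right sum_subtractf[symmetric]
    by (intro sum.cong refl) (simp add: eig vector_smult_assoc algebra_simps vector_sub_rdistrib)
  also have "\<dots> = (\<Sum>i\<in>A. (c i * (l i - l j)) *s x i)"
    using insert.hyps by simp
  finally have "(\<Sum>i\<in>A. (c i * (l i - l j)) *s x i) = 0" by simp
  then have "c i * (l i - l j) = 0" if "i \<in> A" for i
    using insert.IH[of "\<lambda>i. c i * (l i - l j)"] that by blast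
  moreover have "l i \<noteq> l j" if "i \<in> A" for i using that insert.hyps l by (auto dest: injD)
  ultimately have A: "c i = 0" if "i \<in> A" for i using that by fastforce
  then have "(\<Sum>i\<in>A. c i *s x i) = 0" by (intro sum.neutral) simp
  then have "c j *s x j = 0" using insert.prems(1) insert.hyps by simp
  then have "c j = 0" using nz[of j] by simp
  then show ?case using A insert.prems(2) by auto
qed simp

lemma independent_family_spans:
  fixes x :: "'n::finite \<Rightarrow> complex^'n"
  assumes "\<And>c. (\<Sum>i\<in>UNIV. c i *s x i) = 0 \<Longrightarrow> \<forall>i. c i = 0"
  shows "\<exists>c. y = (\<Sum>i\<in>UNIV. c i *s x i)"
proof -
  define X where "X = (\<chi> r k. x k $ r)"
  have col: "column k X = x k" for k by (simp add: X_def column_def vec_eq_iff)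
  have "\<exists>B. B ** X = mat 1"
    unfolding matrix_left_invertible_independent_columns col using assms by blast
  then obtain B where "X ** B = mat 1" using matrix_left_right_inverse by blast
  then have "y = X *v (B *v y)" by (simp add: matrix_vector_mul_assoc)
  also have "\<dots> = (\<Sum>i\<in>UNIV. (B *v y) $ i *s x i)"
    unfolding matrix_mult_sum col ..
  finally show ?thesis by blast
qed

text \<open>Under z -> 1/z the matrix Q - P takes over the role of P.\<close>

lemma formal_sol_inf_iff: "formal_sol_inf P Q mu b \<longleftrightarrow> formal_sol0 (Q - P) Q (- mu) b"
proof -
  have "(- (mu *s b 0) = - (P *v b 0) + Q *v b 0) \<longleftrightarrow> (- mu) *s b 0 = (Q - P) *v b 0"
    by (simp add: matrix_vector_mult_diff_rdistrib vector_smult_lneg)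
  moreover have "(mu - of_nat n + 1) *s b (n - 1) - (mu - of_nat n) *s b n = P *v b (n - 1) - P *v b n + Q *v b n
    \<longleftrightarrow> (- mu + of_nat n) *s b n - (- mu + of_nat n - 1) *s b (n - 1)
       = (Q - P) *v b n - (Q - P) *v b (n - 1) + Q *v b (n - 1)" for n
  proof -
    have "(mu - of_nat n + 1) *s b (n - 1) - (mu - of_nat n) *s b n = (- mu + of_nat n) *s b n - (- mu + of_nat n - 1) *s b (n - 1)"
      by (simp add: vec_eq_iff algebra_simps)
    moreover have "P *v b (n - 1) - P *v b n + Q *v b n = (Q - P) *v b n - (Q - P) *v b (n - 1) + Q *v b (n - 1)"
      by (simp add: matrix_vector_mult_diff_rdistrib)
    ultimately show ?thesis by (simp only:)
  qed
  ultimately show ?thesis unfolding formal_sol_inf_def formal_sol0_def by simp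
qed

lemma no_pos_int_diff_uminus:
  assumes "no_pos_int_diff l"
  shows "no_pos_int_diff (\<lambda>i. - l i)"
  unfolding no_pos_int_diff_def
proof (intro allI impI)
  fix i k and m :: nat assume "m > 0"
  then have "l k - l i \<noteq> of_nat m" using assms unfolding no_pos_int_diff_def by blast
  then show "- l i - - l k \<noteq> of_nat m" by simp
qed

section \<open>Coordinates in the eigenbasis of P, the secular equation and the formal
  solutions\<close>

locale rank_one_pair =
  fixes P Q :: "complex^'n::finite^'n"
    and phi v :: "complex^'n"
    and lam mu :: "'n \<Rightarrow> complex"
    and xi zeta :: "'n \<Rightarrow> complex^'n"
    and d :: "'n \<Rightarrow> complex"
  assumes Q_rank1: "Q *v x = dual_app phi x *s v"
    and lam_inj: "inj lam"
    and lam_nodiff: "no_pos_int_diff lam"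
    and xi_eig: "P *v xi i = lam i *s xi i"
    and xi_norm: "dual_app phi (xi i) = 1"
    and d_nz: "d i \<noteq> 0"
    and v_xi: "v = (\<Sum>i\<in>UNIV. d i *s xi i)"
    and mu_inj: "inj mu"
    and mu_nodiff: "no_pos_int_diff mu"
    and zeta_eig: "(Q - P) *v zeta j = (- mu j) *s zeta j"
    and zeta_norm: "dual_app phi (zeta j) = 1"
begin

definition comb :: "('n \<Rightarrow> complex) \<Rightarrow> complex^'n" where
  "comb c = (\<Sum>k\<in>UNIV. c k *s xi k)"

lemma xi_nz: "xi i \<noteq> 0"
  using xi_norm[of i] by (auto simp: dual_app_def)

lemma comb_eq_iff: "comb c = comb c' \<longleftrightarrow> c = c'"
proof
  assume "comb c = comb c'"
  then have "(\<Sum>i\<in>UNIV. (c i - c' i) *s xi i) = 0"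
    by (simp add: comb_def vector_sub_rdistrib sum_subtractf)
  then have "c i - c' i = 0" for i
    using eigenvectors_independent[OF lam_inj xi_eig xi_nz, of "\<lambda>i. c i - c' i" UNIV i] by simp
  then show "c = c'" by (simp add: fun_eq_iff)
qed simp

lemma comb_exhaust: obtains c where "x = comb c"
  using independent_family_spans[of xi x] eigenvectors_independent[OF lam_inj xi_eig xi_nz, of _ UNIV]
  unfolding comb_def by blast

lemma comb_add: "comb c + comb c' = comb (\<lambda>k. c k + c' k)"
  and comb_diff: "comb c - comb c' = comb (\<lambda>k. c k - c' k)"
  and comb_smult: "s *s comb c = comb (\<lambda>k. s * c k)"
  by (simp_all add: comb_def sum.distrib vector_sadd_rdistrib vector_sub_rdistrib sum_subtractf vec.scale_sum_right)

lemma P_comb: "P *v comb c = comb (\<lambda>k. lam k * c k)"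
  unfolding comb_def matrix_vector_mult_sum by (intro sum.cong) (simp_all add: xi_eig vector_smult_assoc mult.commute)

lemma dual_app_comb: "dual_app phi (comb c) = (\<Sum>k\<in>UNIV. c k)"
  unfolding comb_def dual_app_sum by (simp add: xi_norm)

lemma Q_comb: "Q *v comb c = comb (\<lambda>k. (\<Sum>l\<in>UNIV. c l) * d k)"
  unfolding Q_rank1 dual_app_comb v_xi comb_def[symmetric] comb_smult ..

lemma lam_diff_nz: "n > 0 \<Longrightarrow> lam i + of_nat n - lam k \<noteq> 0"
  using lam_nodiff unfolding no_pos_int_diff_def
  by (metis add_diff_eq add.commute diff_eq_diff_eq diff_0_right add_diff_cancel_left' eq_iff_diff_eq_0)

text \<open>In the eigenbasis P is diagonal and phi is the sum of coordinates, so the components of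
  the recurrence are coupled only through that sum.\<close>

lemma formal_sol0_comb_iff:
  "formal_sol0 P Q s (\<lambda>n. comb (c n)) \<longleftrightarrow>
     (\<forall>k. (s - lam k) * c 0 k = 0) \<and>
     (\<forall>n k. (s + of_nat n + 1 - lam k) * c (Suc n) k = (s + of_nat n - lam k) * c n k + d k * (\<Sum>l\<in>UNIV. c n l))"
proof -
  have "(\<forall>n\<ge>1. F n) \<longleftrightarrow> (\<forall>n. F (Suc n))" for F :: "nat \<Rightarrow> bool"
    by (metis One_nat_def Suc_le_D Suc_le_mono le0)
  moreover have "(x - y) * z = 0 \<longleftrightarrow> x * z = y * z" for x y z :: complex by (simp add: algebra_simps)
  moreover have "((s + of_nat (Suc n)) * x - (s + of_nat (Suc n) - 1) * y = l * x - l * y + q * e)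
     \<longleftrightarrow> ((s + of_nat n + 1 - l) * x = (s + of_nat n - l) * y + e * q)" for x y l q e :: complex and n
    by (simp add: algebra_simps)
  ultimately show ?thesis
    unfolding formal_sol0_def P_comb Q_comb comb_smult comb_diff comb_add comb_eq_iff fun_eq_iff
    by simp
qed

text \<open>Distinctness of the \<open>lam k\<close> forces the leading coefficient onto the line of
  \<open>xi i\<close>, and the divisors lam i + n + 1 - lam k never vanish, so the solutions form a
  line on which phi of the leading term is a coordinate. This identifies families of residues with
  the given coefficients.\<close>

lemma formal_sol0_unique:
  assumes a: "a 0 = xi i" "formal_sol0 P Q (lam i) a" and B: "formal_sol0 P Q (lam i) B"
  shows "B n = dual_app phi (B 0) *s a n"
proof -
  have "\<forall>n. \<exists>c. a n = comb c" "\<forall>n. \<exists>c. B n = comb c" using comb_exhaust by metis+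
  then obtain ca cB where c: "a = (\<lambda>n. comb (ca n))" "B = (\<lambda>n. comb (cB n))"
    unfolding fun_eq_iff by metis
  have ra: "(lam i + of_nat n + 1 - lam k) * ca (Suc n) k = (lam i + of_nat n - lam k) * ca n k + d k * (\<Sum>l\<in>UNIV. ca n l)" for n k
    using a(2) unfolding c formal_sol0_comb_iff by blast
  have rB: "(lam i + of_nat n + 1 - lam k) * cB (Suc n) k = (lam i + of_nat n - lam k) * cB n k + d k * (\<Sum>l\<in>UNIV. cB n l)" 
    and B0: "(lam i - lam k) * cB 0 k = 0" for n k
    using B unfolding c formal_sol0_comb_iff by blast+
  have a0: "ca 0 k = (if k = i then 1 else 0)" for k
  proof -
    have "comb (\<lambda>k. if k = i then 1 else 0) = xi i"
      by (simp add: comb_def if_distrib[of "\<lambda>c. c *s _"] sum.delta cong: if_cong)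
    then have "comb (ca 0) = comb (\<lambda>k. if k = i then 1 else 0)" using a(1) c by simp
    then show ?thesis unfolding comb_eq_iff by simp
  qed
  define \<kappa> where "\<kappa> = cB 0 i"
  have B0': "cB 0 k = \<kappa> * ca 0 k" for k
    using B0[of k] lam_inj by (auto simp: a0 \<kappa>_def dest: injD)
  have "cB n k = \<kappa> * ca n k" for k
  proof (induction n arbitrary: k)
    case 0
    show ?case by (rule B0')
  next
    case (Suc n)
    have "(lam i + of_nat n + 1 - lam k) * cB (Suc n) k = (lam i + of_nat n + 1 - lam k) * (\<kappa> * ca (Suc n) k)"
    proof -
      have "x * (\<kappa> * y) + e * (\<Sum>l\<in>UNIV. \<kappa> * ca n l) = \<kappa> * (x * y + e * (\<Sum>l\<in>UNIV. ca n l))" for x y e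
        by (simp add: sum_distrib_left [symmetric] distrib_left mult.left_commute)
      moreover have "(lam i + of_nat n + 1 - lam k) * (\<kappa> * ca (Suc n) k) = \<kappa> * ((lam i + of_nat n + 1 - lam k) * ca (Suc n) k)"
        by (rule mult.left_commute)
      ultimately show ?thesis unfolding rB Suc using ra by (simp only:)
    qed
    moreover have "lam i + of_nat n + 1 - lam k \<noteq> 0" using lam_diff_nz[of "Suc n" i k] by (simp add: add_ac)
    ultimately show ?case by simp
  qed
  moreover have "dual_app phi (B 0) = \<kappa>"
    unfolding c dual_app_comb B0' by (simp add: a0 sum_distrib_left [symmetric])
  ultimately have "cB n = (\<lambda>k. \<kappa> * ca n k)" "dual_app phi (B 0) = \<kappa>" by auto
  then show ?thesis unfolding c comb_smult by simp
qed

text \<open>With the coordinates z of \<open>zeta j\<close> summing to 1, the eigenvalue equation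
  reads (mu j - lam k) z k = - d k. As d k is nonzero, so is mu j - lam k, and summing z gives the
  secular equation.\<close>

lemma mu_char: "mu j \<noteq> lam k" "(\<Sum>k\<in>UNIV. d k / (mu j - lam k)) = - 1"
proof -
  obtain z where z: "zeta j = comb z" by (rule comb_exhaust)
  have sz: "(\<Sum>k\<in>UNIV. z k) = 1" using zeta_norm[of j] by (simp add: z dual_app_comb)
  have "Q *v zeta j - P *v zeta j = (- mu j) *s zeta j"
    using zeta_eig[of j] by (simp add: matrix_vector_mult_diff_rdistrib)
  then have "(\<lambda>k. (\<Sum>l\<in>UNIV. z l) * d k - lam k * z k) = (\<lambda>k. - mu j * z k)"
    unfolding z P_comb Q_comb comb_diff comb_smult comb_eq_iff .
  then have zk: "(mu j - lam k) * z k = - d k" for k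
    unfolding fun_eq_iff sz by (metis (no_types, opaque_lifting) add_diff_cancel_left' diff_add_cancel left_diff_distrib minus_diff_eq mult_1 mult_minus_left uminus_add_conv_diff)
  show *: "mu j \<noteq> lam k" for k using zk[of k] d_nz[of k] by auto
  have "d k / (mu j - lam k) = - z k" for k
    using zk[of k] *[of k] by (simp add: divide_eq_eq mult.commute)
  then show "(\<Sum>k\<in>UNIV. d k / (mu j - lam k)) = - 1"
    by (simp add: sum_negf sz)
qed

text \<open>This is det (t - P + Q) / det (t - P), the mu j being the eigenvalues of P - Q.\<close>

definition \<rho> :: "complex \<Rightarrow> complex" where
  "\<rho> t = (\<Prod>j\<in>UNIV. t - mu j) / (\<Prod>k\<in>UNIV. t - lam k)"

text \<open>After clearing denominators both sides are monic of degree N, and they agree at the N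
  distinct points mu j by the secular equation.\<close>

lemma \<rho>_partial_fractions:
  assumes t: "\<And>k. t \<noteq> lam k"
  shows "\<rho> t = 1 + (\<Sum>k\<in>UNIV. d k / (t - lam k))"
proof -
  define N where "N = CARD('n)"
  define p where "p = (\<Prod>k\<in>UNIV. [:- lam k, 1:]) + (\<Sum>k\<in>UNIV. Polynomial.smult (d k) (\<Prod>l\<in>UNIV - {k}. [:- lam l, 1:]))"
  define q where "q = (\<Prod>j\<in>UNIV. [:- mu j, 1:])"
  have deg: "degree (\<Prod>l\<in>A. [:- f l, 1:]) = card A" for A :: "'n set" and f :: "'n \<Rightarrow> complex"
    by (subst degree_prod_eq_sum_degree) auto
  have lc: "coeff (\<Prod>l\<in>UNIV. [:- f l, 1:]) N = 1" for f :: "'n \<Rightarrow> complex"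
    using lead_coeff_prod[of "\<lambda>l. [:- f l, 1:]" UNIV] by (simp add: deg N_def)
  have poly_p: "poly p s = (\<Prod>k\<in>UNIV. s - lam k) * (1 + (\<Sum>k\<in>UNIV. d k / (s - lam k)))"
    if "\<And>k. s \<noteq> lam k" for s
  proof -
    have "d k * (\<Prod>l\<in>UNIV - {k}. s - lam l) = (\<Prod>l\<in>UNIV. s - lam l) * (d k / (s - lam k))" for k
      using that[of k] prod.remove[of UNIV k "\<lambda>l. s - lam l"] by simp
    then show ?thesis
      by (simp add: p_def poly_prod poly_sum distrib_left sum_distrib_left)
  qed
  have small: "degree (Polynomial.smult (d k) (\<Prod>l\<in>UNIV - {k}. [:- lam l, 1:])) < N" for k
  proof -
    have "degree (Polynomial.smult (d k) (\<Prod>l\<in>UNIV - {k}. [:- lam l, 1:])) \<le> N - 1"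
      by (rule order.trans[OF degree_smult_le]) (simp add: deg N_def)
    moreover have "N > 0" by (simp add: N_def)
    ultimately show ?thesis by linarith
  qed
  have "p = q"
  proof (rule poly_eqI_degree_lead_coeff[where n = N and A = "range mu"])
    have "coeff (\<Sum>k\<in>UNIV. Polynomial.smult (d k) (\<Prod>l\<in>UNIV - {k}. [:- lam l, 1:])) N = 0"
      unfolding coeff_sum using small by (intro sum.neutral ballI coeff_eq_0)
    then show "coeff p N = coeff q N"
      unfolding p_def q_def coeff_add lc by simp
    show "N \<le> card (range mu)" using card_image[OF mu_inj] by (simp add: N_def)
    show "degree p \<le> N" unfolding p_def
      using small by (intro degree_add_le degree_sum_le) (auto simp: deg N_def intro: less_imp_le)
    show "degree q \<le> N" unfolding q_def by (simp add: deg N_def)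
    fix z assume "z \<in> range mu"
    then obtain j where j: "z = mu j" by blast
    show "poly p z = poly q z"
      unfolding j using mu_char(1)[of j] by (subst poly_p) (auto simp: mu_char(2) q_def poly_prod)
  qed
  then have "(\<Prod>j\<in>UNIV. t - mu j) = (\<Prod>k\<in>UNIV. t - lam k) * (1 + (\<Sum>k\<in>UNIV. d k / (t - lam k)))"
    using poly_p[OF t] by (simp add: q_def poly_prod)
  moreover have "(\<Prod>k\<in>UNIV. t - lam k) \<noteq> 0" using t by simp
  ultimately show ?thesis unfolding \<rho>_def by simp
qed

text \<open>The constant c_ij. With \<open>rGamma\<close> in place of a quotient, a pole of Gamma in
  the denominator makes it 0; \<open>resonant\<close> relies on this.\<close>

definition conn :: "'n \<Rightarrow> 'n \<Rightarrow> complex" where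
  "conn i j = exp (\<i> * pi * (lam i - mu j))
      * (\<Prod>k\<in>UNIV - {i}. Gamma (lam i - lam k + 1))
      * (\<Prod>m\<in>UNIV - {j}. Gamma (mu j - mu m))
      * (\<Prod>m\<in>UNIV - {j}. rGamma (lam i - mu m + 1))
      * (\<Prod>k\<in>UNIV - {i}. rGamma (mu j - lam k))"

text \<open>Summing the recurrence over n telescopes, so each coordinate of \<open>a n\<close> is d
  k * s n / (lam i + n - lam k) once n > 0. Adding the coordinates turns this into s (n+1) = s n *
  \<rho> (lam i + n), whose solution is the product of Pochhammer quotients.\<close>

lemma coefficients_hypergeometric:
  assumes a: "a 0 = xi i" "formal_sol0 P Q (lam i) a"
  defines "s \<equiv> \<lambda>n. \<Sum>m<n. dual_app phi (a m)"
  shows "a n = comb c \<Longrightarrow> (lam i + of_nat n - lam k) * c k = d k * s n"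
    and "s (Suc n) = (\<Prod>j\<in>UNIV. pochhammer (lam i - mu j + 1) n) / (\<Prod>k\<in>UNIV. pochhammer (lam i - lam k + 1) n)"
proof -
  have "\<forall>n. \<exists>c. a n = comb c" using comb_exhaust by metis
  then obtain ca where ca: "\<And>n. a n = comb (ca n)" by metis
  have c: "a = (\<lambda>n. comb (ca n))" using ca by blast
  have ra: "(lam i + of_nat n + 1 - lam k) * ca (Suc n) k = (lam i + of_nat n - lam k) * ca n k + d k * (\<Sum>l\<in>UNIV. ca n l)"
    and r0: "(lam i - lam k) * ca 0 k = 0" for n k
    using a(2) unfolding c formal_sol0_comb_iff by blast+
  have 1: "(lam i + of_nat n - lam k) * ca n k = d k * s n" for n k
  proof (induction n)
    case 0
    then show ?case using r0 by (simp add: s_def)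
  next
    case (Suc n)
    have "(lam i + of_nat (Suc n) - lam k) * ca (Suc n) k = d k * s n + d k * (\<Sum>l\<in>UNIV. ca n l)"
      using ra[of n k] Suc by (simp add: add_ac)
    also have "\<dots> = d k * s (Suc n)"
      by (simp add: s_def c dual_app_comb distrib_left)
    finally show ?case .
  qed
  show "(lam i + of_nat n - lam k) * c k = d k * s n" if "a n = comb c"
    using that 1[of n k] unfolding ca comb_eq_iff by simp
  have step: "s (Suc (Suc n)) = s (Suc n) * \<rho> (lam i + of_nat (Suc n))" for n
  proof -
    have nz: "lam i + of_nat (Suc n) - lam k \<noteq> 0" for k by (rule lam_diff_nz) simp
    then have "ca (Suc n) k = s (Suc n) * (d k / (lam i + of_nat (Suc n) - lam k))" for k
      using 1[of "Suc n" k] by (simp add: eq_divide_eq mult_ac)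
    then have "dual_app phi (a (Suc n)) = s (Suc n) * (\<Sum>k\<in>UNIV. d k / (lam i + of_nat (Suc n) - lam k))"
      unfolding ca dual_app_comb sum_distrib_left by (intro sum.cong) auto
    also have "\<dots> = s (Suc n) * (\<rho> (lam i + of_nat (Suc n)) - 1)"
      using nz by (subst \<rho>_partial_fractions) auto
    finally show ?thesis by (simp add: s_def algebra_simps)
  qed
  show "s (Suc n) = (\<Prod>j\<in>UNIV. pochhammer (lam i - mu j + 1) n) / (\<Prod>k\<in>UNIV. pochhammer (lam i - lam k + 1) n)"
  proof (induction n)
    case 0
    then show ?case by (simp add: s_def a(1) xi_norm)
  next
    case (Suc n)
    have "\<rho> (lam i + of_nat (Suc n)) = (\<Prod>j\<in>UNIV. lam i - mu j + 1 + of_nat n) / (\<Prod>k\<in>UNIV. lam i - lam k + 1 + of_nat n)"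
      by (simp add: \<rho>_def algebra_simps)
    then show ?case
      unfolding step Suc pochhammer_Suc prod.distrib by simp
  qed
qed

lemma lam_nonpos_Ints: "lam i - lam k + of_nat (Suc n) \<notin> \<int>\<^sub>\<le>\<^sub>0"
proof
  assume "lam i - lam k + of_nat (Suc n) \<in> \<int>\<^sub>\<le>\<^sub>0"
  then obtain m where "lam i - lam k + of_nat (Suc n) = - of_nat m" by (auto elim: nonpos_Ints_cases')
  then have "lam k - lam i = of_nat (Suc (n + m))" by (simp add: algebra_simps)
  then show False using lam_nodiff unfolding no_pos_int_diff_def by blast
qed

lemma mu_diff_Ints: "j \<noteq> m \<Longrightarrow> mu j - mu m \<notin> \<int>"
proof
  assume "j \<noteq> m" "mu j - mu m \<in> \<int>"
  then obtain z where z: "mu j - mu m = of_int z" by (auto elim: Ints_cases)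
  consider "z = 0" | "z > 0" | "z < 0" by linarith
  then show False
  proof cases
    case 1
    then show False using z mu_inj \<open>j \<noteq> m\<close> by (auto dest: injD)
  next
    case 2
    then have "mu j - mu m = of_nat (nat z)" "nat z > 0" using z by auto
    then show False using mu_nodiff unfolding no_pos_int_diff_def by blast
  next
    case 3
    then have "mu m - mu j = of_nat (nat (- z))" "nat (- z) > 0" using z by (auto simp: algebra_simps)
    then show False using mu_nodiff unfolding no_pos_int_diff_def by blast
  qed
qed

end

section \<open>The symmetry between P and Q - P, and the resonant case\<close>

locale rank_one_connection = rank_one_pair +
  fixes e :: "'a \<Rightarrow> complex"
  assumes e_nz: "e j \<noteq> 0" and v_zeta: "v = (\<Sum>j\<in>UNIV. e j *s zeta j)"
begin

text \<open>Since Q - (Q - P) = P, the data are symmetric. This makes every statement about the f_i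
  available for the h_j: uniqueness of the coefficients, and convergence and continuation of the
  series.\<close>

lemma flip: "rank_one_connection (Q - P) Q phi v (\<lambda>j. - mu j) (\<lambda>k. - lam k) zeta xi e d"
proof -
  have QP: "Q - (Q - P) = P" by simp
  have 1: "inj (\<lambda>j. - mu j)" "inj (\<lambda>k. - lam k)" using mu_inj lam_inj by (auto simp: inj_def)
  have 2: "no_pos_int_diff (\<lambda>j. - mu j)" "no_pos_int_diff (\<lambda>k. - lam k)"
    using mu_nodiff lam_nodiff by (auto intro: no_pos_int_diff_uminus)
  have 3: "(Q - (Q - P)) *v xi j = - (- lam j) *s xi j" for j
    unfolding QP minus_minus by (rule xi_eig)
  show ?thesis
    by (intro rank_one_connection.intro rank_one_pair.intro rank_one_connection_axioms.intro)
      (fact Q_rank1 zeta_eig zeta_norm e_nz v_zeta xi_norm d_nz v_xi 1 2 3)+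
qed

text \<open>Here the pole sequences lam i + n and mu j - n collide, but the series f_i terminates and,
  read backwards, is a multiple of h_j.\<close>

lemma resonant:
  assumes a: "a 0 = xi i" "formal_sol0 P Q (lam i) a"
    and b: "b 0 = zeta j" "formal_sol_inf P Q (mu j) b"
    and p: "mu j = lam i + of_nat p"
  shows "n > p \<Longrightarrow> a n = 0" 
    and "conn i j *s b n = (if n \<le> p then a (p - n) else 0)"
    and "m \<noteq> j \<Longrightarrow> conn i m = 0"
proof -
  interpret flip: rank_one_connection "Q - P" Q phi v "\<lambda>j. - mu j" "\<lambda>k. - lam k" zeta xi e d by (rule flip)
  have "p \<noteq> 0" using mu_char(1)[of j i] p by auto
  then obtain p' where p': "p = Suc p'" by (cases p) auto
  define s where "s n = (\<Sum>m<n. dual_app phi (a m))" for n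
  have s: "s (Suc n) = (\<Prod>j\<in>UNIV. pochhammer (lam i - mu j + 1) n) / (\<Prod>k\<in>UNIV. pochhammer (lam i - lam k + 1) n)" for n
    unfolding s_def by (rule coefficients_hypergeometric(2)[OF a])
  have res: "lam i - mu j + 1 = - of_nat p'" by (simp add: p p')
  have "s (Suc n) = 0" if "n \<ge> p" for n
  proof -
    have "pochhammer (lam i - mu j + 1) n = 0" unfolding res using that p' by (intro pochhammer_of_nat_eq_0_lemma) auto
    then have "(\<Prod>j\<in>UNIV. pochhammer (lam i - mu j + 1) n) = 0" by (auto simp: prod_zero_iff)
    then show ?thesis unfolding s by simp
  qed
  then have s0: "s n = 0" if "n > p" for n using that by (cases n) auto
  show a_zero: "a n = 0" if "n > p" for n
  proof -
    obtain c where c: "a n = comb c" by (rule comb_exhaust)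
    have "(lam i + of_nat n - lam k) * c k = 0" for k
      using coefficients_hypergeometric(1)[OF a c, of k] s0[OF that] unfolding s_def by simp
    then have "c = (\<lambda>k. 0)" using lam_diff_nz[of n i] that by auto
    then show ?thesis unfolding c by (simp add: comb_def)
  qed
  define B where "B n = (if n \<le> p then a (p - n) else 0)" for n
  have a_rec: "(lam i + of_nat n) *s a n - (lam i + of_nat n - 1) *s a (n - 1) = P *v a n - P *v a (n - 1) + Q *v a (n - 1)"
    if "n \<ge> 1" for n using a(2) that unfolding formal_sol0_def by blast
  have "formal_sol_inf P Q (mu j) B"
    unfolding formal_sol_inf_def
  proof (intro conjI allI impI)
    \<comment> \<open>The recurrence for \<open>a\<close> at index p + 1, where a (p+1) = 0, is the
      leading equation at infinity.\<close>
    show "- (mu j *s B 0) = - (P *v B 0) + Q *v B 0"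
      using a_rec[of "Suc p"] a_zero[of "Suc p"] by (simp add: B_def p)
    fix n :: nat assume n: "n \<ge> 1"
    show "(mu j - of_nat n + 1) *s B (n - 1) - (mu j - of_nat n) *s B n = P *v B (n - 1) - P *v B n + Q *v B n"
    proof (cases "n \<le> p")
      case True
      have 1: "mu j - of_nat n + 1 = lam i + of_nat (p - n + 1)" "mu j - of_nat n = lam i + of_nat (p - n + 1) - 1"
        using True by (auto simp: p of_nat_diff)
      have 2: "B (n - 1) = a (p - n + 1)" "B n = a (p - n + 1 - 1)"
        using True n by (auto simp: B_def Suc_diff_le)
      have 3: "(mu j - of_nat n + 1) *s B (n - 1) = (lam i + of_nat (p - n + 1)) *s a (p - n + 1)"
        "(mu j - of_nat n) *s B n = (lam i + of_nat (p - n + 1) - 1) *s a (p - n + 1 - 1)"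
        by (rule arg_cong2[where f = "(*s)"], rule 1, rule 2)+
      show ?thesis unfolding 3 unfolding 2 by (rule a_rec) simp
    next
      case False
      show ?thesis
      \<comment> \<open>Just past the end of the reversed series the required equation is lam i a 0
        = P a 0; beyond that both sides are 0.\<close>
      proof (cases "n = Suc p")
        case True
        have "lam i *s a 0 = P *v a 0" using a(2) unfolding formal_sol0_def by blast
        moreover have "B (n - 1) = a 0" "B n = 0" "mu j - of_nat n + 1 = lam i"
          using True by (auto simp: B_def p)
        ultimately show ?thesis by simp
      next
        case ne: False
        then have "B (n - 1) = 0" "B n = 0" using False by (auto simp: B_def)
        then show ?thesis by simp
      qed
    qed
  qed
  then have "B n = dual_app phi (B 0) *s b n" for n
    using b unfolding formal_sol_inf_iff by (intro flip.formal_sol0_unique) auto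
  moreover have "dual_app phi (B 0) = conn i j"
  proof -
    \<comment> \<open>phi (a p) is a difference of consecutive partial sums, the later of which is
      0. In the product formula for s p the factors of j and i give (-1)^p' p! up to the shift, that
      is (-1)^p' fact p' / fact p'; with the minus sign this is (-1)^p = exp (i pi (lam i - mu
      j)).\<close>
    have "dual_app phi (B 0) = s (Suc p) - s p" by (simp add: B_def s_def)
    also have "\<dots> = - s (Suc p')" using s0[of "Suc p"] by (simp add: p')
    also have "s (Suc p') = (pochhammer (lam i - mu j + 1) p' * (\<Prod>m\<in>UNIV - {j}. pochhammer (lam i - mu m + 1) p'))
        / (pochhammer (lam i - lam i + 1) p' * (\<Prod>k\<in>UNIV - {i}. pochhammer (lam i - lam k + 1) p'))"
      unfolding s by (subst prod.remove[of _ j], simp, simp, subst prod.remove[of _ i], simp_all)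
    also have "pochhammer (lam i - lam i + 1) p' = fact p'" by (simp add: pochhammer_fact)
    also have "pochhammer (lam i - mu j + 1) p' = (-1) ^ p' * fact p'"
      unfolding res by (rule pochhammer_same)
    also have "(\<Prod>m\<in>UNIV - {j}. pochhammer (lam i - mu m + 1) p') = (\<Prod>m\<in>UNIV - {j}. Gamma (mu j - mu m) * rGamma (lam i - mu m + 1))"
    proof (rule prod.cong)
      fix m assume m: "m \<in> UNIV - {j}"
      have "lam i - mu m + 1 \<notin> \<int>\<^sub>\<le>\<^sub>0"
      proof
        assume "lam i - mu m + 1 \<in> \<int>\<^sub>\<le>\<^sub>0"
        then have "lam i - mu m + 1 \<in> \<int>" using nonpos_Ints_subset_Ints by blast
        then have "(lam i - mu m + 1) + of_nat p' \<in> \<int>" by simp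
        moreover have "(lam i - mu m + 1) + of_nat p' = mu j - mu m" by (simp add: p p')
        ultimately show False using mu_diff_Ints[of j m] m by (simp only:) auto
      qed
      then have "pochhammer (lam i - mu m + 1) p' = Gamma (lam i - mu m + 1 + of_nat p') / Gamma (lam i - mu m + 1)"
        by (rule pochhammer_Gamma)
      also have "lam i - mu m + 1 + of_nat p' = mu j - mu m" by (simp add: p p')
      finally show "pochhammer (lam i - mu m + 1) p' = Gamma (mu j - mu m) * rGamma (lam i - mu m + 1)"
        by (simp add: rGamma_inverse_Gamma divide_inverse)
    qed simp
    also have "(\<Prod>k\<in>UNIV - {i}. pochhammer (lam i - lam k + 1) p') = inverse (\<Prod>k\<in>UNIV - {i}. Gamma (lam i - lam k + 1) * rGamma (mu j - lam k))"
      unfolding prod_inversef [symmetric]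
    proof (rule prod.cong)
      fix k assume k: "k \<in> UNIV - {i}"
      have "lam i - lam k + 1 \<notin> \<int>\<^sub>\<le>\<^sub>0" using lam_nonpos_Ints[of i k 0] by simp
      then have "pochhammer (lam i - lam k + 1) p' = Gamma (lam i - lam k + 1 + of_nat p') / Gamma (lam i - lam k + 1)"
        by (rule pochhammer_Gamma)
      also have "lam i - lam k + 1 + of_nat p' = mu j - lam k" by (simp add: p p')
      finally show "pochhammer (lam i - lam k + 1) p' = (inverse \<circ> (\<lambda>k. Gamma (lam i - lam k + 1) * rGamma (mu j - lam k))) k"
        by (simp add: rGamma_inverse_Gamma divide_inverse)
    qed simp
    finally have "dual_app phi (B 0) = (-1) ^ p * ((\<Prod>m\<in>UNIV - {j}. Gamma (mu j - mu m) * rGamma (lam i - mu m + 1))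
       * (\<Prod>k\<in>UNIV - {i}. Gamma (lam i - lam k + 1) * rGamma (mu j - lam k)))"
      by (simp add: p' divide_inverse)
    moreover have "exp (\<i> * pi * (lam i - mu j)) = (-1) ^ p"
    proof -
      have "exp (\<i> * pi * (lam i - mu j)) = exp (of_nat p * (- (\<i> * pi)))" by (simp add: p mult_ac)
      also have "\<dots> = exp (- (\<i> * pi)) ^ p" by (rule exp_of_nat_mult)
      also have "exp (- (\<i> * pi)) = -1" by (simp add: exp_minus)
      finally show ?thesis .
    qed
    ultimately show ?thesis unfolding conn_def prod.distrib by simp
  qed
  ultimately show "conn i j *s b n = (if n \<le> p then a (p - n) else 0)" for n
    by (metis B_def)
  show "conn i m = 0" if "m \<noteq> j" for m
  proof -
    have "rGamma (lam i - mu j + 1) = 0" unfolding res by simp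
    then have "(\<Prod>m\<in>UNIV - {m}. rGamma (lam i - mu m + 1)) = 0"
      using that by (intro prod_zero) auto
    then show ?thesis by (simp add: conn_def)
  qed
qed

end

subsection \<open>The kernel and its residues\<close>

lemma filterlim_add_at: "filterlim (\<lambda>t. t + a) (at (s + a)) (at (s::complex))"
  by (rule filterlim_atI) (auto intro!: tendsto_intros simp: eventually_at_filter)

lemma filterlim_minus_at: "filterlim (\<lambda>t. a - t) (at (a - s)) (at (s::complex))"
  by (rule filterlim_atI) (auto intro!: tendsto_intros simp: eventually_at_filter)

lemma Gamma_pole_limit:
  obtains l where "((\<lambda>z. Gamma z * (z - z0)) \<longlongrightarrow> l) (at (z0::complex))"
proof (cases "z0 \<in> \<int>\<^sub>\<le>\<^sub>0")
  case True
  then obtain n where "z0 = - of_nat n" by (auto elim: nonpos_Ints_cases')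
  then show ?thesis using Gamma_residues[of n, where 'a = complex] by (intro that) auto
next
  case False
  have "((\<lambda>z. Gamma z * (z - z0)) \<longlongrightarrow> Gamma z0 * (z0 - z0)) (at z0)"
    using False by (intro tendsto_intros) auto
  then show ?thesis by (rule that)
qed

lemma Gamma_shift_limit:
  obtains l where "((\<lambda>t. Gamma (t - a) * (t - s)) \<longlongrightarrow> l) (at (s::complex))"
proof -
  obtain l where "((\<lambda>z. Gamma z * (z - (s - a))) \<longlongrightarrow> l) (at (s - a))" by (rule Gamma_pole_limit)
  from filterlim_compose[OF this, of "\<lambda>t. t - a" "at s"] filterlim_add_at[of "- a" s]
  show ?thesis by (intro that[of l]) simp
qed

lemma Gamma_reflect_limit:
  obtains l where "((\<lambda>t. Gamma (a - t) * (t - s)) \<longlongrightarrow> l) (at (s::complex))"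
proof -
  obtain l where "((\<lambda>z. Gamma z * (z - (a - s))) \<longlongrightarrow> l) (at (a - s))" by (rule Gamma_pole_limit)
  from tendsto_minus[OF filterlim_compose[OF this filterlim_minus_at[of a s]]]
  show ?thesis by (intro that[of "- l"]) (simp add: algebra_simps)
qed

lemma Gamma_shift_residue: "((\<lambda>t. Gamma (t - s) * (t - s)) \<longlongrightarrow> 1) (at (s::complex))"
proof -
  have "((\<lambda>z. Gamma z * (z + of_nat 0)) \<longlongrightarrow> (-1) ^ 0 / fact 0) (at (- of_nat 0 :: complex))"
    by (rule Gamma_residues)
  then have "((\<lambda>z. Gamma z * z) \<longlongrightarrow> 1) (at (0 :: complex))" by simp
  from filterlim_compose[OF this, of "\<lambda>t. t - s" "at s"] filterlim_add_at[of "- s" s]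
  show ?thesis by simp
qed

lemma Gamma_reflect_residue: "((\<lambda>t. Gamma (s - t) * (t - s)) \<longlongrightarrow> - 1) (at (s::complex))"
proof -
  have "((\<lambda>z. Gamma z * (z + of_nat 0)) \<longlongrightarrow> (-1) ^ 0 / fact 0) (at (- of_nat 0 :: complex))"
    by (rule Gamma_residues)
  then have "((\<lambda>z. Gamma z * z) \<longlongrightarrow> 1) (at (s - s :: complex))" by simp
  from tendsto_minus[OF filterlim_compose[OF this filterlim_minus_at[of s s]]]
  show ?thesis by (simp add: algebra_simps)
qed

lemma eventually_diff_notin_Ints: "eventually (\<lambda>t. t - x \<notin> \<int>) (at (s :: complex))"
proof -
  have "\<not> s islimpt {t. t - x \<in> \<int>}"
  proof (rule discrete_imp_not_islimpt[of 1])
    fix y z assume yz: "y \<in> {t. t - x \<in> \<int>}" "z \<in> {t. t - x \<in> \<int>}" "dist z y < 1"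
    have "(z - x) - (y - x) \<in> \<int>" by (rule Ints_diff) (use yz in auto)
    then obtain n where n: "z - y = of_int n" by (auto elim: Ints_cases)
    then have "\<bar>n\<bar> < 1" using yz(3) by (simp add: dist_norm)
    then show "z = y" using n by simp
  qed simp
  then show ?thesis unfolding islimpt_iff_eventually by simp
qed

lemma exp_minus_i_pi_plus_one: "exp (- (\<i> * pi * (t + 1))) = - exp (- (\<i> * pi * t))"
proof -
  have "exp (- (\<i> * pi * (t + 1))) = exp (- (\<i> * pi * t)) * exp (- (\<i> * pi))"
    by (simp add: algebra_simps flip: exp_add)
  also have "exp (- (\<i> * pi)) = - 1" by (simp add: exp_minus)
  finally show ?thesis by simp
qed

lemma tendsto_rGamma_complex [tendsto_intros]:
  "(f \<longlongrightarrow> l) F \<Longrightarrow> ((\<lambda>x. rGamma (f x :: complex)) \<longlongrightarrow> rGamma l) F"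
  by (rule isCont_tendsto_compose[of l rGamma])
     (use continuous_on_rGamma[of "UNIV :: complex set"] in \<open>simp_all add: continuous_on_eq_continuous_at\<close>)

text \<open>Equality lam i + n = mu j - m would mean mu j - lam i = n + m, so the assumption
  separates the two kinds of poles. As the mu j do not differ by integers either, all poles of the
  kernel are at most simple.\<close>

locale nonresonant = rank_one_pair +
  fixes i :: 'a
  assumes nonres: "mu j - lam i \<noteq> of_nat p"
begin

text \<open>U k is d k * E t / (t - lam k) with its removable singularities filled in; correspondingly T k
  regularises TT t / (t - lam k).\<close>

definition pm :: "complex \<Rightarrow> complex" where
  "pm t = (\<Prod>j\<in>UNIV. Gamma (t - mu j))"

definition TT :: "complex \<Rightarrow> complex" where
  "TT t = Gamma (1 + lam i - t) * (\<Prod>l\<in>UNIV - {i}. rGamma (t - lam l))"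

definition T :: "'a \<Rightarrow> complex \<Rightarrow> complex" where
  "T k t = (if k = i then - Gamma (lam i - t) * (\<Prod>l\<in>UNIV - {i}. rGamma (t - lam l))
     else Gamma (1 + lam i - t) * (rGamma (t - lam k + 1) * (\<Prod>l\<in>UNIV - {i} - {k}. rGamma (t - lam l))))"

text \<open>A scalar solution of E (t + 1) = \<rho> t * E t. By reflection Gamma (1 + lam i - t) is
  \<open>rGamma (t - lam i)\<close> times pi / sin (pi (t - lam i)); the sign that 1/sin acquires
  under t -> t + 1 is undone by exp(-i pi t).\<close>

definition E :: "complex \<Rightarrow> complex" where
  "E t = exp (- (\<i> * pi * t)) * pm t * TT t"

definition U :: "'a \<Rightarrow> complex \<Rightarrow> complex" where
  "U k t = d k * exp (- (\<i> * pi * t)) * pm t * T k t"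

definition S :: "complex set" where
  "S = range (\<lambda>n. lam i + of_nat n) \<union> (\<Union>j. range (\<lambda>n. mu j - of_nat n))"

text \<open>Here all functional equations of Gamma hold and no denominator vanishes. Every s has a
  punctured neighbourhood of such points, so identities proved there pass to limits at the
  poles.\<close>

definition generic :: "complex \<Rightarrow> bool" where
  "generic t \<longleftrightarrow> (\<forall>l. t - lam l \<notin> \<int> \<and> t - mu l \<notin> \<int>)"

lemma eventually_generic: "eventually generic (at s)"
  unfolding generic_def by (intro eventually_all_finite eventually_conj eventually_diff_notin_Ints)

lemma lam_minus_nonpos: "lam i - t \<in> \<int>\<^sub>\<le>\<^sub>0 \<longleftrightarrow> t \<in> range (\<lambda>n. lam i + of_nat n)"
proof
  assume "lam i - t \<in> \<int>\<^sub>\<le>\<^sub>0"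
  then obtain n where "lam i - t = - of_nat n" by (auto elim: nonpos_Ints_cases')
  then have "t = lam i + of_nat n" by (simp add: algebra_simps)
  then show "t \<in> range (\<lambda>n. lam i + of_nat n)" by blast
qed auto

lemma minus_mu_nonpos: "t - mu j \<in> \<int>\<^sub>\<le>\<^sub>0 \<longleftrightarrow> t \<in> range (\<lambda>n. mu j - of_nat n)"
proof
  assume "t - mu j \<in> \<int>\<^sub>\<le>\<^sub>0"
  then obtain n where "t - mu j = - of_nat n" by (auto elim: nonpos_Ints_cases')
  then have "t = mu j - of_nat n" by (simp add: algebra_simps)
  then show "t \<in> range (\<lambda>n. mu j - of_nat n)" by blast
qed auto

lemma one_plus_nonpos: "1 + z \<in> \<int>\<^sub>\<le>\<^sub>0 \<Longrightarrow> z \<in> \<int>\<^sub>\<le>\<^sub>0" for z :: complex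
proof -
  assume "1 + z \<in> \<int>\<^sub>\<le>\<^sub>0"
  then obtain n where "1 + z = - of_nat n" by (auto elim: nonpos_Ints_cases')
  then have "z = - of_nat n - 1" by (simp add: eq_diff_eq add.commute)
  then have "z = - of_nat (Suc n)" by simp
  then show "z \<in> \<int>\<^sub>\<le>\<^sub>0" by (simp only: minus_of_nat_in_nonpos_Ints)
qed

lemma lam_not_left: "lam i + of_nat n - mu j \<notin> \<int>\<^sub>\<le>\<^sub>0"
proof
  assume "lam i + of_nat n - mu j \<in> \<int>\<^sub>\<le>\<^sub>0"
  then obtain m where "lam i + of_nat n - mu j = - of_nat m" by (auto elim: nonpos_Ints_cases')
  then have "mu j - lam i = of_nat (n + m)" by (simp add: algebra_simps)
  then show False using nonres by blast
qed

lemma S_disjoint: "lam i + of_nat n \<noteq> mu j - of_nat m"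
  using lam_not_left[of n j] by (metis add_diff_cancel_left' diff_add_cancel minus_mu_nonpos rangeI)

lemma mu_diff_nonpos: "m \<noteq> j \<Longrightarrow> mu j - of_nat n - mu m \<notin> \<int>\<^sub>\<le>\<^sub>0"
proof
  assume m: "m \<noteq> j" and "mu j - of_nat n - mu m \<in> \<int>\<^sub>\<le>\<^sub>0"
  then have "mu j - of_nat n - mu m \<in> \<int>" using nonpos_Ints_subset_Ints by blast
  then have "(mu j - of_nat n - mu m) + of_nat n \<in> \<int>" by (intro Ints_add) auto
  then show False using mu_diff_Ints[of j m] m by simp
qed

lemma T_TT:
  assumes "t \<notin> range (\<lambda>n. lam i + of_nat n)"
  shows "(t - lam k) * T k t = TT t"
proof (cases "k = i")
  case True
  have "Gamma (lam i - t + 1) = (lam i - t) * Gamma (lam i - t)"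
    using assms by (intro Gamma_plus1) (simp add: lam_minus_nonpos)
  then have "Gamma (1 + lam i - t) = (t - lam i) * - Gamma (lam i - t)"
    by (simp add: algebra_simps)
  then show ?thesis using True by (simp add: T_def TT_def)
next
  case False
  have "(t - lam k) * rGamma (t - lam k + 1) = rGamma (t - lam k)" by (rule rGamma_plus1)
  moreover have "(\<Prod>l\<in>UNIV - {i}. rGamma (t - lam l)) = rGamma (t - lam k) * (\<Prod>l\<in>UNIV - {i} - {k}. rGamma (t - lam l))"
    using False by (intro prod.remove) auto
  ultimately show ?thesis using False by (simp add: T_def TT_def mult_ac)
qed

lemma generic_not_S:
  assumes "generic t"
  shows "t \<notin> range (\<lambda>n. lam i + of_nat n)" "t - mu j \<notin> \<int>\<^sub>\<le>\<^sub>0" "t - lam k \<noteq> 0"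
proof -
  show "t \<notin> range (\<lambda>n. lam i + of_nat n)"
  proof
    assume "t \<in> range (\<lambda>n. lam i + of_nat n)"
    then have "t - lam i \<in> \<int>" by auto
    then show False using assms unfolding generic_def by blast
  qed
  show "t - mu j \<notin> \<int>\<^sub>\<le>\<^sub>0" using assms nonpos_Ints_subset_Ints unfolding generic_def by blast
  show "t - lam k \<noteq> 0" using assms unfolding generic_def by (metis Ints_0)
qed

lemma U_E: "generic t \<Longrightarrow> (t - lam k) * U k t = d k * E t"
proof -
  assume "generic t"
  then have "(t - lam k) * T k t = TT t" by (intro T_TT generic_not_S)
  moreover have "(t - lam k) * U k t = d k * exp (- (\<i> * pi * t)) * pm t * ((t - lam k) * T k t)"
    unfolding U_def by (simp only: mult_ac)
  ultimately show ?thesis by (simp add: E_def)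
qed

lemma E_step:
  assumes t: "generic t"
  shows "E (t + 1) = E t * \<rho> t"
proof -
  note g = generic_not_S[OF t]
  have "pm (t + 1) = (\<Prod>j\<in>UNIV. (t - mu j) * Gamma (t - mu j))"
    unfolding pm_def
  proof (rule prod.cong)
    show "Gamma (t + 1 - mu j) = (t - mu j) * Gamma (t - mu j)" for j
      using Gamma_plus1[OF g(2)[of j]] by (simp add: algebra_simps)
  qed simp
  then have 1: "pm (t + 1) = (\<Prod>j\<in>UNIV. t - mu j) * pm t"
    by (simp add: pm_def prod.distrib)
  have "Gamma (lam i - t + 1) = (lam i - t) * Gamma (lam i - t)"
    using g(1) by (intro Gamma_plus1) (simp add: lam_minus_nonpos)
  then have G: "Gamma (1 + lam i - t) = - ((t - lam i) * Gamma (lam i - t))"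
    by (simp add: algebra_simps)
  have "(\<Prod>l\<in>UNIV - {i}. rGamma (t - lam l)) = (\<Prod>l\<in>UNIV - {i}. (t - lam l) * rGamma (t + 1 - lam l))"
  proof (rule prod.cong)
    show "rGamma (t - lam l) = (t - lam l) * rGamma (t + 1 - lam l)" for l
      using rGamma_plus1[of "t - lam l"] by (simp add: algebra_simps)
  qed simp
  then have "TT t = - (((t - lam i) * (\<Prod>l\<in>UNIV - {i}. t - lam l)) * TT (t + 1))"
    unfolding TT_def G prod.distrib by simp
  also have "(t - lam i) * (\<Prod>l\<in>UNIV - {i}. t - lam l) = (\<Prod>l\<in>UNIV. t - lam l)"
    by (rule prod.remove[symmetric]) auto
  finally have 2: "TT t = - ((\<Prod>l\<in>UNIV. t - lam l) * TT (t + 1))" .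
  have nz: "(\<Prod>l\<in>UNIV. t - lam l) \<noteq> 0" using g(3) by simp
  show ?thesis
    unfolding E_def exp_minus_i_pi_plus_one 1 2 \<rho>_def using nz by simp
qed

text \<open>Summing d k / (t - lam k) gives \<rho> t - 1, so phi of the kernel is a difference of E.
  This reduces the leading residues to residues of a scalar function.\<close>

lemma sum_U:
  assumes t: "generic t"
  shows "(\<Sum>k\<in>UNIV. U k t) = E (t + 1) - E t"
proof -
  note g = generic_not_S[OF t]
  have "U k t = E t * (d k / (t - lam k))" for k
    using U_E[OF t, of k] g(3)[of k] by (simp add: eq_divide_eq mult_ac)
  then have "(\<Sum>k\<in>UNIV. U k t) = E t * (\<rho> t - 1)"
    using g(3) by (subst \<rho>_partial_fractions) (auto simp: sum_distrib_left)
  then show ?thesis using E_step[OF t] by (simp add: algebra_simps)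
qed

lemma generic_plus_one: "generic t \<Longrightarrow> generic (t + 1)"
proof -
  assume g: "generic t"
  have "x \<in> \<int>" if "x + 1 \<in> \<int>" for x :: complex
    using Ints_diff[OF that Ints_1] by simp
  moreover have "t + 1 - y = (t - y) + 1" for y by simp
  ultimately show ?thesis using g unfolding generic_def by metis
qed

text \<open>Both sides equal d k * E (t + 1).\<close>

lemma U_rec:
  assumes t: "generic t"
  shows "(t + 1 - lam k) * U k (t + 1) = (t - lam k) * U k t + d k * (\<Sum>l\<in>UNIV. U l t)"
  unfolding sum_U[OF t] U_E[OF t] U_E[OF generic_plus_one[OF t]] by (simp add: algebra_simps)

lemma isCont_pm: "(\<And>j. t - mu j \<notin> \<int>\<^sub>\<le>\<^sub>0) \<Longrightarrow> isCont pm t"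
  unfolding pm_def [abs_def] by (intro continuous_intros) auto

lemma isCont_TT: "1 + lam i - t \<notin> \<int>\<^sub>\<le>\<^sub>0 \<Longrightarrow> isCont TT t"
  unfolding TT_def [abs_def] by (intro continuous_intros) auto

lemma isCont_T_ne: "k \<noteq> i \<Longrightarrow> 1 + lam i - t \<notin> \<int>\<^sub>\<le>\<^sub>0 \<Longrightarrow> isCont (T k) t"
  unfolding T_def [abs_def] by (simp, intro continuous_intros) auto

lemma isCont_T: "lam i - t \<notin> \<int>\<^sub>\<le>\<^sub>0 \<Longrightarrow> isCont (T k) t"
proof (cases "k = i")
  case True
  assume "lam i - t \<notin> \<int>\<^sub>\<le>\<^sub>0"
  then show ?thesis unfolding T_def [abs_def] using True by (simp, intro continuous_intros) auto
next
  case False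
  assume "lam i - t \<notin> \<int>\<^sub>\<le>\<^sub>0"
  then show ?thesis using False one_plus_nonpos[of "lam i - t"] 
    by (intro isCont_T_ne) (auto simp: add_diff_eq)
qed

lemma isCont_U: "(\<And>j. t - mu j \<notin> \<int>\<^sub>\<le>\<^sub>0) \<Longrightarrow> isCont (T k) t \<Longrightarrow> isCont (U k) t"
  unfolding U_def [abs_def] by (intro continuous_intros isCont_pm)

lemma isCont_lim0: "isCont f s \<Longrightarrow> ((\<lambda>t. f t * (t - s)) \<longlongrightarrow> 0) (at s)" for f :: "complex \<Rightarrow> complex"
proof -
  assume "isCont f s"
  then have "((\<lambda>t. f t * (t - s)) \<longlongrightarrow> f s * (s - s)) (at s)"
    by (intro tendsto_intros) (simp add: isCont_def)
  then show ?thesis by simp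
qed

lemma not_S_iff: "t \<notin> S \<longleftrightarrow> lam i - t \<notin> \<int>\<^sub>\<le>\<^sub>0 \<and> (\<forall>j. t - mu j \<notin> \<int>\<^sub>\<le>\<^sub>0)"
  unfolding S_def lam_minus_nonpos minus_mu_nonpos by blast

text \<open>Only the factor of j is singular at mu j - n, since the other mu m are not congruent to
  mu j modulo the integers.\<close>

lemma pm_residue:
  assumes "((\<lambda>t. Gamma (t - mu j) * (t - (mu j - of_nat n))) \<longlongrightarrow> l) (at (mu j - of_nat n))"
  shows "((\<lambda>t. pm t * (t - (mu j - of_nat n))) \<longlongrightarrow> l * (\<Prod>m\<in>UNIV - {j}. Gamma (mu j - of_nat n - mu m))) (at (mu j - of_nat n))"
proof -
  have "((\<lambda>t. Gamma (t - mu j) * (t - (mu j - of_nat n)) * (\<Prod>m\<in>UNIV - {j}. Gamma (t - mu m)))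
      \<longlongrightarrow> l * (\<Prod>m\<in>UNIV - {j}. Gamma (mu j - of_nat n - mu m))) (at (mu j - of_nat n))"
    by (intro tendsto_mult assms tendsto_prod tendsto_Gamma tendsto_diff tendsto_ident_at tendsto_const mu_diff_nonpos) auto
  moreover have "pm t = Gamma (t - mu j) * (\<Prod>m\<in>UNIV - {j}. Gamma (t - mu m))" for t
    unfolding pm_def by (rule prod.remove) auto
  ultimately show ?thesis by (simp add: mult_ac)
qed

definition R :: "'a \<Rightarrow> complex \<Rightarrow> complex" where
  "R k s = Lim (at s) (\<lambda>t. U k t * (t - s))"

text \<open>At lam i + n the product \<open>pm\<close> is continuous and \<open>T k\<close> has at
  most a simple pole; at mu j - n the roles are exchanged. At all other points the limit is 0, so
  \<open>R\<close> is meaningful everywhere and its recurrence needs no case distinction.\<close>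

lemma R_lim: "((\<lambda>t. U k t * (t - s)) \<longlongrightarrow> R k s) (at s)"
proof -
  have "\<exists>r. ((\<lambda>t. U k t * (t - s)) \<longlongrightarrow> r) (at s)"
  proof (cases "lam i - s \<in> \<int>\<^sub>\<le>\<^sub>0")
    case True
    then obtain n where s: "s = lam i + of_nat n" using lam_minus_nonpos by blast
    have "\<exists>r. ((\<lambda>t. T k t * (t - s)) \<longlongrightarrow> r) (at s)"
    proof (cases "k = i")
      case True
      obtain l where "((\<lambda>t. Gamma (lam i - t) * (t - s)) \<longlongrightarrow> l) (at s)" by (rule Gamma_reflect_limit)
      then have "((\<lambda>t. - (Gamma (lam i - t) * (t - s)) * (\<Prod>l\<in>UNIV - {i}. rGamma (t - lam l))) \<longlongrightarrow> - l * (\<Prod>l\<in>UNIV - {i}. rGamma (s - lam l))) (at s)"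
        by (intro tendsto_intros)
      then show ?thesis using True by (auto simp: T_def mult_ac)
    next
      case False
      obtain l where "((\<lambda>t. Gamma (1 + lam i - t) * (t - s)) \<longlongrightarrow> l) (at s)" by (rule Gamma_reflect_limit)
      then have "((\<lambda>t. Gamma (1 + lam i - t) * (t - s) * (rGamma (t - lam k + 1) * (\<Prod>l\<in>UNIV - {i} - {k}. rGamma (t - lam l))))
          \<longlongrightarrow> l * (rGamma (s - lam k + 1) * (\<Prod>l\<in>UNIV - {i} - {k}. rGamma (s - lam l)))) (at s)"
        by (intro tendsto_intros)
      then show ?thesis using False by (auto simp: T_def mult_ac)
    qed
    then obtain r where "((\<lambda>t. T k t * (t - s)) \<longlongrightarrow> r) (at s)" by blast
    moreover have "(pm \<longlongrightarrow> pm s) (at s)"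
      using isCont_pm[of s] lam_not_left[of n] by (simp add: s isCont_def)
    ultimately have "((\<lambda>t. d k * exp (- (\<i> * pi * t)) * pm t * (T k t * (t - s))) \<longlongrightarrow> d k * exp (- (\<i> * pi * s)) * pm s * r) (at s)"
      by (intro tendsto_intros)
    then show ?thesis unfolding U_def by (auto simp: mult_ac)
  next
    case False
    then have T: "(T k \<longlongrightarrow> T k s) (at s)" using isCont_T isCont_def by blast
    show ?thesis
    proof (cases "\<exists>j. s - mu j \<in> \<int>\<^sub>\<le>\<^sub>0")
      case True
      then obtain j n where s: "s = mu j - of_nat n" using minus_mu_nonpos by blast
      obtain l where "((\<lambda>t. Gamma (t - mu j) * (t - s)) \<longlongrightarrow> l) (at s)" by (rule Gamma_shift_limit)
      then obtain r where "((\<lambda>t. pm t * (t - s)) \<longlongrightarrow> r) (at s)" unfolding s using pm_residue by blast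
      then have "((\<lambda>t. d k * exp (- (\<i> * pi * t)) * (pm t * (t - s)) * T k t) \<longlongrightarrow> d k * exp (- (\<i> * pi * s)) * r * T k s) (at s)"
        by (intro tendsto_intros T)
      then show ?thesis unfolding U_def by (auto simp: mult_ac)
    next
      case nmu: False
      then show ?thesis using isCont_lim0[OF isCont_U] isCont_T False by blast
    qed
  qed
  then show ?thesis unfolding R_def by (metis tendsto_Lim trivial_limit_at)
qed

lemma R_eqI: "((\<lambda>t. U k t * (t - s)) \<longlongrightarrow> r) (at s) \<Longrightarrow> R k s = r"
  using R_lim tendsto_unique trivial_limit_at by blast

lemma R_eq_0: "s \<notin> S \<Longrightarrow> R k s = 0"
  by (intro R_eqI isCont_lim0 isCont_U isCont_T) (auto simp: not_S_iff)

lemma R_shift_lim: "((\<lambda>t. U k (t + 1) * (t - s)) \<longlongrightarrow> R k (s + 1)) (at s)"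
  using filterlim_compose[OF R_lim[of k "s + 1"] filterlim_add_at[of 1 s]] by simp

text \<open>The generic recurrence multiplied by t - s, in the limit t -> s.\<close>

lemma R_rec: "(s + 1 - lam k) * R k (s + 1) = (s - lam k) * R k s + d k * (\<Sum>l\<in>UNIV. R l s)"
proof (rule tendsto_unique[OF trivial_limit_at])
  show "((\<lambda>t. (t + 1 - lam k) * (U k (t + 1) * (t - s))) \<longlongrightarrow> (s + 1 - lam k) * R k (s + 1)) (at s)"
    by (intro tendsto_intros R_shift_lim)
  have "((\<lambda>t. (t - lam k) * (U k t * (t - s)) + d k * (\<Sum>l\<in>UNIV. U l t * (t - s)))
      \<longlongrightarrow> (s - lam k) * R k s + d k * (\<Sum>l\<in>UNIV. R l s)) (at s)"
    by (intro tendsto_intros R_lim)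
  moreover have "eventually (\<lambda>t. (t - lam k) * (U k t * (t - s)) + d k * (\<Sum>l\<in>UNIV. U l t * (t - s)) = (t + 1 - lam k) * (U k (t + 1) * (t - s))) (at s)"
    using eventually_generic[of s]
  proof eventually_elim
    case (elim t)
    have "(t - lam k) * (U k t * (t - s)) + d k * (\<Sum>l\<in>UNIV. U l t * (t - s))
       = ((t - lam k) * U k t + d k * (\<Sum>l\<in>UNIV. U l t)) * (t - s)"
      by (simp only: sum_distrib_right[symmetric] distrib_right mult.assoc)
    then show ?case unfolding U_rec[OF elim, symmetric] by (simp add: mult_ac)
  qed
  ultimately show "((\<lambda>t. (t + 1 - lam k) * (U k (t + 1) * (t - s))) \<longlongrightarrow> (s - lam k) * R k s + d k * (\<Sum>l\<in>UNIV. R l s)) (at s)"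
    by (rule Lim_transform_eventually)
qed

lemma sum_R_lim: "((\<lambda>t. E (t + 1) * (t - s) - E t * (t - s)) \<longlongrightarrow> (\<Sum>k\<in>UNIV. R k s)) (at s)"
proof -
  have "((\<lambda>t. (\<Sum>k\<in>UNIV. U k t * (t - s))) \<longlongrightarrow> (\<Sum>k\<in>UNIV. R k s)) (at s)"
    by (intro tendsto_intros R_lim)
  moreover have "eventually (\<lambda>t. (\<Sum>k\<in>UNIV. U k t * (t - s)) = E (t + 1) * (t - s) - E t * (t - s)) (at s)"
    using eventually_generic[of s]
    by eventually_elim (simp only: sum_distrib_right[symmetric] sum_U left_diff_distrib)
  ultimately show ?thesis by (rule Lim_transform_eventually)
qed

text \<open>For k other than i the factor Gamma (1 + lam i - t) of \<open>T k\<close> is still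
  regular at lam i, its poles starting one step later. So the first residue vector is a multiple of
  \<open>xi i\<close>.\<close>

lemma R_lam_head: "(lam i - lam k) * R k (lam i) = 0"
proof (cases "k = i")
  case False
  have "isCont (T k) (lam i)" using False by (intro isCont_T_ne) auto
  then have "R k (lam i) = 0" using lam_not_left[of 0] by (intro R_eqI isCont_lim0 isCont_U) auto
  then show ?thesis by simp
qed simp

text \<open>The step above mu j is usually not a pole. The hypotheses do allow mu j + 1 = lam i;
  there the eigenvector relation for the residue at lam i takes over.\<close>

lemma R_mu_head: "(mu j + 1 - lam k) * R k (mu j + 1) = 0"
proof (cases "mu j + 1 = lam i")
  case True
  then show ?thesis using R_lam_head by simp
next
  case False
  have "mu j + 1 \<notin> S"
  proof
    assume "mu j + 1 \<in> S"
    then consider n where "mu j + 1 = lam i + of_nat n" | m n where "mu j + 1 = mu m - of_nat n" by (auto simp: S_def)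
    then show False
    proof cases
      case 1
      then obtain n' where "n = Suc n'" using False by (cases n) auto
      then have "mu j - lam i = of_nat n'" using 1 by (simp add: algebra_simps)
      then show False using nonres by blast
    next
      case 2
      then have "mu m - mu j = of_nat (Suc n)" by (simp add: algebra_simps)
      then show False using mu_nodiff unfolding no_pos_int_diff_def by blast
    qed
  qed
  then show ?thesis by (simp add: R_eq_0)
qed

lemma residues_formal_sol0: "formal_sol0 P Q (lam i) (\<lambda>n. comb (\<lambda>k. R k (lam i + of_nat n)))"
  unfolding formal_sol0_comb_iff using R_lam_head R_rec[of "lam i + of_nat _"] by (simp add: add_ac)

text \<open>The same recurrence read downwards from mu j; it starts correctly because its left side
  vanishes at s = mu j.\<close>

lemma residues_formal_sol_inf: "formal_sol_inf P Q (mu j) (\<lambda>n. comb (\<lambda>k. R k (mu j - of_nat n)))"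
  unfolding formal_sol_inf_def
proof (intro conjI allI impI)
  have "- (mu j * R k (mu j)) = - (lam k * R k (mu j)) + (\<Sum>l\<in>UNIV. R l (mu j)) * d k" for k
  proof -
    have "0 = (mu j - lam k) * R k (mu j) + d k * (\<Sum>l\<in>UNIV. R l (mu j))"
      using R_rec[of "mu j" k] R_mu_head[of j k] by simp
    then show ?thesis by algebra
  qed
  moreover have "- comb c = comb (\<lambda>k. - c k)" for c
    using comb_smult[of "-1" c] by (simp add: vector_smult_lneg)
  ultimately show "- (mu j *s comb (\<lambda>k. R k (mu j - of_nat 0))) = - (P *v comb (\<lambda>k. R k (mu j - of_nat 0))) + Q *v comb (\<lambda>k. R k (mu j - of_nat 0))"
    unfolding P_comb Q_comb comb_smult by (simp add: comb_add)
  fix n :: nat assume n: "n \<ge> 1"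
  have eq: "mu j - of_nat (n - 1) = mu j - of_nat n + 1" using n by (simp add: of_nat_diff)
  show "(mu j - of_nat n + 1) *s comb (\<lambda>k. R k (mu j - of_nat (n - 1))) - (mu j - of_nat n) *s comb (\<lambda>k. R k (mu j - of_nat n))
     = P *v comb (\<lambda>k. R k (mu j - of_nat (n - 1))) - P *v comb (\<lambda>k. R k (mu j - of_nat n)) + Q *v comb (\<lambda>k. R k (mu j - of_nat n))"
    unfolding P_comb Q_comb comb_smult comb_add comb_diff comb_eq_iff fun_eq_iff eq
  proof
    fix k
    show "(mu j - of_nat n + 1) * R k (mu j - of_nat n + 1) - (mu j - of_nat n) * R k (mu j - of_nat n) =
        lam k * R k (mu j - of_nat n + 1) - lam k * R k (mu j - of_nat n) + (\<Sum>l\<in>UNIV. R l (mu j - of_nat n)) * d k"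
      using R_rec[of "mu j - of_nat n" k] by (simp add: algebra_simps)
  qed
qed

text \<open>phi of the leading residue at lam i, hence the factor between the residues of the kernel
  and the normalised coefficients of f_i.\<close>

definition \<kappa> :: complex where
  "\<kappa> = exp (- (\<i> * pi * lam i)) * (\<Prod>j\<in>UNIV. Gamma (lam i - mu j + 1)) * (\<Prod>l\<in>UNIV - {i}. rGamma (lam i - lam l + 1))"

text \<open>E is regular at lam i, so the residue of E (t + 1) - E t comes from the first term
  alone.\<close>

lemma sum_R_lam: "(\<Sum>k\<in>UNIV. R k (lam i)) = \<kappa>"
proof (rule tendsto_unique[OF trivial_limit_at sum_R_lim])
  have "isCont E (lam i)"
    unfolding E_def [abs_def] using lam_not_left[of 0] by (intro continuous_intros isCont_pm isCont_TT) auto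
  then have 1: "((\<lambda>t. E t * (t - lam i)) \<longlongrightarrow> 0) (at (lam i))" by (rule isCont_lim0)
  have eq: "E (t + 1) * (t - lam i) = - exp (- (\<i> * pi * t)) * (\<Prod>j\<in>UNIV. Gamma (t - mu j + 1))
      * (Gamma (lam i - t) * (t - lam i)) * (\<Prod>l\<in>UNIV - {i}. rGamma (t - lam l + 1))" for t
    unfolding E_def exp_minus_i_pi_plus_one pm_def TT_def by (simp add: algebra_simps)
  have nn: "lam i - mu j + 1 \<notin> \<int>\<^sub>\<le>\<^sub>0" for j
    using lam_not_left[of 1 j] by (simp add: algebra_simps)
  have "((\<lambda>t. E (t + 1) * (t - lam i)) \<longlongrightarrow> - exp (- (\<i> * pi * lam i)) * (\<Prod>j\<in>UNIV. Gamma (lam i - mu j + 1))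
      * (- 1) * (\<Prod>l\<in>UNIV - {i}. rGamma (lam i - lam l + 1))) (at (lam i))"
    unfolding eq by (intro tendsto_intros nn Gamma_reflect_residue)
  from tendsto_diff[OF this 1] show "((\<lambda>t. E (t + 1) * (t - lam i) - E t * (t - lam i)) \<longlongrightarrow> \<kappa>) (at (lam i))"
    by (simp add: \<kappa>_def)
qed

lemma \<kappa>_nz: "\<kappa> \<noteq> 0"
proof -
  have "lam i - mu j + 1 \<notin> \<int>\<^sub>\<le>\<^sub>0" for j
    using lam_not_left[of 1 j] by (simp add: algebra_simps)
  moreover have "lam i - lam l + 1 \<notin> \<int>\<^sub>\<le>\<^sub>0" for l
    using lam_nonpos_Ints[of i l 0] by simp
  ultimately show ?thesis
    by (simp add: \<kappa>_def Gamma_eq_zero_iff rGamma_eq_zero_iff)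
qed

text \<open>At mu j it is E (t + 1) that is regular, so the residue of E enters with a minus sign.
  Dividing it by \<open>\<kappa>\<close> produces c_ij.\<close>

lemma sum_R_mu: "(\<Sum>k\<in>UNIV. R k (mu j)) = - \<kappa> * conn i j"
proof -
  have nn: "lam i - mu j \<notin> \<int>\<^sub>\<le>\<^sub>0" using lam_not_left[of 0 j] by simp
  have nn1: "lam i - mu m + 1 \<notin> \<int>\<^sub>\<le>\<^sub>0" for m using lam_not_left[of 1 m] by (simp add: algebra_simps)
  have nn2: "mu j + 1 - mu m \<notin> \<int>\<^sub>\<le>\<^sub>0" for m
  proof
    assume "mu j + 1 - mu m \<in> \<int>\<^sub>\<le>\<^sub>0"
    then obtain n where "mu j + 1 - mu m = - of_nat n" by (auto elim: nonpos_Ints_cases')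
    then have "mu m - mu j = of_nat (Suc n)" by (simp add: algebra_simps)
    then show False using mu_nodiff unfolding no_pos_int_diff_def by blast
  qed
  have "isCont (\<lambda>t. E (t + 1)) (mu j)"
    unfolding E_def pm_def TT_def using nn nn2 by (intro continuous_intros) (auto simp: algebra_simps)
  then have 1: "((\<lambda>t. E (t + 1) * (t - mu j)) \<longlongrightarrow> 0) (at (mu j))" by (rule isCont_lim0)
  have "1 + lam i - mu j \<notin> \<int>\<^sub>\<le>\<^sub>0" using nn1[of j] by (simp add: algebra_simps)
  then have TT: "(TT \<longlongrightarrow> TT (mu j)) (at (mu j))" using isCont_TT isCont_def by blast
  have h: "((\<lambda>t. pm t * (t - mu j)) \<longlongrightarrow> 1 * (\<Prod>m\<in>UNIV - {j}. Gamma (mu j - mu m))) (at (mu j))"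
    using pm_residue[of j 0 1] Gamma_shift_residue[of "mu j"] by simp
  have "((\<lambda>t. exp (- (\<i> * pi * t)) * (pm t * (t - mu j)) * TT t) \<longlongrightarrow>
      exp (- (\<i> * pi * mu j)) * (1 * (\<Prod>m\<in>UNIV - {j}. Gamma (mu j - mu m))) * TT (mu j)) (at (mu j))"
    by (intro tendsto_mult[OF tendsto_mult[OF _ h] TT] tendsto_exp tendsto_minus tendsto_mult_left tendsto_const tendsto_ident_at)
  moreover have "exp (- (\<i> * pi * t)) * (pm t * (t - mu j)) * TT t = E t * (t - mu j)" for t
    by (simp add: E_def)
  ultimately have "((\<lambda>t. E t * (t - mu j)) \<longlongrightarrow>
      exp (- (\<i> * pi * mu j)) * (\<Prod>m\<in>UNIV - {j}. Gamma (mu j - mu m)) * TT (mu j)) (at (mu j))"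
    by simp
  from tendsto_diff[OF 1 this]
  have "(\<Sum>k\<in>UNIV. R k (mu j)) = - (exp (- (\<i> * pi * mu j)) * (\<Prod>m\<in>UNIV - {j}. Gamma (mu j - mu m)) * TT (mu j))"
    using tendsto_unique[OF trivial_limit_at sum_R_lim] by simp
  also have "exp (- (\<i> * pi * mu j)) * (\<Prod>m\<in>UNIV - {j}. Gamma (mu j - mu m)) * TT (mu j) = \<kappa> * conn i j"
  proof -
    have e: "exp (- (\<i> * pi * lam i)) * exp (\<i> * pi * (lam i - mu j)) = exp (- (\<i> * pi * mu j))"
      by (simp add: algebra_simps flip: exp_add)
    have GrG: "rGamma z * Gamma z = 1" if "z \<notin> \<int>\<^sub>\<le>\<^sub>0" for z :: complex
      using that by (simp add: rGamma_inverse_Gamma Gamma_eq_zero_iff)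
    have g1: "(\<Prod>l\<in>UNIV - {i}. rGamma (lam i - lam l + 1)) * (\<Prod>k\<in>UNIV - {i}. Gamma (lam i - lam k + 1)) = 1"
      unfolding prod.distrib[symmetric] using lam_nonpos_Ints[of i _ 0] by (intro prod.neutral ballI GrG) simp
    have g2: "(\<Prod>m\<in>UNIV - {j}. rGamma (lam i - mu m + 1)) * (\<Prod>m\<in>UNIV - {j}. Gamma (lam i - mu m + 1)) = 1"
      unfolding prod.distrib[symmetric] by (intro prod.neutral ballI GrG nn1)
    have p: "(\<Prod>j\<in>UNIV. Gamma (lam i - mu j + 1)) = Gamma (lam i - mu j + 1) * (\<Prod>m\<in>UNIV - {j}. Gamma (lam i - mu m + 1))"
      by (rule prod.remove) auto
    have "\<kappa> * conn i j = (exp (- (\<i> * pi * lam i)) * exp (\<i> * pi * (lam i - mu j)))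
        * ((\<Prod>l\<in>UNIV - {i}. rGamma (lam i - lam l + 1)) * (\<Prod>k\<in>UNIV - {i}. Gamma (lam i - lam k + 1)))
        * ((\<Prod>m\<in>UNIV - {j}. rGamma (lam i - mu m + 1)) * (\<Prod>m\<in>UNIV - {j}. Gamma (lam i - mu m + 1)))
        * (\<Prod>m\<in>UNIV - {j}. Gamma (mu j - mu m)) * (Gamma (lam i - mu j + 1) * (\<Prod>k\<in>UNIV - {i}. rGamma (mu j - lam k)))"
      unfolding \<kappa>_def conn_def p by (simp only: mult_ac)
    also have "Gamma (lam i - mu j + 1) * (\<Prod>k\<in>UNIV - {i}. rGamma (mu j - lam k)) = TT (mu j)"
      by (simp add: TT_def algebra_simps)
    finally show ?thesis unfolding e g1 g2 by simp
  qed
  finally show ?thesis by simp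
qed

lemma U_holomorphic: "U k holomorphic_on - S"
proof (cases "k = i")
  case True
  have "U i = (\<lambda>t. d i * exp (- (\<i> * pi * t)) * (\<Prod>j\<in>UNIV. Gamma (t - mu j)) * (- Gamma (lam i - t) * (\<Prod>l\<in>UNIV - {i}. rGamma (t - lam l))))"
    by (simp add: U_def T_def pm_def fun_eq_iff)
  moreover have "\<dots> holomorphic_on - S"
    by (intro holomorphic_intros) (auto simp: not_S_iff)
  ultimately show ?thesis using True by simp
next
  case False
  have "U k = (\<lambda>t. d k * exp (- (\<i> * pi * t)) * (\<Prod>j\<in>UNIV. Gamma (t - mu j)) * (Gamma (1 + (lam i - t)) * (rGamma (t - lam k + 1) * (\<Prod>l\<in>UNIV - {i} - {k}. rGamma (t - lam l)))))"
    using False by (simp add: U_def T_def pm_def fun_eq_iff algebra_simps)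
  moreover have "\<dots> holomorphic_on - S"
    by (intro holomorphic_intros) (auto simp: not_S_iff dest: one_plus_nonpos)
  ultimately show ?thesis by simp
qed

end

section \<open>Growth of the kernel on the contours and the two expansions\<close>

definition log_strip :: "complex set" where
  "log_strip = {w. 0 < Im w \<and> Im w < 2 * pi}"

text \<open>The abscissa avoids the countably many integer translates of the real parts. Being to
  the right of all mu j, the line has only poles lam i + n on its right.\<close>

lemma exists_abscissa:
  fixes X :: "real set"
  assumes "finite X"
  shows "\<exists>c. (\<forall>x\<in>X. x < c \<and> x - c \<notin> \<int>)"
proof -
  define K where "K = Max (insert 0 X)"
  have K: "x \<le> K" if "x \<in> X" for x using that assms by (auto simp: K_def)
  define B where "B = (\<Union>x\<in>X. range (\<lambda>z. x - of_int z))"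
  have "countable B" unfolding B_def by (rule countable_UN) (use assms in \<open>auto intro: countable_finite\<close>)
  moreover have "uncountable {K<..<K+1}" by (simp add: uncountable_open_interval)
  ultimately obtain c where c: "c \<in> {K<..<K+1}" "c \<notin> B" by (metis countable_subset subsetI)
  have "x - c \<notin> \<int>" if x: "x \<in> X" for x
  proof
    assume "x - c \<in> \<int>"
    then obtain z where "x - c = of_int z" by (auto elim: Ints_cases)
    then have "c = x - of_int z" by simp
    then show False using c(2) x by (auto simp: B_def)
  qed
  moreover have "x < c" if "x \<in> X" for x using K[OF that] c by auto
  ultimately show ?thesis by blast
qed

lemma Gamma_ratio_bound_grid:
  assumes "Re s - c \<notin> \<int>" "\<bar>Im s\<bar> + 1 \<le> Y"
  shows "\<exists>A C. A \<ge> 0 \<and> C \<ge> 0 \<and> (\<forall>t\<in>grid c Y. norm (Gamma (t - s) * rGamma (t - s')) \<le> A * exp (C * sqrt (norm t)))"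
proof -
  obtain \<delta> where \<delta>: "\<delta> > 0" "\<And>t m. t \<in> grid c Y \<Longrightarrow> m \<in> \<int> \<Longrightarrow> \<delta> \<le> norm (t - s + m)"
    using grid_dist[OF assms] by blast
  obtain C where C: "C \<ge> 0" "\<And>t. (\<And>m::nat. \<delta> \<le> norm (t + of_nat m)) \<Longrightarrow>
      norm (Gamma t * rGamma (t + (s - s'))) \<le> exp (C * (1 + sqrt (norm t)))"
    using Gamma_ratio_bound[OF \<delta>(1), of "s - s'"] by blast
  have "norm (Gamma (t - s) * rGamma (t - s')) \<le> exp (C * (1 + sqrt (norm s))) * exp (C * sqrt (norm t))"
    if t: "t \<in> grid c Y" for t
  proof -
    have "norm (Gamma (t - s) * rGamma (t - s + (s - s'))) \<le> exp (C * (1 + sqrt (norm (t - s))))"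
      using \<delta>(2)[OF t] by (intro C(2)) auto
    also have "sqrt (norm (t - s)) \<le> sqrt (norm t + norm s)"
      by (intro real_sqrt_le_mono norm_triangle_ineq4)
    also have "\<dots> \<le> sqrt (norm t) + sqrt (norm s)" by (rule sqrt_add_le_add_sqrt) auto
    finally have "norm (Gamma (t - s) * rGamma (t - s + (s - s'))) \<le> exp (C * (1 + (sqrt (norm t) + sqrt (norm s))))"
      using C(1) by (simp add: mult_left_mono)
    also have "\<dots> = exp (C * (1 + sqrt (norm s))) * exp (C * sqrt (norm t))"
      unfolding exp_add[symmetric] by (simp add: algebra_simps)
    finally show ?thesis by simp
  qed
  then show ?thesis using C(1) by (intro exI[of _ "exp (C * (1 + sqrt (norm s)))"] exI[of _ C]) auto
qed

lemma prod_bound_sqrt_exp: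
  assumes "finite I" "\<And>l. l \<in> I \<Longrightarrow> \<exists>A C. A \<ge> 0 \<and> C \<ge> 0 \<and> (\<forall>t\<in>G. norm (g l t) \<le> A * exp (C * sqrt (norm t)))"
  shows "\<exists>A C. A \<ge> 0 \<and> C \<ge> 0 \<and> (\<forall>t\<in>G. norm (\<Prod>l\<in>I. g l t :: complex) \<le> A * exp (C * sqrt (norm (t :: complex))))"
  using assms
proof (induction I rule: finite_induct)
  case empty
  show ?case by (intro exI[of _ 1] exI[of _ 0]) auto
next
  case (insert x I)
  obtain A C where AC: "A \<ge> 0" "C \<ge> 0" "\<And>t. t \<in> G \<Longrightarrow> norm (g x t) \<le> A * exp (C * sqrt (norm t))"
    using insert.prems by blast
  obtain A' C' where AC': "A' \<ge> 0" "C' \<ge> 0" "\<And>t. t \<in> G \<Longrightarrow> norm (\<Prod>l\<in>I. g l t) \<le> A' * exp (C' * sqrt (norm t))"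
    using insert.IH insert.prems by blast
  have "norm (\<Prod>l\<in>insert x I. g l t) \<le> (A * A') * exp ((C + C') * sqrt (norm t))" if "t \<in> G" for t
  proof -
    have "norm (\<Prod>l\<in>insert x I. g l t) = norm (g x t) * norm (\<Prod>l\<in>I. g l t)"
      using insert.hyps by (simp add: norm_mult)
    also have "\<dots> \<le> (A * exp (C * sqrt (norm t))) * (A' * exp (C' * sqrt (norm t)))"
      using AC AC' that by (intro mult_mono) auto
    also have "\<dots> = (A * A') * exp ((C + C') * sqrt (norm t))"
      by (simp add: distrib_right exp_add)
    finally show ?thesis .
  qed
  then show ?case using AC AC' by (intro exI[of _ "A * A'"] exI[of _ "C + C'"]) auto
qed

context nonresonant
begin

lemma grid_generic:
  assumes "\<And>l. Re (lam l) - c \<notin> \<int>" "\<And>l. Re (mu l) - c \<notin> \<int>"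
    and "\<And>l. \<bar>Im (lam l)\<bar> + 1 \<le> Y" "\<And>l. \<bar>Im (mu l)\<bar> + 1 \<le> Y"
    and t: "t \<in> grid c Y"
  shows "generic t"
proof -
  have "t - s \<notin> \<int>" if s: "Re s - c \<notin> \<int>" "\<bar>Im s\<bar> + 1 \<le> Y" for s
  proof
    assume "t - s \<in> \<int>"
    \<comment> \<open>This integer, used as the translate in \<open>grid_dist\<close>, would give
      distance 0.\<close>
    then have "- (t - s) \<in> \<int>" by (rule Ints_minus)
    then obtain \<delta> where "\<delta> > 0" "\<delta> \<le> norm (t - s + - (t - s))" using grid_dist[OF s] t by blast
    then show False by simp
  qed
  then show ?thesis unfolding generic_def using assms by blast
qed

text \<open>Reflection exposes the exponentially decaying factor 1/sin; the rest pairs each Gamma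
  with an \<open>rGamma\<close>, and such quotients grow subexponentially on the grid.\<close>

lemma E_eq:
  assumes t: "generic t"
  shows "E t = exp (- (\<i> * pi * t)) * (pi / sin (pi * (t - lam i))) * (\<Prod>l\<in>UNIV. Gamma (t - mu l) * rGamma (t - lam l))"
proof -
  have "t - lam i \<notin> \<int>" using t by (simp add: generic_def)
  then have "t - lam i \<notin> \<int>\<^sub>\<le>\<^sub>0" using nonpos_Ints_subset_Ints by blast
  then have nz: "Gamma (t - lam i) \<noteq> 0" "rGamma (t - lam i) * Gamma (t - lam i) = 1"
    by (simp_all add: Gamma_eq_zero_iff rGamma_inverse_Gamma)
  have "Gamma (1 - (t - lam i)) = (Gamma (t - lam i) * Gamma (1 - (t - lam i))) * rGamma (t - lam i)"
    using nz(2) by (simp add: mult_ac)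
  then have G: "Gamma (1 + lam i - t) = (pi / sin (pi * (t - lam i))) * rGamma (t - lam i)"
    unfolding Gamma_reflection_complex by (simp add: algebra_simps)
  have "(\<Prod>l\<in>UNIV. rGamma (t - lam l)) = rGamma (t - lam i) * (\<Prod>l\<in>UNIV - {i}. rGamma (t - lam l))"
    by (rule prod.remove) auto
  then show ?thesis
    unfolding E_def pm_def TT_def G prod.distrib by (simp add: mult_ac)
qed

lemma U_bound:
  assumes c: "\<And>l. Re (lam l) - c \<notin> \<int>" "\<And>l. Re (mu l) - c \<notin> \<int>"
    and Y: "\<And>l. \<bar>Im (lam l)\<bar> + 1 \<le> Y" "\<And>l. \<bar>Im (mu l)\<bar> + 1 \<le> Y"
  shows "\<exists>A C. A \<ge> 0 \<and> C \<ge> 0 \<and> (\<forall>t\<in>grid c Y. norm (U k t) \<le> A * exp (C * sqrt (norm t) + pi * Im t - pi * \<bar>Im t\<bar>))"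
proof -
  obtain A C where AC: "A \<ge> 0" "C \<ge> 0" "\<And>t. t \<in> grid c Y \<Longrightarrow>
      norm (\<Prod>l\<in>UNIV. Gamma (t - mu l) * rGamma (t - lam l)) \<le> A * exp (C * sqrt (norm t))"
    using prod_bound_sqrt_exp[of UNIV "grid c Y" "\<lambda>l t. Gamma (t - mu l) * rGamma (t - lam l)"]
      Gamma_ratio_bound_grid[OF c(2) Y(2)] by fastforce
  obtain A' where A': "A' > 0" "\<And>t. t \<in> grid c Y \<Longrightarrow> norm (pi / sin (pi * (t - lam i))) \<le> A' * exp (- pi * \<bar>Im t\<bar>)"
    using sin_pi_bound_grid[OF c(1) Y(1)] by blast
  obtain \<delta> where \<delta>: "\<delta> > 0" "\<And>t. t \<in> grid c Y \<Longrightarrow> \<delta> \<le> norm (t - lam k)"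
    using grid_dist[OF c(1) Y(1), of k] by (metis Ints_0 add.right_neutral)
  define B where "B = norm (d k) / \<delta> * (A' * A)"
  have "norm (U k t) \<le> B * exp (C * sqrt (norm t) + pi * Im t - pi * \<bar>Im t\<bar>)" if t: "t \<in> grid c Y" for t
  proof -
    have g: "generic t" by (rule grid_generic[OF c Y t])
    have "U k t = d k / (t - lam k) * E t"
      using U_E[OF g, of k] generic_not_S(3)[OF g, of k] by (simp add: field_simps)
    then have "norm (U k t) = norm (d k) / norm (t - lam k) * (exp (pi * Im t) * norm (pi / sin (pi * (t - lam i)))
       * norm (\<Prod>l\<in>UNIV. Gamma (t - mu l) * rGamma (t - lam l)))"
      unfolding E_eq[OF g] by (simp add: norm_mult norm_divide)
    also have "\<dots> \<le> norm (d k) / \<delta> * (exp (pi * Im t) * (A' * exp (- pi * \<bar>Im t\<bar>)) * (A * exp (C * sqrt (norm t))))"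
      using \<delta>(2)[OF t] \<delta>(1) A' AC t
      by (intro mult_mono divide_left_mono mult_pos_pos mult_nonneg_nonneg norm_ge_zero exp_ge_zero order.refl less_imp_le[OF A'(1)] divide_nonneg_nonneg) auto
    also have "\<dots> = B * (exp (C * sqrt (norm t)) * exp (pi * Im t) * exp (- pi * \<bar>Im t\<bar>))"
      unfolding B_def by (simp only: mult_ac times_divide_eq_left times_divide_eq_right)
    also have "exp (C * sqrt (norm t)) * exp (pi * Im t) * exp (- pi * \<bar>Im t\<bar>) = exp (C * sqrt (norm t) + pi * Im t - pi * \<bar>Im t\<bar>)"
      by (simp flip: exp_add)
    finally show ?thesis .
  qed
  moreover have "B \<ge> 0" using AC A' \<delta> by (simp add: B_def)
  ultimately show ?thesis using AC(2) by blast
qed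

lemma finite_S_strip: "finite {s \<in> S. a \<le> Re s \<and> Re s \<le> b}"
proof (rule finite_subset)
  show "{s \<in> S. a \<le> Re s \<and> Re s \<le> b} \<subseteq> (\<lambda>n. lam i + of_nat n) ` {.. nat \<lceil>b - Re (lam i)\<rceil>}
      \<union> (\<Union>j. (\<lambda>n. mu j - of_nat n) ` {.. nat \<lceil>Re (mu j) - a\<rceil>})"
  proof
    fix s assume s: "s \<in> {s \<in> S. a \<le> Re s \<and> Re s \<le> b}"
    then consider n where "s = lam i + of_nat n" | j n where "s = mu j - of_nat n" by (auto simp: S_def)
    then show "s \<in> (\<lambda>n. lam i + of_nat n) ` {.. nat \<lceil>b - Re (lam i)\<rceil>}
      \<union> (\<Union>j. (\<lambda>n. mu j - of_nat n) ` {.. nat \<lceil>Re (mu j) - a\<rceil>})"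
    proof cases
      case (1 n)
      then have "n \<le> nat \<lceil>b - Re (lam i)\<rceil>" using s by simp linarith
      then show ?thesis using 1 by blast
    next
      case (2 j n)
      then have "n \<le> nat \<lceil>Re (mu j) - a\<rceil>" using s by simp linarith
      then show ?thesis using 2 by blast
    qed
  qed
qed simp

lemma barnes_kernel_U:
  obtains c Y A C where "\<And>l. Re (lam l) < c" "\<And>l. Re (mu l) < c" "\<And>k. barnes_kernel (U k) S (R k) c Y (A k) (C k)"
proof -
  obtain c where c: "\<forall>x\<in>Re ` range lam \<union> Re ` range mu. x < c \<and> x - c \<notin> \<int>"
    using exists_abscissa[of "Re ` range lam \<union> Re ` range mu"] by auto
  define Y where "Y = Max ((\<lambda>s. \<bar>Im s\<bar>) ` (range lam \<union> range mu)) + 1"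
  have Y: "\<bar>Im s\<bar> + 1 \<le> Y" if "s \<in> range lam \<union> range mu" for s
    unfolding Y_def using that by (intro add_right_mono Max_ge) auto
  have c': "Re (lam l) < c" "Re (mu l) < c" "Re (lam l) - c \<notin> \<int>" "Re (mu l) - c \<notin> \<int>" for l
    using c by auto
  have Y': "\<bar>Im (lam l)\<bar> + 1 \<le> Y" "\<bar>Im (mu l)\<bar> + 1 \<le> Y" for l using Y by auto
  have avoid: "s \<notin> grid c Y" if "s \<in> S" for s
  proof
    assume "s \<in> grid c Y"
    then have "generic s" by (rule grid_generic[OF c'(3,4) Y'])
    then have "s \<notin> range (\<lambda>n. lam i + of_nat n)" "\<And>j. s \<notin> range (\<lambda>n. mu j - of_nat n)"
      using generic_not_S(1,2) minus_mu_nonpos by blast+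
    then show False using that unfolding S_def by blast
  qed
  have "\<exists>A C. barnes_kernel (U k) S (R k) c Y A C" for k
  proof -
    obtain A C where AC: "A \<ge> 0" "C \<ge> 0" "\<forall>t\<in>grid c Y. norm (U k t) \<le> A * exp (C * sqrt (norm t) + pi * Im t - pi * \<bar>Im t\<bar>)"
      using U_bound[OF c'(3,4) Y'] by blast
    have "barnes_kernel (U k) S (R k) c Y A C"
      by unfold_locales (use AC U_holomorphic finite_S_strip R_lim avoid in auto)
    then show ?thesis by blast
  qed
  then obtain A C where "\<And>k. barnes_kernel (U k) S (R k) c Y (A k) (C k)" by metis
  then show ?thesis using c' that by blast
qed

text \<open>A single holomorphic function is reached from one fixed line in two ways: shifting right
  for Re w < 0 collects the residues at lam i + n, shifting left for Re w > 0 collects those at mu j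
  - n with a minus sign.\<close>

lemma expansion:
  obtains \<Phi> where "\<And>k. \<Phi> k holomorphic_on log_strip"
    and "\<And>w k. w \<in> log_strip \<Longrightarrow> Re w < 0 \<Longrightarrow>
        (\<lambda>n. R k (lam i + of_nat n) * exp (w * (lam i + of_nat n))) sums \<Phi> k w"
    and "\<And>w. w \<in> log_strip \<Longrightarrow> Re w > 0 \<Longrightarrow>
        \<exists>N. (\<forall>j. filterlim (\<lambda>m. N m j) at_top sequentially) \<and>
          (\<forall>k. (\<lambda>m::nat. - (\<Sum>j\<in>UNIV. \<Sum>n<N m j. R k (mu j - of_nat n) * exp (w * (mu j - of_nat n)))) \<longlonglongrightarrow> \<Phi> k w)"
proof -
  obtain c Y A C where c: "\<And>l. Re (lam l) < c" "\<And>l. Re (mu l) < c"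
    and bk: "\<And>k. barnes_kernel (U k) S (R k) c Y (A k) (C k)"
    using barnes_kernel_U by blast
  define J where "J k = barnes_kernel.J (U k)" for k
  note shift = barnes_kernel.J_shift[OF bk, folded J_def]
  note null = barnes_kernel.J_tendsto_0[OF bk, folded J_def]
  define g where "g k w n = R k (lam i + of_nat n) * exp (w * (lam i + of_nat n))" for k w and n :: nat
  define h where "h k w j n = R k (mu j - of_nat n) * exp (w * (mu j - of_nat n))" for k w j and n :: nat
  define x where "x = c - Re (lam i)"
  \<comment> \<open>Counts the poles lam i + n to the left of the line over c.\<close>
  define N0 where "N0 = nat \<lceil>x\<rceil>"
  \<comment> \<open>Counts the poles mu j - n between the lines over c - m and c.\<close>
  define N where "N m j = nat \<lceil>real m - (c - Re (mu j))\<rceil>" for m :: nat and j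
  have x: "x > 0" using c by (simp add: x_def)
  have x_nonint: "x \<noteq> real n" for n
  proof
    assume "x = real n"
    then have "Re (lam i + of_nat n) - c = 0" by (simp add: x_def)
    then have "lam i + of_nat n \<in> grid c Y" by (simp only: grid_def mem_Collect_eq Ints_0 simp_thms)
    then show False using barnes_kernel.avoid[OF bk] by (auto simp: S_def)
  qed
  \<comment> \<open>The finite sum corrects for the poles lam i + n left of the line: it completes
    the series when shifting right and cancels their residues when shifting left.\<close>
  define \<Phi> where "\<Phi> k w = (\<Sum>n<N0. g k w n) - J k c w / (2 * pi)" for k w
  have inj_lam: "inj_on (\<lambda>n. lam i + of_nat n) X" for X by (rule inj_onI) simp
  have inj_mu: "inj_on (\<lambda>n. mu j - of_nat n) X" for j X by (rule inj_onI) simp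
  have right: "J k (c + real m) w - J k c w = 2 * pi * (\<Sum>n\<in>{N0..<N0+m}. g k w n)"
    if w: "w \<in> log_strip" for k m w
  proof (cases "m = 0")
    case False
    have "{s \<in> S. c < Re s \<and> Re s < c + real m} = (\<lambda>n. lam i + of_nat n) ` {N0..<N0+m}" (is "?L = ?R")
    proof (intro equalityI subsetI)
      fix s assume s: "s \<in> ?L"
      then consider n where "s = lam i + of_nat n" | j n where "s = mu j - of_nat n" by (auto simp: S_def)
      then show "s \<in> ?R"
      proof cases
        case (1 n)
        then have "x < real n" "real n < x + real m" using s by (auto simp: x_def)
        then have "N0 \<le> n" "n < N0 + m" unfolding N0_def by linarith+
        then show ?thesis using 1 by auto
      next
        case (2 j n)
        then show ?thesis using s c(2)[of j] by auto
      qed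
    next
      fix s assume "s \<in> ?R"
      then obtain n where n: "s = lam i + of_nat n" "N0 \<le> n" "n < N0 + m" by auto
      have "x \<le> real n" "real n < x + real m" using n(2,3) x unfolding N0_def by linarith+
      then have "x < real n" using x_nonint[of n] by linarith
      then show "s \<in> ?L" using n(1) \<open>real n < x + real m\<close> by (auto simp: S_def x_def)
    qed
    then have "(\<Sum>s | s \<in> S \<and> c < Re s \<and> Re s < c + real m. R k s * exp (w * s)) = (\<Sum>n\<in>{N0..<N0+m}. g k w n)"
      by (simp add: sum.reindex[OF inj_lam] g_def)
    then show ?thesis
      using shift[of c "c + real m" w k] False w by (simp add: log_strip_def)
  qed simp
  have left: "J k c w - J k (c - real m) w = 2 * pi * ((\<Sum>n<N0. g k w n) + (\<Sum>j\<in>UNIV. \<Sum>n<N m j. h k w j n))"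
    if w: "w \<in> log_strip" and m: "real m > x" for k m w
  proof -
    have "{s \<in> S. c - real m < Re s \<and> Re s < c} = (\<lambda>n. lam i + of_nat n) ` {..<N0} \<union> (\<Union>j. (\<lambda>n. mu j - of_nat n) ` {..<N m j})" (is "?L = ?R1 \<union> ?R2")
    proof (intro equalityI subsetI)
      fix s assume s: "s \<in> ?L"
      then consider n where "s = lam i + of_nat n" | j n where "s = mu j - of_nat n" by (auto simp: S_def)
      then show "s \<in> ?R1 \<union> ?R2"
      proof cases
        case (1 n)
        then have "real n < x" using s by (auto simp: x_def)
        then have "n < N0" unfolding N0_def by linarith
        then show ?thesis using 1 by auto
      next
        case (2 j n)
        then have "real n < real m - (c - Re (mu j))" using s by auto
        then have "n < N m j" unfolding N_def by linarith
        then show ?thesis using 2 by auto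
      qed
    next
      fix s assume "s \<in> ?R1 \<union> ?R2"
      then consider n where "s = lam i + of_nat n" "n < N0" | j n where "s = mu j - of_nat n" "n < N m j" by auto
      then show "s \<in> ?L"
      proof cases
        case (1 n)
        then have "real n < x" unfolding N0_def by linarith
        then show ?thesis using 1 m by (auto simp: S_def x_def)
      next
        case (2 j n)
        then have "real n < real m - (c - Re (mu j))" unfolding N_def by linarith
        then show ?thesis using 2 c(2)[of j] by (auto simp: S_def)
      qed
    qed
    then have "(\<Sum>s | s \<in> S \<and> c - real m < Re s \<and> Re s < c. R k s * exp (w * s)) = (\<Sum>s\<in>?R1 \<union> ?R2. R k s * exp (w * s))"
      by simp
    also have "\<dots> = (\<Sum>s\<in>?R1. R k s * exp (w * s)) + (\<Sum>s\<in>?R2. R k s * exp (w * s))"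
      using S_disjoint by (intro sum.union_disjoint) auto
    also have "(\<Sum>s\<in>?R2. R k s * exp (w * s)) = (\<Sum>j\<in>UNIV. \<Sum>s\<in>(\<lambda>n. mu j - of_nat n) ` {..<N m j}. R k s * exp (w * s))"
    proof (rule sum.UNION_disjoint)
      show "\<forall>j\<in>UNIV. \<forall>l\<in>UNIV. j \<noteq> l \<longrightarrow> (\<lambda>n. mu j - of_nat n) ` {..<N m j} \<inter> (\<lambda>n. mu l - of_nat n) ` {..<N m l} = {}"
      proof (intro ballI impI)
        fix j l :: 'a assume jl: "j \<noteq> l"
        have "mu j - of_nat n \<noteq> mu l - of_nat n'" for n n'
        proof
          assume "mu j - of_nat n = mu l - of_nat n'"
          then have "mu j - mu l = of_nat n - of_nat n'" by (simp add: algebra_simps)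
          also have "\<dots> \<in> \<int>" by simp
          finally show False using mu_diff_Ints[OF jl] by simp
        qed
        then show "(\<lambda>n. mu j - of_nat n) ` {..<N m j} \<inter> (\<lambda>n. mu l - of_nat n) ` {..<N m l} = {}" by auto
      qed
    qed auto
    finally have "(\<Sum>s | s \<in> S \<and> c - real m < Re s \<and> Re s < c. R k s * exp (w * s)) = (\<Sum>n<N0. g k w n) + (\<Sum>j\<in>UNIV. \<Sum>n<N m j. h k w j n)"
      by (simp add: sum.reindex[OF inj_lam] sum.reindex[OF inj_mu] g_def h_def)
    then show ?thesis
      using shift[of "c - real m" c w k] m x w by (simp add: log_strip_def)
  qed
  show ?thesis
  proof (rule that[of \<Phi>])
    show "\<Phi> k holomorphic_on log_strip" for k
    proof -
      have "J k c holomorphic_on log_strip"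
        unfolding J_def log_strip_def by (rule barnes_kernel.J_holomorphic[OF bk]) simp
      then show ?thesis unfolding \<Phi>_def g_def by (intro holomorphic_intros) auto
    qed
    show "(\<lambda>n. R k (lam i + of_nat n) * exp (w * (lam i + of_nat n))) sums \<Phi> k w"
      if w: "w \<in> log_strip" "Re w < 0" for w k
    proof -
      have "(\<lambda>m. J k (c + 1 * real m) w) \<longlonglongrightarrow> 0"
        using w by (intro null) (auto simp: log_strip_def)
      then have "(\<lambda>m. (\<Sum>n<N0. g k w n) + (J k (c + real m) w - J k c w) / (2 * pi)) \<longlonglongrightarrow> (\<Sum>n<N0. g k w n) + (0 - J k c w) / (2 * pi)"
        by (intro tendsto_intros) auto
      moreover have "(\<Sum>n<N0. g k w n) + (J k (c + real m) w - J k c w) / (2 * pi) = (\<Sum>n<m + N0. g k w n)" for m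
      proof -
        have "(\<Sum>n<m + N0. g k w n) = (\<Sum>n<N0. g k w n) + (\<Sum>n\<in>{N0..<N0+m}. g k w n)"
          using sum.atLeastLessThan_concat[of 0 N0 "N0 + m" "g k w"] by (simp add: atLeast0LessThan add.commute)
        then show ?thesis unfolding right[OF w(1)] by simp
      qed
      ultimately have "(\<lambda>m. \<Sum>n<m + N0. g k w n) \<longlonglongrightarrow> \<Phi> k w" by (simp add: \<Phi>_def)
      then have "(\<lambda>m. \<Sum>n<m. g k w n) \<longlonglongrightarrow> \<Phi> k w" by (rule LIMSEQ_offset)
      then show ?thesis by (simp add: sums_def g_def)
    qed
    show "\<exists>N. (\<forall>j. filterlim (\<lambda>m. N m j) at_top sequentially) \<and>
          (\<forall>k. (\<lambda>m::nat. - (\<Sum>j\<in>UNIV. \<Sum>n<N m j. R k (mu j - of_nat n) * exp (w * (mu j - of_nat n)))) \<longlonglongrightarrow> \<Phi> k w)"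
      if w: "w \<in> log_strip" "Re w > 0" for w
    proof (intro exI[of _ N] conjI allI)
      fix j
      show "filterlim (\<lambda>m. N m j) at_top sequentially"
        unfolding filterlim_at_top eventually_sequentially
      proof (intro allI)
        fix Z
        show "\<exists>M. \<forall>m\<ge>M. Z \<le> N m j"
        proof (intro exI[of _ "Z + nat \<lceil>c - Re (mu j)\<rceil>"] allI impI)
          fix m assume "m \<ge> Z + nat \<lceil>c - Re (mu j)\<rceil>"
          then show "Z \<le> N m j" unfolding N_def by linarith
        qed
      qed
    next
      fix k
      have "(\<lambda>m. J k (c + (-1) * real m) w) \<longlonglongrightarrow> 0"
        using w by (intro null) (auto simp: log_strip_def)
      then have "(\<lambda>m. J k (c - real m) w) \<longlonglongrightarrow> 0" by simp
      then have "(\<lambda>m. (\<Sum>n<N0. g k w n) - (J k c w - J k (c - real m) w) / (2 * pi)) \<longlonglongrightarrow> (\<Sum>n<N0. g k w n) - (J k c w - 0) / (2 * pi)"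
        by (intro tendsto_intros) auto
      then have lim: "(\<lambda>m. (\<Sum>n<N0. g k w n) - (J k c w - J k (c - real m) w) / (2 * pi)) \<longlonglongrightarrow> \<Phi> k w"
        by (simp add: \<Phi>_def)
      have ev: "eventually (\<lambda>m. (\<Sum>n<N0. g k w n) - (J k c w - J k (c - real m) w) / (2 * pi) = - (\<Sum>j\<in>UNIV. \<Sum>n<N m j. h k w j n)) sequentially"
        using eventually_gt_at_top[of "nat \<lceil>x\<rceil>"]
      proof eventually_elim
        case (elim m)
        then have "real m > x" by linarith
        from left[OF w(1) this, of k] show ?case by simp
      qed
      show "(\<lambda>m. - (\<Sum>j\<in>UNIV. \<Sum>n<N m j. R k (mu j - of_nat n) * exp (w * (mu j - of_nat n)))) \<longlonglongrightarrow> \<Phi> k w"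
        using Lim_transform_eventually[OF lim ev] unfolding h_def .
    qed
  qed
qed

end

subsection \<open>The connection formula\<close>

lemma tendsto_vector_scalar_mult:
  fixes f :: "'b \<Rightarrow> complex^'n::finite"
  assumes "(f \<longlongrightarrow> l) G"
  shows "((\<lambda>x. c *s f x) \<longlongrightarrow> c *s l) G"
  unfolding vector_scalar_mult_def
  by (intro vec_tendstoI) (simp, intro tendsto_mult tendsto_const tendsto_vec_nth assms)

lemma (in rank_one_pair) comb_sum: "comb (\<lambda>k. \<Sum>x\<in>A. f x k) = (\<Sum>x\<in>A. comb (f x))"
  unfolding comb_def vec.scale_sum_left by (rule sum.swap)

lemma (in rank_one_pair) comb_component: "comb c $ p = (\<Sum>k\<in>UNIV. c k * xi k $ p)"
  by (simp add: comb_def)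

lemma (in rank_one_pair) comb_tendsto:
  assumes "\<And>k. ((\<lambda>m. f m k) \<longlongrightarrow> l k) G"
  shows "((\<lambda>m. comb (f m)) \<longlongrightarrow> comb l) G"
  unfolding comb_component [symmetric]
  by (rule vec_tendstoI) (unfold comb_component, intro tendsto_intros assms)

context rank_one_connection
begin

text \<open>The truncations N m j differ in j because a vertical line cuts the pole sequences mu j - n at
  different indices; separate convergence of the series h_j comes from the flipped data.\<close>

lemma connection_expansion:
  assumes a: "a 0 = xi i" "formal_sol0 P Q (lam i) a"
    and b: "\<And>j. b j 0 = zeta j" "\<And>j. formal_sol_inf P Q (mu j) (b j)"
  obtains F :: "complex \<Rightarrow> complex^'a" where "\<And>p. (\<lambda>w. F w $ p) holomorphic_on log_strip"
    and "\<And>w. w \<in> log_strip \<Longrightarrow> Re w < 0 \<Longrightarrow> (\<lambda>n. exp (w * (lam i + of_nat n)) *s a n) sums F w"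
    and "\<And>w. w \<in> log_strip \<Longrightarrow> Re w > 0 \<Longrightarrow>
        \<exists>N. (\<forall>j. filterlim (\<lambda>m. N m j) at_top sequentially) \<and>
          (\<lambda>m::nat. \<Sum>j\<in>UNIV. conn i j *s (\<Sum>n<N m j. exp (w * (mu j - of_nat n)) *s b j n)) \<longlonglongrightarrow> F w"
proof (cases "\<exists>j p. mu j = lam i + of_nat p")
  case True
  then obtain j p where p: "mu j = lam i + of_nat p" by blast
  note res = resonant[OF a b(1)[of j] b(2)[of j] p]
  \<comment> \<open>In the resonant case f_i is a finite sum, the same reversed sum represents the
    single remaining term on the right, and no integral is involved.\<close>
  define F where "F w = (\<Sum>n<Suc p. exp (w * (lam i + of_nat n)) *s a n)" for w
  show ?thesis
  proof (rule that[of F])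
    show "(\<lambda>w. F w $ q) holomorphic_on log_strip" for q
      unfolding F_def by simp (intro holomorphic_intros)
    show "(\<lambda>n. exp (w * (lam i + of_nat n)) *s a n) sums F w" for w
      unfolding F_def by (rule sums_finite) (auto simp: res(1))
    show "\<exists>N. (\<forall>j. filterlim (\<lambda>m. N m j) at_top sequentially) \<and>
          (\<lambda>m::nat. \<Sum>j\<in>UNIV. conn i j *s (\<Sum>n<N m j. exp (w * (mu j - of_nat n)) *s b j n)) \<longlonglongrightarrow> F w" for w
    proof (intro exI[of _ "\<lambda>m j. m"] conjI allI filterlim_ident)
      have "(\<Sum>j\<in>UNIV. conn i j *s (\<Sum>n<m. exp (w * (mu j - of_nat n)) *s b j n)) = F w" if m: "m > p" for m
      proof -
        have "(\<Sum>j\<in>UNIV. conn i j *s (\<Sum>n<m. exp (w * (mu j - of_nat n)) *s b j n))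
            = (\<Sum>j\<in>{j}. conn i j *s (\<Sum>n<m. exp (w * (mu j - of_nat n)) *s b j n))"
          by (intro sum.mono_neutral_right) (auto simp: res(3))
        also have "\<dots> = (\<Sum>n<m. exp (w * (mu j - of_nat n)) *s (conn i j *s b j n))"
          by (simp add: vec.scale_sum_right vector_smult_assoc mult.commute)
        also have "\<dots> = (\<Sum>n<Suc p. exp (w * (mu j - of_nat n)) *s a (p - n))"
          using m by (intro sum.mono_neutral_cong_right) (auto simp: res(2))
        also have "\<dots> = (\<Sum>n<Suc p. exp (w * (lam i + of_nat (Suc p - Suc n))) *s a (Suc p - Suc n))"
          by (intro sum.cong) (auto simp: p of_nat_diff algebra_simps)
        also have "\<dots> = F w"
          unfolding F_def by (rule sum.nat_diff_reindex)
        finally show ?thesis .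
      qed
      then show "(\<lambda>m::nat. \<Sum>j\<in>UNIV. conn i j *s (\<Sum>n<m. exp (w * (mu j - of_nat n)) *s b j n)) \<longlonglongrightarrow> F w"
        by (intro tendsto_eventually) (auto simp: eventually_sequentially intro!: exI[of _ "Suc p"])
    qed
  qed
next
  case False
  interpret flip: rank_one_connection "Q - P" Q phi v "\<lambda>j. - mu j" "\<lambda>k. - lam k" zeta xi e d by (rule flip)
  interpret nonresonant P Q phi v lam mu xi zeta d i
  proof unfold_locales
    show "mu j - lam i \<noteq> of_nat p" for j p using False by (metis add.commute diff_add_cancel)
  qed
  obtain \<Phi> where \<Phi>: "\<And>k. \<Phi> k holomorphic_on log_strip"
    "\<And>w k. w \<in> log_strip \<Longrightarrow> Re w < 0 \<Longrightarrow>
        (\<lambda>n. R k (lam i + of_nat n) * exp (w * (lam i + of_nat n))) sums \<Phi> k w"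
    "\<And>w. w \<in> log_strip \<Longrightarrow> Re w > 0 \<Longrightarrow>
        \<exists>N. (\<forall>j. filterlim (\<lambda>m. N m j) at_top sequentially) \<and>
          (\<forall>k. (\<lambda>m::nat. - (\<Sum>j\<in>UNIV. \<Sum>n<N m j. R k (mu j - of_nat n) * exp (w * (mu j - of_nat n)))) \<longlonglongrightarrow> \<Phi> k w)"
    using expansion by blast
  \<comment> \<open>Uniqueness of the formal solution: the residues at lam i + n are
    \<open>\<kappa>\<close> times the coefficients of f_i.\<close>
  have A: "a n = comb (\<lambda>k. 1 / \<kappa> * R k (lam i + of_nat n))" for n
  proof -
    have "comb (\<lambda>k. R k (lam i + of_nat n)) = \<kappa> *s a n"
      using formal_sol0_unique[OF a residues_formal_sol0, of n] by (simp add: dual_app_comb sum_R_lam)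
    then have "(1 / \<kappa>) *s comb (\<lambda>k. R k (lam i + of_nat n)) = a n"
      using \<kappa>_nz by (simp add: vector_smult_assoc)
    then show ?thesis by (simp add: comb_smult)
  qed
  \<comment> \<open>Uniqueness for the exchanged data, with leading value - \<kappa> c_ij. The minus
    sign cancels the one from shifting the line to the left.\<close>
  have B: "conn i j *s b j n = comb (\<lambda>k. - (1 / \<kappa>) * R k (mu j - of_nat n))" for j n
  proof -
    have "comb (\<lambda>k. R k (mu j - of_nat n)) = dual_app phi (comb (\<lambda>k. R k (mu j - of_nat 0))) *s b j n"
      using flip.formal_sol0_unique[where a = "b j" and i = j and B = "\<lambda>n. comb (\<lambda>k. R k (mu j - of_nat n))" and n = n]
        b[of j] residues_formal_sol_inf[of j] unfolding formal_sol_inf_iff by blast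
    then have "comb (\<lambda>k. R k (mu j - of_nat n)) = (- \<kappa> * conn i j) *s b j n"
      by (simp add: dual_app_comb sum_R_mu)
    then have "(- (1 / \<kappa>)) *s comb (\<lambda>k. R k (mu j - of_nat n)) = (- (1 / \<kappa>)) *s ((- \<kappa> * conn i j) *s b j n)"
      by simp
    also have "\<dots> = conn i j *s b j n"
      unfolding vector_smult_assoc using \<kappa>_nz by simp
    finally show ?thesis by (simp only: comb_smult)
  qed
  define F where "F w = comb (\<lambda>k. 1 / \<kappa> * \<Phi> k w)" for w
  show ?thesis
  proof (rule that[of F])
    show "(\<lambda>w. F w $ q) holomorphic_on log_strip" for q
      unfolding F_def comb_component by (intro holomorphic_intros \<Phi>(1))
    show "(\<lambda>n. exp (w * (lam i + of_nat n)) *s a n) sums F w" if w: "w \<in> log_strip" "Re w < 0" for w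
    proof -
      have "(\<Sum>n<m. exp (w * (lam i + of_nat n)) *s a n)
          = comb (\<lambda>k. 1 / \<kappa> * (\<Sum>n<m. R k (lam i + of_nat n) * exp (w * (lam i + of_nat n))))" for m
        unfolding A comb_smult comb_sum[symmetric] comb_eq_iff sum_distrib_left
        by (simp add: mult_ac)
      then show ?thesis
        unfolding sums_def F_def using \<Phi>(2)[OF w] unfolding sums_def
        by (simp only:) (intro comb_tendsto tendsto_intros)
    qed
    show "\<exists>N. (\<forall>j. filterlim (\<lambda>m. N m j) at_top sequentially) \<and>
          (\<lambda>m::nat. \<Sum>j\<in>UNIV. conn i j *s (\<Sum>n<N m j. exp (w * (mu j - of_nat n)) *s b j n)) \<longlonglongrightarrow> F w"
      if w: "w \<in> log_strip" "Re w > 0" for w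
    proof -
      obtain N where N: "\<And>j. filterlim (\<lambda>m. N m j) at_top sequentially"
         "\<And>k. (\<lambda>m::nat. - (\<Sum>j\<in>UNIV. \<Sum>n<N m j. R k (mu j - of_nat n) * exp (w * (mu j - of_nat n)))) \<longlonglongrightarrow> \<Phi> k w"
        using \<Phi>(3)[OF w] by blast
      have "(\<Sum>j\<in>UNIV. conn i j *s (\<Sum>n<N m j. exp (w * (mu j - of_nat n)) *s b j n))
         = comb (\<lambda>k. 1 / \<kappa> * (- (\<Sum>j\<in>UNIV. \<Sum>n<N m j. R k (mu j - of_nat n) * exp (w * (mu j - of_nat n)))))" for m
      proof -
        have "conn i j *s (\<Sum>n<N m j. exp (w * (mu j - of_nat n)) *s b j n)
            = (\<Sum>n<N m j. exp (w * (mu j - of_nat n)) *s (conn i j *s b j n))" for j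
          unfolding vec.scale_sum_right by (intro sum.cong refl) (simp add: vector_smult_assoc mult.commute)
        then have "(\<Sum>j\<in>UNIV. conn i j *s (\<Sum>n<N m j. exp (w * (mu j - of_nat n)) *s b j n))
            = comb (\<lambda>k. \<Sum>j\<in>UNIV. \<Sum>n<N m j. exp (w * (mu j - of_nat n)) * (- (1 / \<kappa>) * R k (mu j - of_nat n)))"
          by (simp only: B comb_smult comb_sum)
        also have "\<dots> = comb (\<lambda>k. 1 / \<kappa> * (- (\<Sum>j\<in>UNIV. \<Sum>n<N m j. R k (mu j - of_nat n) * exp (w * (mu j - of_nat n)))))"
          unfolding comb_eq_iff sum_negf[symmetric] sum_distrib_left
          by (intro ext sum.cong refl) simp
        finally show ?thesis .
      qed
      then have "(\<lambda>m::nat. \<Sum>j\<in>UNIV. conn i j *s (\<Sum>n<N m j. exp (w * (mu j - of_nat n)) *s b j n)) \<longlonglongrightarrow> F w"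
        unfolding F_def by (simp only:) (intro comb_tendsto tendsto_mult tendsto_const N(2))
      then show ?thesis using N(1) by blast
    qed
  qed
qed

end

section \<open>The branch of the logarithm and the final assembly\<close>

lemma uminus_notin_nonpos_Reals:
  assumes "z \<in> - {complex_of_real t | t. 0 \<le> t}"
  shows "- z \<notin> \<real>\<^sub>\<le>\<^sub>0"
  using assms by (auto elim: nonneg_Reals_cases)

text \<open>Rotating by pi moves the cut of the principal logarithm from the negative to the
  positive real axis.\<close>

lemma cut_log_eq:
  assumes "z \<in> - {complex_of_real t | t. 0 \<le> t}"
  shows "cut_log z = Ln (- z) + \<i> * pi" "cut_log z \<in> log_strip" "Re (cut_log z) = ln (norm z)"
proof -
  have z0: "z \<noteq> 0" using assms by (auto simp: image_iff intro: exI[of _ 0])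
  have nz: "- z \<notin> \<real>\<^sub>\<le>\<^sub>0" using assms by (rule uminus_notin_nonpos_Reals)
  define w where "w = Ln (- z) + \<i> * pi"
  have w: "exp w = z" using z0 by (simp add: w_def exp_add)
  have im: "0 < Im w" "Im w < 2 * pi"
    using nz mpi_less_Im_Ln[of "- z"] Im_Ln_less_pi[of "- z"] z0 by (auto simp: w_def)
  have "cut_log z = w"
    unfolding cut_log_def
  proof (rule the_equality)
    fix u assume u: "exp u = z \<and> 0 < Im u \<and> Im u < 2 * pi"
    show "u = w" by (rule exp_complex_eqI) (use u w im in auto)
  qed (use w im in auto)
  then show "cut_log z = Ln (- z) + \<i> * pi" "cut_log z \<in> log_strip" "Re (cut_log z) = ln (norm z)"
    using im z0 by (auto simp: w_def log_strip_def)
qed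

lemma cut_log_holomorphic: "cut_log holomorphic_on - {complex_of_real t | t. 0 \<le> t}"
proof -
  have "(\<lambda>z. Ln (- z) + \<i> * pi) holomorphic_on - {complex_of_real t | t. 0 \<le> t}"
    by (intro holomorphic_intros uminus_notin_nonpos_Reals)
  then show ?thesis by (rule holomorphic_transform) (simp only: cut_log_eq(1))
qed

lemma cut_pow_alt: "cut_pow z s = exp (cut_log z * s)"
  by (simp add: cut_pow_def mult.commute)

theorem mainTheorem12:
  fixes P Q :: "complex^'n::finite^'n"
    and phi v :: "complex^'n"
    and lam mu :: "'n \<Rightarrow> complex"
    and xi zeta :: "'n \<Rightarrow> complex^'n"
    and a b :: "'n \<Rightarrow> nat \<Rightarrow> complex^'n"
  assumes Q_rank1: "\<forall>x. Q *v x = dual_app phi x *s v"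
    and delta_nz: "dual_app phi v \<noteq> 0"
    and lam_inj: "inj lam"
    and lam_nodiff: "no_pos_int_diff lam"
    and xi_eig: "\<forall>i. P *v xi i = lam i *s xi i"
    and xi_norm: "\<forall>i. dual_app phi (xi i) = 1"
    and v_gen_P: "\<exists>d::'n \<Rightarrow> complex. (\<forall>i. d i \<noteq> 0) \<and> v = (\<Sum>i\<in>UNIV. d i *s xi i)"
    and mu_inj: "inj mu"
    and mu_nodiff: "no_pos_int_diff mu"
    and zeta_eig: "\<forall>j. (Q - P) *v zeta j = (- mu j) *s zeta j"
    and zeta_norm: "\<forall>j. dual_app phi (zeta j) = 1"
    and v_gen_R: "\<exists>d::'n \<Rightarrow> complex. (\<forall>j. d j \<noteq> 0) \<and> v = (\<Sum>j\<in>UNIV. d j *s zeta j)"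
    and a_sol: "\<forall>i. a i 0 = xi i \<and> formal_sol0 P Q (lam i) (a i)"
    and b_sol: "\<forall>j. b j 0 = zeta j \<and> formal_sol_inf P Q (mu j) (b j)"
  shows "(\<forall>i. \<forall>z. norm z < 1 \<and> z \<notin> {complex_of_real t | t. 0 \<le> t \<and> t < 1} \<longrightarrow>
             summable (\<lambda>n. cut_pow z (lam i + of_nat n) *s a i n))
       \<and> (\<forall>j. \<forall>z. norm z > 1 \<and> z \<notin> {complex_of_real t | t. 1 \<le> t} \<longrightarrow>
             summable (\<lambda>n. cut_pow z (mu j - of_nat n) *s b j n))
       \<and> (\<exists>F H :: 'n \<Rightarrow> complex \<Rightarrow> complex^'n.
            (\<forall>i k. (\<lambda>z. F i z $ k) holomorphic_on (- {complex_of_real t | t. 0 \<le> t}))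
          \<and> (\<forall>j k. (\<lambda>z. H j z $ k) holomorphic_on (- {complex_of_real t | t. 0 \<le> t}))
          \<and> (\<forall>i. \<forall>z. norm z < 1 \<and> z \<notin> {complex_of_real t | t. 0 \<le> t \<and> t < 1} \<longrightarrow>
                 F i z = (\<Sum>n. cut_pow z (lam i + of_nat n) *s a i n))
          \<and> (\<forall>j. \<forall>z. norm z > 1 \<and> z \<notin> {complex_of_real t | t. 1 \<le> t} \<longrightarrow>
                 H j z = (\<Sum>n. cut_pow z (mu j - of_nat n) *s b j n))
          \<and> (\<forall>i. \<forall>z \<in> - {complex_of_real t | t. 0 \<le> t}.
                 F i z = (\<Sum>j\<in>UNIV.
                   (exp (\<i> * pi * (lam i - mu j))
                    * (\<Prod>k\<in>UNIV - {i}. Gamma (lam i - lam k + 1))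
                    * (\<Prod>m\<in>UNIV - {j}. Gamma (mu j - mu m))
                    * (\<Prod>m\<in>UNIV - {j}. rGamma (lam i - mu m + 1))
                    * (\<Prod>k\<in>UNIV - {i}. rGamma (mu j - lam k))) *s H j z)))"
proof -
  obtain d where d: "\<And>i. d i \<noteq> 0" "v = (\<Sum>i\<in>UNIV. d i *s xi i)" using v_gen_P by blast
  obtain e where e: "\<And>j. e j \<noteq> 0" "v = (\<Sum>j\<in>UNIV. e j *s zeta j)" using v_gen_R by blast
  interpret L: rank_one_connection P Q phi v lam mu xi zeta d e
    by (intro rank_one_connection.intro rank_one_pair.intro rank_one_connection_axioms.intro)
       (use assms(1,3-6,8-11) d e in \<open>fact | blast\<close>)+
  interpret flip: rank_one_connection "Q - P" Q phi v "\<lambda>j. - mu j" "\<lambda>k. - lam k" zeta xi e d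
    by (rule L.flip)
  \<comment> \<open>Bundles the conclusions into one predicate so that a function can be chosen for
    every i at once.\<close>
  define is_F where "is_F i F \<longleftrightarrow> (\<forall>p. (\<lambda>w. F w $ p) holomorphic_on log_strip) \<and>
      (\<forall>w. w \<in> log_strip \<longrightarrow> Re w < 0 \<longrightarrow> (\<lambda>n. exp (w * (lam i + of_nat n)) *s a i n) sums F w) \<and>
      (\<forall>w. w \<in> log_strip \<longrightarrow> Re w > 0 \<longrightarrow>
        (\<exists>N. (\<forall>j. filterlim (\<lambda>m. N m j) at_top sequentially) \<and>
          (\<lambda>m::nat. \<Sum>j\<in>UNIV. L.conn i j *s (\<Sum>n<N m j. exp (w * (mu j - of_nat n)) *s b j n)) \<longlonglongrightarrow> F w))"
    for i and F :: "complex \<Rightarrow> complex^'n"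
  have "\<exists>F. is_F i F" for i
  proof -
    have "a i 0 = xi i" "formal_sol0 P Q (lam i) (a i)" "\<And>j. b j 0 = zeta j" "\<And>j. formal_sol_inf P Q (mu j) (b j)"
      using a_sol b_sol by blast+
    from this show ?thesis
    proof (rule L.connection_expansion)
      fix F :: "complex \<Rightarrow> complex^'n"
      assume *: "\<And>p. (\<lambda>w. F w $ p) holomorphic_on log_strip"
        "\<And>w. w \<in> log_strip \<Longrightarrow> Re w < 0 \<Longrightarrow> (\<lambda>n. exp (w * (lam i + of_nat n)) *s a i n) sums F w"
        "\<And>w. w \<in> log_strip \<Longrightarrow> Re w > 0 \<Longrightarrow>
          \<exists>N. (\<forall>j. filterlim (\<lambda>m. N m j) at_top sequentially) \<and>
          (\<lambda>m::nat. \<Sum>j\<in>UNIV. L.conn i j *s (\<Sum>n<N m j. exp (w * (mu j - of_nat n)) *s b j n)) \<longlonglongrightarrow> F w"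
      have "is_F i F" unfolding is_F_def by (intro conjI allI impI) (rule *; assumption)+
      then show ?thesis by blast
    qed
  qed
  then obtain F0 where "\<And>i. is_F i (F0 i)" by metis
  then have F0: "(\<lambda>w. F0 i w $ p) holomorphic_on log_strip"
      "w \<in> log_strip \<Longrightarrow> Re w < 0 \<Longrightarrow> (\<lambda>n. exp (w * (lam i + of_nat n)) *s a i n) sums F0 i w"
      "w \<in> log_strip \<Longrightarrow> Re w > 0 \<Longrightarrow>
        \<exists>N. (\<forall>j. filterlim (\<lambda>m. N m j) at_top sequentially) \<and>
          (\<lambda>m::nat. \<Sum>j\<in>UNIV. L.conn i j *s (\<Sum>n<N m j. exp (w * (mu j - of_nat n)) *s b j n)) \<longlonglongrightarrow> F0 i w"
    for i p w unfolding is_F_def by simp_all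
  define is_G where "is_G j G \<longleftrightarrow> (\<forall>p. (\<lambda>w. G w $ p) holomorphic_on log_strip) \<and>
      (\<forall>w. w \<in> log_strip \<longrightarrow> Re w < 0 \<longrightarrow> (\<lambda>n. exp (w * (- mu j + of_nat n)) *s b j n) sums G w)"
    for j and G :: "complex \<Rightarrow> complex^'n"
  \<comment> \<open>The f-part of the result for Q - P: as a function of 1/z, h_j is a solution at 0
    with exponent - mu j.\<close>
  have "\<exists>G. is_G j G" for j
  proof -
    have "b j 0 = zeta j" "formal_sol0 (Q - P) Q (- mu j) (b j)" "\<And>i. a i 0 = xi i"
      "\<And>i. formal_sol_inf (Q - P) Q (- lam i) (a i)"
      using a_sol b_sol unfolding formal_sol_inf_iff by simp_all
    from this show ?thesis
    proof (rule flip.connection_expansion)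
      fix G :: "complex \<Rightarrow> complex^'n"
      assume *: "\<And>p. (\<lambda>w. G w $ p) holomorphic_on log_strip"
        "\<And>w. w \<in> log_strip \<Longrightarrow> Re w < 0 \<Longrightarrow> (\<lambda>n. exp (w * (- mu j + of_nat n)) *s b j n) sums G w"
      have "is_G j G" unfolding is_G_def by (intro conjI allI impI) (rule *; assumption)+
      then show ?thesis by blast
    qed
  qed
  then obtain G0 where "\<And>j. is_G j (G0 j)" by metis
  then have G0: "(\<lambda>w. G0 j w $ p) holomorphic_on log_strip"
      "w \<in> log_strip \<Longrightarrow> Re w < 0 \<Longrightarrow> (\<lambda>n. exp (w * (- mu j + of_nat n)) *s b j n) sums G0 j w"
    for j p w unfolding is_G_def by simp_all
  \<comment> \<open>The substitution z -> 1/z is w -> 2 pi i - w, since - w would leave the strip.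
    The prefactor undoes the resulting exp (- 2 pi i mu j); the integers n contribute only exp (2 pi
    i n) = 1.\<close>
  define H0 where "H0 j w = exp (2 * pi * \<i> * mu j) *s G0 j (2 * pi * \<i> - w)" for j w
  have refl: "2 * pi * \<i> - w \<in> log_strip" if "w \<in> log_strip" for w
    using that by (auto simp: log_strip_def)
  have H0_holo: "(\<lambda>w. H0 j w $ p) holomorphic_on log_strip" for j p
  proof -
    have "(\<lambda>w. G0 j (2 * pi * \<i> - w) $ p) holomorphic_on log_strip"
      using refl by (intro holomorphic_on_compose_gen[OF _ G0(1), unfolded o_def] holomorphic_intros) auto
    then show ?thesis unfolding H0_def by simp (intro holomorphic_intros)
  qed
  have H0_sums: "(\<lambda>n. exp (w * (mu j - of_nat n)) *s b j n) sums H0 j w" if w: "w \<in> log_strip" "Re w > 0" for j w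
  proof -
    have "(\<lambda>n. exp ((2 * pi * \<i> - w) * (- mu j + of_nat n)) *s b j n) sums G0 j (2 * pi * \<i> - w)"
      using w refl by (intro G0(2)) auto
    then have "(\<lambda>n. exp (2 * pi * \<i> * mu j) *s (exp ((2 * pi * \<i> - w) * (- mu j + of_nat n)) *s b j n)) sums H0 j w"
      unfolding H0_def sums_def vec.scale_sum_right [symmetric]
      by (rule tendsto_vector_scalar_mult)
    moreover have "exp (2 * pi * \<i> * mu j) * exp ((2 * pi * \<i> - w) * (- mu j + of_nat n)) = exp (w * (mu j - of_nat n))" for n
    proof -
      have "exp (2 * pi * \<i> * mu j) * exp ((2 * pi * \<i> - w) * (- mu j + of_nat n))
          = exp (w * (mu j - of_nat n)) * exp (of_nat n * (2 * pi * \<i>))"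
        unfolding exp_add[symmetric] by (simp add: algebra_simps)
      also have "exp (of_nat n * (2 * pi * \<i>)) = 1"
        unfolding exp_of_nat_mult by simp
      finally show ?thesis by simp
    qed
    ultimately show ?thesis by (simp add: vector_smult_assoc)
  qed
  \<comment> \<open>Each h_j is now known to converge, so the partial sums may be taken to infinity
    at different speeds \<open>N m j\<close> and the joint limit splits.\<close>
  have right: "F0 i w = (\<Sum>j\<in>UNIV. L.conn i j *s H0 j w)" if w: "w \<in> log_strip" "Re w > 0" for i w
  proof -
    obtain N where N: "\<And>j. filterlim (\<lambda>m. N m j) at_top sequentially"
        "(\<lambda>m::nat. \<Sum>j\<in>UNIV. L.conn i j *s (\<Sum>n<N m j. exp (w * (mu j - of_nat n)) *s b j n)) \<longlonglongrightarrow> F0 i w"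
      using F0(3)[OF w] by blast
    have "(\<lambda>m. \<Sum>n<N m j. exp (w * (mu j - of_nat n)) *s b j n) \<longlonglongrightarrow> H0 j w" for j
      using filterlim_compose[OF H0_sums[OF w, of j, unfolded sums_def] N(1)[of j]] .
    then have "(\<lambda>m. L.conn i j *s (\<Sum>n<N m j. exp (w * (mu j - of_nat n)) *s b j n)) \<longlonglongrightarrow> L.conn i j *s H0 j w" for j
      by (rule tendsto_vector_scalar_mult)
    then have "(\<lambda>m. \<Sum>j\<in>UNIV. L.conn i j *s (\<Sum>n<N m j. exp (w * (mu j - of_nat n)) *s b j n)) \<longlonglongrightarrow> (\<Sum>j\<in>UNIV. L.conn i j *s H0 j w)"
      by (intro tendsto_sum)
    then show ?thesis using N(2) LIMSEQ_unique by blast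
  qed
  have strip: "open log_strip" "connected log_strip"
  proof -
    show "open log_strip" unfolding log_strip_def
      by (intro open_Collect_conj open_Collect_less continuous_intros)
    have "convex ({w. 0 < Im w} \<inter> {w. Im w < 2 * pi})"
      by (intro convex_Int convex_halfspace_Im_gt convex_halfspace_Im_lt)
    also have "{w. 0 < Im w} \<inter> {w. Im w < 2 * pi} = log_strip" by (auto simp: log_strip_def)
    finally have "convex log_strip" .
    then show "connected log_strip" by (rule convex_connected)
  qed
  \<comment> \<open>The identity on the right half of the connected strip extends by analytic
    continuation, one component at a time.\<close>
  have connect: "F0 i w = (\<Sum>j\<in>UNIV. L.conn i j *s H0 j w)" if w: "w \<in> log_strip" for i w
    unfolding vec_eq_iff
  proof
    fix p
    show "F0 i w $ p = (\<Sum>j\<in>UNIV. L.conn i j *s H0 j w) $ p"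
    proof (rule analytic_continuation_open[where s = "log_strip \<inter> {w. Re w > 0}" and s' = log_strip
          and f = "\<lambda>w. F0 i w $ p" and g = "\<lambda>w. (\<Sum>j\<in>UNIV. L.conn i j *s H0 j w) $ p"])
      show "open (log_strip \<inter> {w. Re w > 0})" by (intro open_Int strip open_halfspace_Re_gt)
      have "1 + \<i> * pi \<in> log_strip \<inter> {w. Re w > 0}" by (simp add: log_strip_def)
      then show "log_strip \<inter> {w. Re w > 0} \<noteq> {}" by blast
      show "(\<lambda>w. (\<Sum>j\<in>UNIV. L.conn i j *s H0 j w) $ p) holomorphic_on log_strip"
        by simp (intro holomorphic_intros H0_holo)
    qed (use strip F0(1) right w in auto)
  qed
  define F H :: "'n \<Rightarrow> complex \<Rightarrow> complex^'n" where "F i z = F0 i (cut_log z)" and "H j z = H0 j (cut_log z)" for i j z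
  \<comment> \<open>For |z| < 1, excluding [0, 1) is the same as excluding [0, infinity), and |z| <
    1 means Re (log z) < 0.\<close>
  have small: "z \<in> - {complex_of_real t | t. 0 \<le> t} \<and> Re (cut_log z) < 0"
    if "norm z < 1" "z \<notin> {complex_of_real t | t. 0 \<le> t \<and> t < 1}" for z
  proof -
    have z: "z \<in> - {complex_of_real t | t. 0 \<le> t}" using that by auto
    then have "z \<noteq> 0" by (auto intro: exI[of _ 0])
    then show ?thesis using z that by (simp add: cut_log_eq(3))
  qed
  have large: "z \<in> - {complex_of_real t | t. 0 \<le> t} \<and> Re (cut_log z) > 0"
    if "norm z > 1" "z \<notin> {complex_of_real t | t. 1 \<le> t}" for z
  proof -
    have z: "z \<in> - {complex_of_real t | t. 0 \<le> t}" using that by auto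
    have "Re (cut_log z) > 0" unfolding cut_log_eq(3)[OF z] using that(1) by (rule ln_gt_zero)
    then show ?thesis using z by blast
  qed
  have F_sums: "(\<lambda>n. cut_pow z (lam i + of_nat n) *s a i n) sums F i z"
    if "norm z < 1" "z \<notin> {complex_of_real t | t. 0 \<le> t \<and> t < 1}" for i z
    unfolding cut_pow_alt F_def using small[OF that] by (intro F0(2) cut_log_eq) auto
  have H_sums: "(\<lambda>n. cut_pow z (mu j - of_nat n) *s b j n) sums H j z"
    if "norm z > 1" "z \<notin> {complex_of_real t | t. 1 \<le> t}" for j z
    unfolding cut_pow_alt H_def using large[OF that] by (intro H0_sums cut_log_eq) auto
  have maps: "cut_log ` (- {complex_of_real t | t. 0 \<le> t}) \<subseteq> log_strip" using cut_log_eq(2) by blast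
  have F_holo: "(\<lambda>z. F i z $ k) holomorphic_on (- {complex_of_real t | t. 0 \<le> t})" for i k
    unfolding F_def using maps
    by (intro holomorphic_on_compose_gen[OF cut_log_holomorphic F0(1), unfolded o_def])
  have H_holo: "(\<lambda>z. H j z $ k) holomorphic_on (- {complex_of_real t | t. 0 \<le> t})" for j k
    unfolding H_def using maps
    by (intro holomorphic_on_compose_gen[OF cut_log_holomorphic H0_holo, unfolded o_def])
  have F_H: "F i z = (\<Sum>j\<in>UNIV. L.conn i j *s H j z)" if "z \<in> - {complex_of_real t | t. 0 \<le> t}" for i z
    unfolding F_def H_def using cut_log_eq(2)[OF that] by (rule connect)
  show ?thesis
    unfolding L.conn_def [symmetric]
  proof (intro conjI, goal_cases)
    case 1
    show ?case using F_sums by (blast intro: sums_summable)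
  next
    case 2
    show ?case using H_sums by (blast intro: sums_summable)
  next
    case 3
    show ?case
    proof (rule exI[of _ F], rule exI[of _ H], intro conjI allI impI ballI, goal_cases)
      case (1 i k)
      show ?case by (rule F_holo)
    next
      case (2 j k)
      show ?case by (rule H_holo)
    next
      case (3 i z)
      then show ?case using F_sums by (blast intro: sums_unique)
    next
      case (4 j z)
      then show ?case using H_sums by (blast intro: sums_unique)
    next
      case (5 i z)
      then show ?case by (rule F_H)
    qed
  qed
qed

end
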